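(* Let $F=(N,F,\{F_\sigma\})$ be a KM fan, $\Lambda=\Lambda(F)$. Then $\mathbb U(F):=(\Lambda,\{i(\sigma):\sigma\in F\},\{i_\sigma(F_\sigma):\sigma\in F\})$ is a KM fan (the unfolding of $F$), and $\beta:\Lambda\to N$ defines a semi-tame morphism of KM fans $\beta:\mathbb U(F)\to F$ which is initial among all semi-tame morphisms with codomain $F$: for every semi-tame morphism $f:F'\to F$ there is a unique morphism $g:\mathbb U(F)\to F'$ with $fg=\beta$. If $F$ is atoroidal and $\operatorname{Ker}(\beta:\Lambda\to N)$ is torsion-free, then $\beta:\mathbb U(F)\to F$ is tame. The construction $F\mapsto\mathbb U(F)$ (together with $\beta$) is functorial in $F$ and takes semi-tame morphisms to isomorphisms. The rigidification of $\mathbb U(F)$ is $\mathbb U^{\rm rig}(F)=(\overline\Lambda,\{i(\sigma)\},\{\overline i_\sigma(F_\sigma)\})$ (the rigidified unfolding). Assume now $N$ is a lattice. Then $\overline\beta:\overline\Lambda\to N$ defines a semi-tame morphism $\overline\beta:\mathbb U^{\rm rig}(F)\to F$ which is initial among semi-tame morphisms $F'\to F$ with $F'$ a lattice KM fan; it is tame whenever $F$ is atoroidal. If $F$ is a classical fan, then $\mathbb U^{\rm rig}(F)$ is a classical fan.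
   Context: Notation: for an abelian group $N$, $N_{\mathbb R}=N\otimes\mathbb R$, $N_{\rm tor}$ its torsion subgroup, $\overline N=N/N_{\rm tor}$. A cone in $N_{\mathbb R}$ is $\{\sum\lambda_in_i:\lambda_i\ge0\}$ for finitely many $n_i\in N$; a fan in $N$ is a finite nonempty set of sharp cones closed under faces with pairwise intersections common faces; $N_\sigma=N\cap\operatorname{Span}\sigma$ (elements with image in the span). A KM fan $(N,F,\{F_\sigma\})$: a finitely generated abelian group $N$, a fan $F$ in $N$, and torsion-free finite-index subgroups $F_\sigma\subseteq N_\sigma$ with $F_\tau=F_\sigma\cap\operatorname{Span}\tau$ for faces $\tau\le\sigma$. Lattice KM fan: $N$ torsion-free; classical fan: lattice KM fan with $F_\sigma=N_\sigma$ for all $\sigma$. Morphism: homomorphism $f:N\to N'$ such that each $\sigma\in F$ has some $\tau\in F'$ with $f_{\mathbb R}(\sigma)\subseteq\tau$ and $f(F_\sigma)\subseteq F'_\tau$. A morphism $f$ is semi-tame if for every $\sigma\in F$, $\sigma':=f_{\mathbb R}(\sigma)\in F'$ and $f_{\mathbb R}|_\sigma:\sigma\to\sigma'$ is bijective, $\sigma\mapsto\sigma'$ is a bijection $F\to F'$, and $f|_{F_\sigma}:F_\sigma\to F'_{\sigma'}$ is bijective; it is tame if moreover $\operatorname{Cok}(f:N\to N')$ is finite and $\operatorname{Ker}f$ is torsion-free. $F$ is atoroidal if $\bigoplus_{\sigma\in F}\operatorname{Span}\sigma\to N_{\mathbb R}$ is surjective. The rigidification of a KM fan $F$ is $F^{\rm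 rig}=(\overline N,F,\{q(F_\sigma)\})$, $q:N\to\overline N$ the quotient (cones viewed in $\overline N_{\mathbb R}=N_{\mathbb R}$). Unfolding data: $\Lambda(F)=\varinjlim_{\sigma\in F}F_\sigma$, the colimit in abelian groups over the poset of cones with the inclusions $F_\tau\hookrightarrow F_\sigma$ for $\tau\le\sigma$; $i_\sigma:F_\sigma\to\Lambda$ the structure maps; $\overline\Lambda=\Lambda/\Lambda_{\rm tor}$ and $\overline i_\sigma$ the composite $F_\sigma\to\overline\Lambda$; $\beta:\Lambda\to N$ the map induced by the inclusions $F_\sigma\subseteq N$; when $N$ is a lattice, $\overline\beta:\overline\Lambda\to N$ the induced map. For $\sigma\in F$, $i(\sigma)\subseteq\Lambda_{\mathbb R}=\overline\Lambda_{\mathbb R}$ is the image of $\sigma\subseteq F_\sigma\otimes\mathbb R$ under $i_\sigma\otimes\mathbb R$. *)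

theory Defs
  imports "HOL-Algebra.Algebra"
begin

section \<open>Real vector space N_R, modelled as Hom_Z(Hom_Z(N,Z),R)\<close>

type_synonym 'a rvec = "('a \<Rightarrow> int) \<Rightarrow> real"
type_synonym 'a rcone = "'a rvec set"
type_synonym 'a kmfan = "'a monoid \<times> 'a rcone set \<times> ('a rcone \<Rightarrow> 'a set)"

definition grp :: "'a kmfan \<Rightarrow> 'a monoid" where "grp K = fst K"
definition cones :: "'a kmfan \<Rightarrow> 'a rcone set" where "cones K = fst (snd K)"
definition lat :: "'a kmfan \<Rightarrow> 'a rcone \<Rightarrow> 'a set" where "lat K = snd (snd K)"

definition zdual :: "'a monoid \<Rightarrow> ('a \<Rightarrow> int) set" where
  "zdual N = {\<phi>. (\<forall>x\<in>carrier N. \<forall>y\<in>carrier N. \<phi> (x \<otimes>\<^bsub>N\<^esub> y) = \<phi> x + \<phi> y)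
                 \<and> (\<forall>x. x \<notin> carrier N \<longrightarrow> \<phi> x = 0)}"

text \<open>N_R = N tensor R, realised as additive maps Hom(N,Z) -> R (vanishing elsewhere).\<close>
definition realspace :: "'a monoid \<Rightarrow> 'a rvec set" where
  "realspace N = {v. (\<forall>\<phi>\<in>zdual N. \<forall>\<psi>\<in>zdual N. v (\<lambda>x. \<phi> x + \<psi> x) = v \<phi> + v \<psi>)
                     \<and> (\<forall>\<phi>. \<phi> \<notin> zdual N \<longrightarrow> v \<phi> = 0)}"

text \<open>The canonical map N -> N_R, n |-> n tensor 1.\<close>
definition ev :: "'a monoid \<Rightarrow> 'a \<Rightarrow> 'a rvec" where
  "ev N x = (\<lambda>\<phi>. if \<phi> \<in> zdual N then real_of_int (\<phi> x) else 0)"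

definition vlin :: "('d \<Rightarrow> real) set \<Rightarrow> (('d \<Rightarrow> real) \<Rightarrow> real) \<Rightarrow> ('d \<Rightarrow> real)" where
  "vlin S r = (\<lambda>\<phi>. \<Sum>v\<in>S. r v * v \<phi>)"

definition rspan :: "('d \<Rightarrow> real) set \<Rightarrow> ('d \<Rightarrow> real) set" where
  "rspan V = {vlin S r | S r. finite S \<and> S \<subseteq> V}"

definition gen_cone :: "('d \<Rightarrow> real) set \<Rightarrow> ('d \<Rightarrow> real) set" where
  "gen_cone V = {vlin S r | S r. finite S \<and> S \<subseteq> V \<and> (\<forall>v\<in>S. 0 \<le> r v)}"

definition is_cone :: "'a monoid \<Rightarrow> 'a rcone \<Rightarrow> bool" where
  "is_cone N \<sigma> \<longleftrightarrow> (\<exists>S. finite S \<and> S \<subseteq> carrier N \<and> \<sigma> = gen_cone (ev N ` S))"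

definition sharp :: "('d \<Rightarrow> real) set \<Rightarrow> bool" where
  "sharp \<sigma> \<longleftrightarrow> (\<forall>v\<in>\<sigma>. (\<lambda>\<phi>. - v \<phi>) \<in> \<sigma> \<longrightarrow> v = (\<lambda>_. 0))"

definition rlinear_on :: "('d \<Rightarrow> real) set \<Rightarrow> (('d \<Rightarrow> real) \<Rightarrow> real) \<Rightarrow> bool" where
  "rlinear_on V l \<longleftrightarrow> (\<forall>v\<in>V. \<forall>w\<in>V. \<forall>a b. l (\<lambda>\<phi>. a * v \<phi> + b * w \<phi>) = a * l v + b * l w)"

definition is_face :: "'a monoid \<Rightarrow> 'a rcone \<Rightarrow> 'a rcone \<Rightarrow> bool" where
  "is_face N \<tau> \<sigma> \<longleftrightarrow> (\<exists>l. rlinear_on (realspace N) l \<and> (\<forall>v\<in>\<sigma>. 0 \<le> l v) \<and> \<tau> = {v\<in>\<sigma>. l v = 0})"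

definition is_fan :: "'a monoid \<Rightarrow> 'a rcone set \<Rightarrow> bool" where
  "is_fan N F \<longleftrightarrow> finite F \<and> F \<noteq> {} \<and> (\<forall>\<sigma>\<in>F. is_cone N \<sigma> \<and> sharp \<sigma>)
     \<and> (\<forall>\<sigma>\<in>F. \<forall>\<tau>. is_face N \<tau> \<sigma> \<longrightarrow> \<tau> \<in> F)
     \<and> (\<forall>\<sigma>\<in>F. \<forall>\<sigma>'\<in>F. is_face N (\<sigma> \<inter> \<sigma>') \<sigma> \<and> is_face N (\<sigma> \<inter> \<sigma>') \<sigma>')"

definition Nsig :: "'a monoid \<Rightarrow> 'a rcone \<Rightarrow> 'a set" where
  "Nsig N \<sigma> = {x\<in>carrier N. ev N x \<in> rspan \<sigma>}"

definition torsion_free :: "('a, 'm) monoid_scheme \<Rightarrow> 'a set \<Rightarrow> bool" where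
  "torsion_free N H \<longleftrightarrow> (\<forall>x\<in>H. \<forall>n::nat. n > 0 \<and> x [^]\<^bsub>N\<^esub> n = \<one>\<^bsub>N\<^esub> \<longrightarrow> x = \<one>\<^bsub>N\<^esub>)"

definition tor :: "('a, 'm) monoid_scheme \<Rightarrow> 'a set" where
  "tor N = {x\<in>carrier N. \<exists>n::nat. n > 0 \<and> x [^]\<^bsub>N\<^esub> n = \<one>\<^bsub>N\<^esub>}"

definition fin_gen :: "'a monoid \<Rightarrow> bool" where
  "fin_gen N \<longleftrightarrow> (\<exists>S. finite S \<and> S \<subseteq> carrier N \<and> generate N S = carrier N)"

definition km_fan :: "'a kmfan \<Rightarrow> bool" where
  "km_fan K \<longleftrightarrow> comm_group (grp K) \<and> fin_gen (grp K) \<and> is_fan (grp K) (cones K)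
     \<and> (\<forall>\<sigma>\<in>cones K. subgroup (lat K \<sigma>) (grp K) \<and> lat K \<sigma> \<subseteq> Nsig (grp K) \<sigma>
          \<and> torsion_free (grp K) (lat K \<sigma>)
          \<and> finite {lat K \<sigma> #>\<^bsub>grp K\<^esub> x | x. x \<in> Nsig (grp K) \<sigma>})
     \<and> (\<forall>\<sigma>\<in>cones K. \<forall>\<tau>\<in>cones K. is_face (grp K) \<tau> \<sigma> \<longrightarrow>
          lat K \<tau> = {x\<in>lat K \<sigma>. ev (grp K) x \<in> rspan \<tau>})"

definition lattice_km :: "'a kmfan \<Rightarrow> bool" where
  "lattice_km K \<longleftrightarrow> km_fan K \<and> torsion_free (grp K) (carrier (grp K))"

definition classical :: "'a kmfan \<Rightarrow> bool" where
  "classical K \<longleftrightarrow> lattice_km K \<and> (\<forall>\<sigma>\<in>cones K. lat K \<sigma> = Nsig (grp K) \<sigma>)"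

definition realify :: "'a monoid \<Rightarrow> 'b monoid \<Rightarrow> ('a \<Rightarrow> 'b) \<Rightarrow> 'a rvec \<Rightarrow> 'b rvec" where
  "realify N N' f v = (\<lambda>\<phi>'. if \<phi>' \<in> zdual N' then v (\<lambda>x. if x \<in> carrier N then \<phi>' (f x) else 0) else 0)"

definition km_morphism :: "'a kmfan \<Rightarrow> 'b kmfan \<Rightarrow> ('a \<Rightarrow> 'b) \<Rightarrow> bool" where
  "km_morphism K K' f \<longleftrightarrow> f \<in> hom (grp K) (grp K') \<and>
     (\<forall>\<sigma>\<in>cones K. \<exists>\<tau>\<in>cones K'. realify (grp K) (grp K') f ` \<sigma> \<subseteq> \<tau> \<and> f ` lat K \<sigma> \<subseteq> lat K' \<tau>)"

definition semi_tame :: "'a kmfan \<Rightarrow> 'b kmfan \<Rightarrow> ('a \<Rightarrow> 'b) \<Rightarrow> bool" where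
  "semi_tame K K' f \<longleftrightarrow> km_morphism K K' f \<and>
     (\<forall>\<sigma>\<in>cones K. realify (grp K) (grp K') f ` \<sigma> \<in> cones K'
        \<and> inj_on (realify (grp K) (grp K') f) \<sigma>
        \<and> bij_betw f (lat K \<sigma>) (lat K' (realify (grp K) (grp K') f ` \<sigma>)))
     \<and> bij_betw (\<lambda>\<sigma>. realify (grp K) (grp K') f ` \<sigma>) (cones K) (cones K')"

definition tame :: "'a kmfan \<Rightarrow> 'b kmfan \<Rightarrow> ('a \<Rightarrow> 'b) \<Rightarrow> bool" where
  "tame K K' f \<longleftrightarrow> semi_tame K K' f
     \<and> finite (rcosets\<^bsub>grp K'\<^esub> (f ` carrier (grp K)))
     \<and> torsion_free (grp K) (kernel (grp K) (grp K') f)"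

definition km_iso :: "'a kmfan \<Rightarrow> 'b kmfan \<Rightarrow> ('a \<Rightarrow> 'b) \<Rightarrow> bool" where
  "km_iso K K' f \<longleftrightarrow> km_morphism K K' f \<and> (\<exists>g. km_morphism K' K g
     \<and> (\<forall>x\<in>carrier (grp K). g (f x) = x) \<and> (\<forall>y\<in>carrier (grp K'). f (g y) = y))"

definition atoroidal :: "'a kmfan \<Rightarrow> bool" where
  "atoroidal K \<longleftrightarrow> (\<forall>v\<in>realspace (grp K). \<exists>w. (\<forall>\<sigma>\<in>cones K. w \<sigma> \<in> rspan \<sigma>)
      \<and> v = (\<lambda>\<phi>. \<Sum>\<sigma>\<in>cones K. w \<sigma> \<phi>))"

text \<open>Rigidification; cones are transported along q_R : N_R -> Nbar_R (an isomorphism).\<close>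
definition rig :: "'a kmfan \<Rightarrow> 'a set kmfan" where
  "rig K = (let N = grp K; Nb = N Mod tor N; q = (\<lambda>x. tor N #>\<^bsub>N\<^esub> x);
              qR = realify N Nb q
            in (Nb, (\<lambda>\<sigma>. qR ` \<sigma>) ` cones K,
                (\<lambda>\<sigma>'. \<Union>{q ` lat K \<sigma> | \<sigma>. \<sigma> \<in> cones K \<and> qR ` \<sigma> = \<sigma>'})))"

definition sumgrp :: "'a kmfan \<Rightarrow> ('a rcone \<Rightarrow> 'a) monoid" where
  "sumgrp K = \<lparr>carrier = {c. (\<forall>\<sigma>\<in>cones K. c \<sigma> \<in> lat K \<sigma>) \<and> (\<forall>\<sigma>. \<sigma> \<notin> cones K \<longrightarrow> c \<sigma> = \<one>\<^bsub>grp K\<^esub>)},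
               monoid.mult = (\<lambda>c d \<sigma>. c \<sigma> \<otimes>\<^bsub>grp K\<^esub> d \<sigma>), monoid.one = (\<lambda>\<sigma>. \<one>\<^bsub>grp K\<^esub>)\<rparr>"

definition delta :: "'a kmfan \<Rightarrow> 'a rcone \<Rightarrow> 'a \<Rightarrow> ('a rcone \<Rightarrow> 'a)" where
  "delta K \<sigma> x = (\<lambda>\<rho>. if \<rho> = \<sigma> then x else \<one>\<^bsub>grp K\<^esub>)"

definition rels :: "'a kmfan \<Rightarrow> ('a rcone \<Rightarrow> 'a) set" where
  "rels K = generate (sumgrp K)
     {delta K \<sigma> x \<otimes>\<^bsub>sumgrp K\<^esub> inv\<^bsub>sumgrp K\<^esub> (delta K \<tau> x) | \<sigma> \<tau> x.
        \<sigma> \<in> cones K \<and> \<tau> \<in> cones K \<and> is_face (grp K) \<tau> \<sigma> \<and> x \<in> lat K \<tau>}"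

text \<open>Lambda(F) = colim F_sigma.\<close>
definition Lambda :: "'a kmfan \<Rightarrow> ('a rcone \<Rightarrow> 'a) set monoid" where
  "Lambda K = sumgrp K Mod rels K"

definition iota :: "'a kmfan \<Rightarrow> 'a rcone \<Rightarrow> 'a \<Rightarrow> ('a rcone \<Rightarrow> 'a) set" where
  "iota K \<sigma> x = rels K #>\<^bsub>sumgrp K\<^esub> delta K \<sigma> x"

definition beta :: "'a kmfan \<Rightarrow> ('a rcone \<Rightarrow> 'a) set \<Rightarrow> 'a" where
  "beta K \<xi> = finprod (grp K) (\<lambda>\<sigma>. (SOME c. c \<in> \<xi>) \<sigma>) (cones K)"

text \<open>Image of sigma (inside Span sigma = (F_sigma)_R) under the R-linear extension h_R of
  h : F_sigma -> M.\<close>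
definition lin_img :: "'a monoid \<Rightarrow> 'b monoid \<Rightarrow> ('a \<Rightarrow> 'b) \<Rightarrow> 'a set \<Rightarrow> 'a rcone \<Rightarrow> 'b rcone" where
  "lin_img N M h G \<sigma> = {w. \<exists>S r. finite S \<and> S \<subseteq> G
       \<and> (\<lambda>\<phi>. \<Sum>x\<in>S. r x * ev N x \<phi>) \<in> \<sigma>
       \<and> w = (\<lambda>\<phi>. \<Sum>x\<in>S. r x * ev M (h x) \<phi>)}"

definition unfold :: "'a kmfan \<Rightarrow> ('a rcone \<Rightarrow> 'a) set kmfan" where
  "unfold K = (let cn = (\<lambda>\<sigma>. lin_img (grp K) (Lambda K) (iota K \<sigma>) (lat K \<sigma>) \<sigma>)
     in (Lambda K, cn ` cones K,
         (\<lambda>\<sigma>'. \<Union>{iota K \<sigma> ` lat K \<sigma> | \<sigma>. \<sigma> \<in> cones K \<and> cn \<sigma> = \<sigma>'})))"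

definition qL :: "'a kmfan \<Rightarrow> ('a rcone \<Rightarrow> 'a) set \<Rightarrow> ('a rcone \<Rightarrow> 'a) set set" where
  "qL K \<xi> = tor (Lambda K) #>\<^bsub>Lambda K\<^esub> \<xi>"

definition LambdaBar :: "'a kmfan \<Rightarrow> ('a rcone \<Rightarrow> 'a) set set monoid" where
  "LambdaBar K = Lambda K Mod tor (Lambda K)"

definition urig :: "'a kmfan \<Rightarrow> ('a rcone \<Rightarrow> 'a) set set kmfan" where
  "urig K = (let cn = (\<lambda>\<sigma>. lin_img (grp K) (LambdaBar K) (qL K \<circ> iota K \<sigma>) (lat K \<sigma>) \<sigma>)
     in (LambdaBar K, cn ` cones K,
         (\<lambda>\<sigma>'. \<Union>{(qL K \<circ> iota K \<sigma>) ` lat K \<sigma> | \<sigma>. \<sigma> \<in> cones K \<and> cn \<sigma> = \<sigma>'})))"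

definition betabar :: "'a kmfan \<Rightarrow> ('a rcone \<Rightarrow> 'a) set set \<Rightarrow> 'a" where
  "betabar K \<Xi> = beta K (SOME \<xi>. \<xi> \<in> \<Xi>)"

definition tgt_cone :: "'a kmfan \<Rightarrow> 'b kmfan \<Rightarrow> ('a \<Rightarrow> 'b) \<Rightarrow> 'a rcone \<Rightarrow> 'b rcone" where
  "tgt_cone K K' h \<sigma> = (SOME \<tau>. \<tau> \<in> cones K' \<and> realify (grp K) (grp K') h ` \<sigma> \<subseteq> \<tau>
                                \<and> h ` lat K \<sigma> \<subseteq> lat K' \<tau>)"

definition unfold_map :: "'a kmfan \<Rightarrow> 'b kmfan \<Rightarrow> ('a \<Rightarrow> 'b)
    \<Rightarrow> ('a rcone \<Rightarrow> 'a) set \<Rightarrow> ('b rcone \<Rightarrow> 'b) set" where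
  "unfold_map K K' h \<xi> = rels K' #>\<^bsub>sumgrp K'\<^esub>
     finprod (sumgrp K') (\<lambda>\<sigma>. delta K' (tgt_cone K K' h \<sigma>) (h ((SOME c. c \<in> \<xi>) \<sigma>))) (cones K)"

end

theory Submission
  imports Defs "HOL-Library.Function_Algebras"
begin

text \<open>
  The subgroups \<open>F\<^sub>\<sigma>\<close> are torsion-free of finite index in \<open>N\<^sub>\<sigma>\<close>, so \<open>F\<^sub>\<sigma> \<otimes> \<real>\<close> is the span of \<open>\<sigma>\<close>, and
  \<open>\<beta> \<circ> i\<^sub>\<sigma>\<close> is the inclusion of \<open>F\<^sub>\<sigma>\<close>. As a homomorphism from \<open>F\<^sub>\<sigma>\<close> to the integers extends to \<open>N\<close> after
  multiplication by a positive integer, \<open>\<beta>\<^sub>\<real>\<close> is injective on the span of the image of \<open>F\<^sub>\<sigma>\<close> in \<open>\<Lambda>\<^sub>\<real>\<close>.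
  Hence \<open>i(\<sigma>)\<close> consists of the vectors of that span which \<open>\<beta>\<^sub>\<real>\<close> maps into \<open>\<sigma>\<close>, and the axioms of a KM fan
  are transported from \<open>F\<close> along \<open>\<beta>\<^sub>\<real>\<close>; the same argument applies to \<open>\<Lambda>\<close> modulo torsion.

  A semi-tame morphism \<open>f: F' \<rightarrow> F\<close> lifts faces of cones and is inverted on each \<open>F\<^sub>\<sigma>\<close>, so the inverses form
  a cocone, which yields the morphism from the unfolding to \<open>F'\<close>. Its uniqueness, the functoriality of the
  unfolding and the fact that it inverts semi-tame morphisms all follow from semi-tame morphisms being
  monomorphisms with respect to KM fans whose group is generated by the lattices \<open>F\<^sub>\<sigma>\<close>.
\<close>

section \<open>Finitely generated abelian groups\<close>

text \<open>Since \<open>N_R\<close> is realised as the additive maps from \<open>zdual N\<close> to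
  the reals, a vector is known through its values on integer functionals, and questions about
  \<open>ev\<close>, spans and indices become questions about which functionals exist. Two existence
  results carry the development. A functional on a subgroup extends to all of \<open>N\<close> after
  multiplication by a positive integer, which clears the denominators that divisibility forces. An
  element with no positive power in a given subgroup is detected by a functional vanishing on that
  subgroup. The second result shows that \<open>ev\<close> kills only torsion and, as subgroups of
  \<open>N\<close> are finitely generated, turns statements about spans into finiteness of an index.

  The obstacle is that \<open>\<beta>_R\<close> need not be injective on \<open>\<Lambda>_R\<close>;
  it is so only on the span belonging to a single cone. Comparisons between different cones
  therefore pass through a common face, on which the structure maps agree. A second nuisance is
  choice: \<open>beta\<close>, \<open>betabar\<close>, \<open>tgt_cone\<close> and
  \<open>unfold_map\<close> all select representatives or targets, so each of them needs an argument
  that the choice is immaterial.\<close>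

definition additive_on :: "('a, 'm) monoid_scheme \<Rightarrow> 'a set \<Rightarrow> ('a \<Rightarrow> int) \<Rightarrow> bool" where
  "additive_on G A \<psi> \<longleftrightarrow> (\<forall>x\<in>A. \<forall>y\<in>A. \<psi> (x \<otimes>\<^bsub>G\<^esub> y) = \<psi> x + \<psi> y)"

text \<open>Meant for a subgroup \<open>A\<close>, where it is the subgroup generated by
  \<open>A\<close> and \<open>s\<close>. The normal form with one integer exponent reduces extension
  problems to one generator at a time.\<close>

definition adjoin :: "('a, 'm) monoid_scheme \<Rightarrow> 'a \<Rightarrow> 'a set \<Rightarrow> 'a set" where
  "adjoin G s A = {s [^]\<^bsub>G\<^esub> k \<otimes>\<^bsub>G\<^esub> y | (k::int) y. y \<in> A}"

lemma hom_eq_on_generate: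
  assumes "group G" "group H" "f \<in> hom G H" "g \<in> hom G H" "S \<subseteq> carrier G"
    "\<And>x. x \<in> S \<Longrightarrow> f x = g x" "x \<in> generate G S"
  shows "f x = g x"
proof -
  interpret f: group_hom G H f using assms by (simp add: group_hom_def group_hom_axioms_def)
  interpret g: group_hom G H g using assms by (simp add: group_hom_def group_hom_axioms_def)
  show ?thesis using assms(7)
  proof (induction rule: generate.induct)
    case (eng h1 h2)
    then show ?case using group.generate_in_carrier[OF assms(1,5)] by simp
  qed (use assms in \<open>auto simp: subset_iff\<close>)
qed

context comm_group
begin

lemma additive_on_one:
  assumes "subgroup A G" "additive_on G A \<psi>" shows "\<psi> \<one> = 0"
proof -
  have "\<psi> (\<one> \<otimes> \<one>) = \<psi> \<one> + \<psi> \<one>"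
    using assms subgroup.one_closed unfolding additive_on_def by blast
  then show ?thesis by simp
qed

lemma additive_on_inv:
  assumes "subgroup A G" "additive_on G A \<psi>" "x \<in> A" shows "\<psi> (inv x) = - \<psi> x"
proof -
  have "\<psi> (x \<otimes> inv x) = \<psi> x + \<psi> (inv x)"
    using assms(2,3) subgroup.m_inv_closed[OF assms(1,3)] by (simp add: additive_on_def)
  moreover have "x \<in> carrier G" using assms subgroup.mem_carrier by metis
  ultimately show ?thesis using additive_on_one[OF assms(1,2)] by simp
qed

lemma additive_on_int_pow:
  assumes A: "subgroup A G" "additive_on G A \<psi>" "x \<in> A" shows "\<psi> (x [^] (k::int)) = k * \<psi> x"
proof -
  have xc: "x \<in> carrier G" using A subgroup.mem_carrier by metis
  have n: "\<psi> (x [^] n) = int n * \<psi> x" for n :: nat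
  proof (induction n)
    case 0 then show ?case using additive_on_one[OF A(1,2)] by simp
  next
    case (Suc n)
    have "x [^] n \<in> A" using A(1,3) by (metis subgroup_int_pow_closed int_pow_int)
    then have "\<psi> (x [^] n \<otimes> x) = \<psi> (x [^] n) + \<psi> x" using A unfolding additive_on_def by blast
    then show ?case using Suc by (simp add: algebra_simps)
  qed
  show ?thesis
  proof (cases "0 \<le> k")
    case True
    then obtain m where "k = int m" using nonneg_int_cases by blast
    then show ?thesis using n by (simp add: int_pow_int)
  next
    case False
    then obtain m where m: "k = - int m" by (metis int_cases2 of_nat_0_le_iff)
    have "x [^] m \<in> A" using A(1,3) by (metis subgroup_int_pow_closed int_pow_int)
    then show ?thesis using n additive_on_inv[OF A(1,2)] m xc by (simp add: int_pow_neg_int)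
  qed
qed

lemma adjoin_subgroup:
  assumes A: "subgroup A G" and s: "s \<in> carrier G" shows "subgroup (adjoin G s A) G"
proof (rule subgroupI)
  note [simp] = subgroup.mem_carrier[OF A] s
  show "adjoin G s A \<subseteq> carrier G" by (auto simp: adjoin_def)
  show "adjoin G s A \<noteq> {}" using subgroup.one_closed[OF A] by (auto simp: adjoin_def)
  show "inv a \<in> adjoin G s A" if a: "a \<in> adjoin G s A" for a
  proof -
    obtain k y where ky: "a = s [^] (k::int) \<otimes> y" "y \<in> A" using a by (auto simp: adjoin_def)
    then have "inv a = s [^] (-k) \<otimes> inv y" by (simp add: inv_mult int_pow_neg)
    then show ?thesis using ky subgroup.m_inv_closed[OF A] by (auto simp: adjoin_def)
  qed
  show "a \<otimes> b \<in> adjoin G s A" if ab: "a \<in> adjoin G s A" "b \<in> adjoin G s A" for a b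
  proof -
    obtain k y l z where ky: "a = s [^] (k::int) \<otimes> y" "y \<in> A" "b = s [^] (l::int) \<otimes> z" "z \<in> A"
      using ab by (auto simp: adjoin_def)
    then have "a \<otimes> b = s [^] (k + l) \<otimes> (y \<otimes> z)" by (simp add: int_pow_mult m_ac)
    then show ?thesis using ky subgroup.m_closed[OF A] by (auto simp: adjoin_def)
  qed
qed

lemma subset_adjoin:
  assumes "subgroup A G" "s \<in> carrier G" shows "A \<subseteq> adjoin G s A" "s \<in> adjoin G s A"
proof -
  show "A \<subseteq> adjoin G s A"
  proof
    fix y assume y: "y \<in> A"
    then have "y = s [^] (0::int) \<otimes> y" using subgroup.mem_carrier[OF assms(1)] by simp
    then show "y \<in> adjoin G s A" using y unfolding adjoin_def by blast
  qed
  have "s = s [^] (1::int) \<otimes> \<one>" using assms by simp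
  then show "s \<in> adjoin G s A" using subgroup.one_closed[OF assms(1)] unfolding adjoin_def by blast
qed

lemma generate_insert:
  assumes "S \<subseteq> carrier G" "s \<in> carrier G"
  shows "generate G (insert s S) = adjoin G s (generate G S)"
proof
  have sg: "subgroup (generate G S) G" by (rule generate_is_subgroup[OF assms(1)])
  have "insert s S \<subseteq> adjoin G s (generate G S)"
    using subset_adjoin[OF sg assms(2)] by (auto intro: generate.incl)
  then show "generate G (insert s S) \<subseteq> adjoin G s (generate G S)"
    by (rule generate_subgroup_incl[OF _ adjoin_subgroup[OF sg assms(2)]])
  have sg': "subgroup (generate G (insert s S)) G" using assms by (intro generate_is_subgroup) auto
  have "generate G S \<subseteq> generate G (insert s S)" by (rule mono_generate) auto
  moreover have "s [^] (k::int) \<in> generate G (insert s S)" for k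
    by (rule subgroup_int_pow_closed[OF sg']) (auto intro: generate.incl)
  ultimately show "adjoin G s (generate G S) \<subseteq> generate G (insert s S)"
    using subgroup.m_closed[OF sg'] by (auto simp: adjoin_def)
qed

text \<open>Induction on the generators. The exponents of the new generator \<open>s\<close> that
  occur in \<open>H\<close> form a subgroup of the integers, hence the multiples of some
  \<open>d\<close>. An element of \<open>H\<close> with exponent \<open>d\<close>, together with
  generators of the part of \<open>H\<close> lying in the old group, generates \<open>H\<close>:
  dividing by a suitable power of that element removes the exponent of \<open>s\<close>.\<close>

lemma subgroup_of_fin_gen:
  assumes "finite S" "S \<subseteq> carrier G" "subgroup H G" "H \<subseteq> generate G S"
  shows "\<exists>T. finite T \<and> T \<subseteq> carrier G \<and> H = generate G T"
  using assms
proof (induction S arbitrary: H rule: finite_induct)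
  case empty
  then have "H = {\<one>}" using subgroup.one_closed generate_empty by blast
  then show ?case using generate_empty by blast
next
  case (insert s S)
  note H = insert.prems(2)
  have s: "s \<in> carrier G" and S: "S \<subseteq> carrier G" using insert.prems by auto
  let ?A = "generate G S"
  have A: "subgroup ?A G" by (rule generate_is_subgroup[OF S])
  note [simp] = subgroup.mem_carrier[OF A] subgroup.mem_carrier[OF H] s
  have "\<exists>T. finite T \<and> T \<subseteq> carrier G \<and> H \<inter> ?A = generate G T"
    by (rule insert.IH[OF S]) (use H A in \<open>auto intro: subgroups_Inter_pair\<close>)
  then obtain T where T: "finite T" "T \<subseteq> carrier G" "H \<inter> ?A = generate G T" by blast
  \<comment> \<open>The exponents of \<open>s\<close> occurring in \<open>H\<close>, modulo the
    group generated by the remaining generators.\<close>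
  define I where "I = {k::int. \<exists>y\<in>?A. s [^] k \<otimes> y \<in> H}"
  have Idiff: "k - l * q \<in> I" if kl: "k \<in> I" "l \<in> I" for k l q
  proof -
    obtain y z where yz: "y \<in> ?A" "s [^] k \<otimes> y \<in> H" "z \<in> ?A" "s [^] l \<otimes> z \<in> H"
      using kl by (auto simp: I_def)
    have "s [^] k \<otimes> y \<otimes> (s [^] l \<otimes> z) [^] (-q) \<in> H"
      using yz H by (simp add: subgroup.m_closed subgroup_int_pow_closed)
    moreover have "s [^] k \<otimes> y \<otimes> (s [^] l \<otimes> z) [^] (-q) = s [^] (k - l * q) \<otimes> (y \<otimes> z [^] (-q))"
      using yz by (simp add: int_pow_distrib int_pow_pow int_pow_diff int_pow_neg inv_mult m_ac)
    moreover have "y \<otimes> z [^] (-q) \<in> ?A"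
      using yz A by (simp add: subgroup.m_closed subgroup_int_pow_closed)
    ultimately show ?thesis by (auto simp: I_def)
  qed
  \<comment> \<open>Division with remainder makes the least positive exponent divide all others. If
    no exponent is positive, then only \<open>0\<close> occurs and \<open>d = 0\<close>
    serves.\<close>
  obtain d where d: "d \<in> I" "\<And>k. k \<in> I \<Longrightarrow> d dvd k"
  proof (cases "\<exists>k\<in>I. k > 0")
    case True
    define n where "n = (LEAST n::nat. n > 0 \<and> int n \<in> I)"
    have "\<exists>n::nat. n > 0 \<and> int n \<in> I" using True by (metis zero_less_imp_eq_int)
    then have n: "n > 0" "int n \<in> I" unfolding n_def by (metis (mono_tags, lifting) LeastI)+
    have "int n dvd k" if k: "k \<in> I" for k
    proof -
      have "k - int n * (k div int n) \<in> I" by (rule Idiff[OF k n(2)])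
      then have r: "k mod int n \<in> I" by (simp add: minus_mult_div_eq_mod)
      have "k mod int n = int (nat (k mod int n))" "nat (k mod int n) < n" using n(1)
        by (simp_all add: nat_less_iff)
      then have "\<not> nat (k mod int n) > 0" using r not_less_Least n_def by (metis (mono_tags, lifting))
      then have "k mod int n = 0" using n(1) by (metis \<open>k mod int n = int (nat (k mod int n))\<close> gr_zeroI of_nat_0)
      then show ?thesis by auto
    qed
    then show ?thesis using that n by blast
  next
    case False
    have "\<one> \<in> ?A" "s [^] (0::int) \<otimes> \<one> \<in> H" using A H by (auto simp: subgroup.one_closed)
    then have 0: "0 \<in> I" by (auto simp: I_def)
    have "k = 0" if "k \<in> I" for k
      using False Idiff[OF 0 that, of 1] that by force
    then show ?thesis using that 0 by blast
  qed
  then obtain y0 where y0: "y0 \<in> ?A" "s [^] d \<otimes> y0 \<in> H" by (auto simp: I_def)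
  let ?h = "s [^] d \<otimes> y0"
  have TH: "insert ?h T \<subseteq> H" using T(3) y0 by (auto intro: generate.incl)
  have "H \<subseteq> generate G (insert ?h T)"
  proof
    fix h assume h: "h \<in> H"
    then obtain k y where ky: "h = s [^] (k::int) \<otimes> y" "y \<in> ?A"
      using insert.prems(3) generate_insert[OF S s] by (auto simp: adjoin_def)
    then have "k \<in> I" using h by (auto simp: I_def)
    then obtain q where q: "k = d * q" using d by blast
    have "?h [^] q = s [^] k \<otimes> y0 [^] q" using y0 q by (simp add: int_pow_distrib int_pow_pow)
    moreover have "y = y0 [^] q \<otimes> (inv (y0 [^] q) \<otimes> y)" using y0 ky
      by (simp add: m_assoc[symmetric])
    ultimately have eq: "h = ?h [^] q \<otimes> (inv (y0 [^] q) \<otimes> y)" using y0 ky by (simp add: m_assoc)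
    have "inv (?h [^] q) \<otimes> h \<in> H" using h y0 H
      by (simp add: subgroup.m_closed subgroup_int_pow_closed subgroup.m_inv_closed)
    moreover have "inv (?h [^] q) \<otimes> h = inv (y0 [^] q) \<otimes> y"
      using y0 ky by (subst eq) (simp add: m_assoc[symmetric])
    ultimately have "inv (y0 [^] q) \<otimes> y \<in> H \<inter> ?A" using y0 ky A
      by (simp add: subgroup.m_closed subgroup_int_pow_closed subgroup.m_inv_closed)
    then have "inv (y0 [^] q) \<otimes> y \<in> generate G T" using T by simp
    then show "h \<in> generate G (insert ?h T)"
      using eq y0 T(2) by (subst generate_insert) (auto simp: adjoin_def)
  qed
  moreover have "generate G (insert ?h T) \<subseteq> H" using generate_subgroup_incl[OF TH H] .
  ultimately show ?case using T(1,2) y0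
    by (intro exI[of _ "insert ?h T"]) auto
qed

text \<open>The value \<open>c\<close> at \<open>s\<close> may be prescribed as soon as it respects
  the relations between \<open>s\<close> and \<open>A\<close>, that is, the powers of
  \<open>s\<close> that lie in \<open>A\<close>. The factor \<open>m\<close> leaves room for
  clearing denominators.\<close>

lemma additive_adjoin:
  assumes A: "subgroup A G" "additive_on G A \<psi>" and s: "s \<in> carrier G"
    and c: "\<And>k::int. s [^] k \<in> A \<Longrightarrow> k * c = m * \<psi> (s [^] k)"
  shows "\<exists>\<phi>. additive_on G (adjoin G s A) \<phi> \<and> (\<forall>k. \<forall>y\<in>A. \<phi> (s [^] (k::int) \<otimes> y) = k * c + m * \<psi> y)"
proof -
  note [simp] = subgroup.mem_carrier[OF A(1)] s
  \<comment> \<open>Two representations of the same element differ by a power of \<open>s\<close>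
    that lies in \<open>A\<close>, which is where the hypothesis on \<open>c\<close>
    applies.\<close>
  have wd: "k * c + m * \<psi> y = l * c + m * \<psi> z"
    if e: "s [^] (k::int) \<otimes> y = s [^] (l::int) \<otimes> z" and yz: "y \<in> A" "z \<in> A" for k l y z
  proof -
    have iy: "inv y \<in> A" using A(1) yz(1) by (simp add: subgroup.m_inv_closed)
    have "s [^] (k - l) = s [^] k \<otimes> y \<otimes> inv y \<otimes> inv (s [^] l)"
      using yz by (simp add: int_pow_diff m_assoc)
    also have "\<dots> = z \<otimes> inv y" using yz unfolding e
      by (metis (no_types, lifting) inv_closed inv_solve_right int_pow_closed m_assoc m_closed m_comm
          s subgroup.mem_carrier[OF A(1)])
    finally have sk: "s [^] (k - l) = z \<otimes> inv y" .
    have "z \<otimes> inv y \<in> A" using A(1) yz iy by (simp add: subgroup.m_closed)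
    then have "(k - l) * c = m * \<psi> (z \<otimes> inv y)" using c[of "k - l"] sk by simp
    also have "\<psi> (z \<otimes> inv y) = \<psi> z - \<psi> y"
      using A(2) yz iy additive_on_inv[OF A yz(1)] by (simp add: additive_on_def)
    finally show ?thesis by (simp add: algebra_simps)
  qed
  define \<phi> where "\<phi> x = (THE v. \<exists>(k::int) y. y \<in> A \<and> x = s [^] k \<otimes> y \<and> v = k * c + m * \<psi> y)" for x
  have \<phi>: "\<phi> (s [^] k \<otimes> y) = k * c + m * \<psi> y" if y: "y \<in> A" for k :: int and y
    unfolding \<phi>_def
  proof (rule the_equality)
    show "\<exists>(k'::int) y'. y' \<in> A \<and> s [^] k \<otimes> y = s [^] k' \<otimes> y' \<and> k * c + m * \<psi> y = k' * c + m * \<psi> y'"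
      using y by blast
    fix v assume "\<exists>(k'::int) y'. y' \<in> A \<and> s [^] k \<otimes> y = s [^] k' \<otimes> y' \<and> v = k' * c + m * \<psi> y'"
    then show "v = k * c + m * \<psi> y" using wd[OF _ y] by metis
  qed
  have "additive_on G (adjoin G s A) \<phi>"
    unfolding additive_on_def
  proof (intro ballI)
    fix a b assume "a \<in> adjoin G s A" "b \<in> adjoin G s A"
    then obtain k y l z where ky: "a = s [^] (k::int) \<otimes> y" "y \<in> A" "b = s [^] (l::int) \<otimes> z" "z \<in> A"
      by (auto simp: adjoin_def)
    have "a \<otimes> b = s [^] (k + l) \<otimes> (y \<otimes> z)" using ky by (simp add: int_pow_mult m_ac)
    moreover have "y \<otimes> z \<in> A" using ky A(1) by (simp add: subgroup.m_closed)
    moreover have "\<psi> (y \<otimes> z) = \<psi> y + \<psi> z" using A(2) ky by (simp add: additive_on_def)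
    ultimately show "\<phi> (a \<otimes> b) = \<phi> a + \<phi> b" using \<phi> ky by (simp add: algebra_simps)
  qed
  then show ?thesis using \<phi> by blast
qed

text \<open>If \<open>s\<close> has a positive power \<open>n\<close> in \<open>A\<close>, an
  extension would have to take the value \<open>\<psi> (s^n) / n\<close> at \<open>s\<close>;
  scaling by \<open>m = n\<close> makes this the integer \<open>\<psi> (s^n)\<close>. Otherwise
  \<open>s\<close> is free over \<open>A\<close> and the value \<open>0\<close> with
  \<open>m = 1\<close> will do.\<close>

lemma additive_extend_step:
  assumes A: "subgroup A G" "additive_on G A \<psi>" and s: "s \<in> carrier G"
  shows "\<exists>\<phi> m. m > 0 \<and> additive_on G (adjoin G s A) \<phi> \<and> (\<forall>y\<in>A. \<phi> y = m * \<psi> y)"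
proof -
  have "\<exists>c m. m > 0 \<and> (\<forall>k::int. s [^] k \<in> A \<longrightarrow> k * c = m * \<psi> (s [^] k))"
  proof (cases "\<exists>n::int. n > 0 \<and> s [^] n \<in> A")
    case True
    then obtain n :: int where n: "n > 0" "s [^] n \<in> A" by blast
    have "k * \<psi> (s [^] n) = n * \<psi> (s [^] k)" if "s [^] k \<in> A" for k
      using additive_on_int_pow[OF A n(2), of k] additive_on_int_pow[OF A that, of n] s
      by (simp add: int_pow_pow mult.commute)
    then show ?thesis using n by blast
  next
    case False
    have "k = 0" if k: "s [^] k \<in> A" for k :: int
    proof (rule ccontr)
      assume "k \<noteq> 0"
      then have "k > 0 \<or> - k > 0" by auto
      moreover have "s [^] (-k) \<in> A" using k s A(1) by (simp add: int_pow_neg subgroup.m_inv_closed)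
      ultimately show False using k False by blast
    qed
    then have "\<forall>k::int. s [^] k \<in> A \<longrightarrow> k * 0 = 1 * \<psi> (s [^] k)"
      using additive_on_one[OF A] by fastforce
    then show ?thesis by (meson zero_less_one)
  qed
  then obtain c m where cm: "m > 0" "\<And>k::int. s [^] k \<in> A \<Longrightarrow> k * c = m * \<psi> (s [^] k)" by blast
  obtain \<phi> where \<phi>: "additive_on G (adjoin G s A) \<phi>"
    "\<forall>k. \<forall>y\<in>A. \<phi> (s [^] (k::int) \<otimes> y) = k * c + m * \<psi> y"
    using additive_adjoin[OF A s cm(2)] by metis
  have "\<phi> y = m * \<psi> y" if "y \<in> A" for y
    using \<phi>(2)[rule_format, OF that, of 0] subgroup.mem_carrier[OF A(1) that] by simp
  then show ?thesis using \<phi> cm(1) by blast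
qed

lemma additive_extend:
  assumes A: "subgroup A G" "additive_on G A \<psi>" and S: "finite S" "S \<subseteq> carrier G"
  shows "\<exists>\<phi> m B. m > 0 \<and> subgroup B G \<and> A \<subseteq> B \<and> S \<subseteq> B \<and> additive_on G B \<phi> \<and> (\<forall>y\<in>A. \<phi> y = m * \<psi> y)"
  using S
proof (induction S rule: finite_induct)
  case empty
  then show ?case using A by (intro exI[of _ \<psi>] exI[of _ 1] exI[of _ A]) auto
next
  case (insert s S)
  then obtain \<phi> m B where B: "m > 0" "subgroup B G" "A \<subseteq> B" "S \<subseteq> B" "additive_on G B \<phi>" "\<forall>y\<in>A. \<phi> y = m * \<psi> y"
    by auto
  have s: "s \<in> carrier G" using insert.prems by auto
  obtain \<phi>' m' where \<phi>': "m' > 0" "additive_on G (adjoin G s B) \<phi>'" "\<forall>y\<in>B. \<phi>' y = m' * \<phi> y"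
    using additive_extend_step[OF B(2,5) s] by blast
  have "\<forall>y\<in>A. \<phi>' y = (m' * m) * \<psi> y" using B(3,6) \<phi>'(3) by auto
  then show ?case
    using \<phi>' B adjoin_subgroup[OF B(2) s] subset_adjoin[OF B(2) s]
    by (intro exI[of _ \<phi>'] exI[of _ "m' * m"] exI[of _ "adjoin G s B"]) auto
qed

text \<open>Modulo \<open>H\<close> every generator has finite order, so its exponent may be reduced
  to a remainder. A coset is then determined by that remainder and a coset coming from the other
  generators.\<close>

lemma finite_cosets_generate:
  assumes H: "subgroup H G" and S: "finite S" "S \<subseteq> carrier G"
    and t: "\<And>s. s \<in> S \<Longrightarrow> \<exists>n::nat. n > 0 \<and> s [^] n \<in> H"
  shows "finite {H #> x | x. x \<in> generate G S}"
  using S t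
proof (induction S rule: finite_induct)
  case empty
  then show ?case by (simp add: generate_empty)
next
  case (insert s S)
  have s: "s \<in> carrier G" and S: "S \<subseteq> carrier G" using insert.prems by auto
  let ?A = "generate G S"
  have A: "subgroup ?A G" by (rule generate_is_subgroup[OF S])
  note [simp] = subgroup.mem_carrier[OF A] subgroup.mem_carrier[OF H] s
  obtain n :: nat where n: "n > 0" "s [^] n \<in> H" using insert.prems by blast
  have Hc: "H \<subseteq> carrier G" using H subgroup.subset by blast
  have "{H #> x | x. x \<in> generate G (insert s S)}
      \<subseteq> (\<lambda>(r, C). C #> s [^] (r::int)) ` ({0..<int n} \<times> {H #> x | x. x \<in> ?A})"
  proof
    fix C assume "C \<in> {H #> x | x. x \<in> generate G (insert s S)}"
    then obtain k y where C: "C = H #> (s [^] (k::int) \<otimes> y)" "y \<in> ?A"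
      using generate_insert[OF S s] by (auto simp: adjoin_def)
    let ?q = "k div int n" and ?r = "k mod int n"
    have sq: "s [^] (int n * ?q) \<in> H"
      using subgroup_int_pow_closed[OF H n(2), of ?q] s by (simp add: int_pow_pow flip: int_pow_int)
    have "s [^] k = s [^] (int n * ?q) \<otimes> s [^] ?r"
      by (subst int_pow_mult[symmetric]) auto
    then have "C = H #> (s [^] (int n * ?q) \<otimes> (y \<otimes> s [^] ?r))" using C by (simp add: m_ac)
    also have "\<dots> = H #> s [^] (int n * ?q) #> y #> s [^] ?r"
      using C Hc by (simp add: coset_mult_assoc r_coset_subset_G m_assoc)
    also have "H #> s [^] (int n * ?q) = H" using sq H by (simp add: coset_join2)
    finally have "C = H #> y #> s [^] ?r" .
    moreover have "?r \<in> {0..<int n}" using n by simp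
    ultimately show "C \<in> (\<lambda>(r, C). C #> s [^] (r::int)) ` ({0..<int n} \<times> {H #> x | x. x \<in> ?A})"
      using C(2) by (intro image_eqI[of _ _ "(?r, H #> y)"]) auto
  qed
  moreover have "finite {H #> x | x. x \<in> ?A}" using insert by auto
  ultimately show ?case by (meson finite_SigmaI finite_atLeastLessThan_int finite_imageI finite_subset)
qed

text \<open>Pigeonhole on the cosets of the powers of \<open>x\<close>: two of them coincide, and
  the difference of the exponents works.\<close>

lemma pow_mem_of_finite_cosets:
  assumes H: "subgroup H G" and A: "subgroup A G" "x \<in> A" and f: "finite {H #> x | x. x \<in> A}"
  shows "\<exists>n::nat. n > 0 \<and> x [^] n \<in> H"
proof -
  note [simp] = subgroup.mem_carrier[OF A(1)] subgroup.mem_carrier[OF H]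
  have xc: "x \<in> carrier G" using A by simp
  have pw: "x [^] (k::nat) \<in> A" for k using A by (metis subgroup_int_pow_closed int_pow_int)
  have "\<not> inj (\<lambda>k::nat. H #> x [^] k)"
  proof
    assume "inj (\<lambda>k::nat. H #> x [^] k)"
    then have "infinite (range (\<lambda>k::nat. H #> x [^] k))" using finite_imageD by blast
    moreover have "range (\<lambda>k::nat. H #> x [^] k) \<subseteq> {H #> x | x. x \<in> A}" using pw by auto
    ultimately show False using f finite_subset by blast
  qed
  then obtain i j :: nat where ij: "i \<noteq> j" "H #> x [^] i = H #> x [^] j" by (auto simp: inj_def)
  have *: "\<exists>n::nat. n > 0 \<and> x [^] n \<in> H" if ij: "i < j" "H #> x [^] i = H #> x [^] j" for i j :: nat
  proof -
    have "x [^] j \<in> H #> x [^] i" using ij H xc by (simp add: rcos_self)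
    then obtain h where h: "h \<in> H" "x [^] j = h \<otimes> x [^] i" by (auto simp: r_coset_def)
    have "x [^] j = x [^] (j - i) \<otimes> x [^] i" using ij xc by (simp add: nat_pow_mult)
    then have "x [^] (j - i) = h" using h xc by simp
    then show ?thesis using ij h by (intro exI[of _ "j - i"]) auto
  qed
  show ?thesis
  proof (cases "i < j")
    case True then show ?thesis using * ij by blast
  next
    case False then show ?thesis using *[of j i] ij by auto
  qed
qed

lemma tor_subgroup: "subgroup (tor G) G"
proof (rule subgroupI)
  show "tor G \<subseteq> carrier G" by (auto simp: tor_def)
  have "\<one> [^] (1::nat) = \<one>" by simp
  then show "tor G \<noteq> {}" unfolding tor_def using zero_less_one by blast
  show "inv a \<in> tor G" if "a \<in> tor G" for a
    using that unfolding tor_def by (auto simp: nat_pow_inv intro!: exI)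
  show "a \<otimes> b \<in> tor G" if ab: "a \<in> tor G" "b \<in> tor G" for a b
  proof -
    obtain n m :: nat where nm: "a \<in> carrier G" "b \<in> carrier G" "n > 0" "a [^] n = \<one>" "m > 0" "b [^] m = \<one>"
      using ab by (auto simp: tor_def)
    have "(a \<otimes> b) [^] (n * m) = (a [^] n) [^] m \<otimes> (b [^] m) [^] n"
      using nm(1,2) by (simp add: nat_pow_pow nat_pow_distrib mult.commute)
    then have "(a \<otimes> b) [^] (n * m) = \<one>" using nm by simp
    then show ?thesis using nm unfolding tor_def by (auto intro!: exI[of _ "n * m"])
  qed
qed

lemma torsion_free_FactGroup_tor: "torsion_free (G Mod tor G) (carrier (G Mod tor G))"
  unfolding torsion_free_def
proof (intro ballI allI impI)
  fix C and n :: nat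
  assume C: "C \<in> carrier (G Mod tor G)" and n: "n > 0 \<and> C [^]\<^bsub>G Mod tor G\<^esub> n = \<one>\<^bsub>G Mod tor G\<^esub>"
  interpret t: normal "tor G" G by (rule subgroup_imp_normal[OF tor_subgroup])
  obtain x where x: "x \<in> carrier G" "C = tor G #> x" using C by (auto simp: FactGroup_def RCOSETS_def)
  have "C [^]\<^bsub>G Mod tor G\<^esub> k = tor G #> x [^] k" for k :: nat
    using hom_nat_pow[OF t.r_coset_hom_Mod x(1) _, of k] is_group t.factorgroup_is_group x by simp
  then have "tor G #> x [^] n = tor G" using n by (simp add: FactGroup_def)
  then have "x [^] n \<in> tor G" using x rcos_self[OF _ tor_subgroup, of "x [^] n"] by simp
  then obtain m :: nat where "m > 0" "(x [^] n) [^] m = \<one>" unfolding tor_def by blast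
  then have "n * m > 0" "x [^] (n * m) = \<one>" using x n by (simp_all add: nat_pow_pow)
  then have "x \<in> tor G" using x(1) unfolding tor_def by blast
  then show "C = \<one>\<^bsub>G Mod tor G\<^esub>" using x tor_subgroup by (simp add: FactGroup_def coset_join2)
qed

text \<open>Maps on quotient groups are evaluated here on a representative picked by
  \<open>SOME\<close>; this converts invariance under \<open>H\<close> into independence of the
  pick.\<close>

lemma some_in_coset:
  assumes "subgroup H G" "x \<in> carrier G" "\<And>h. h \<in> H \<Longrightarrow> f (h \<otimes> x) = f x"
  shows "f (SOME y. y \<in> H #> x) = f x"
proof -
  have "(SOME y. y \<in> H #> x) \<in> H #> x" using rcos_self[OF assms(2,1)] by (rule someI)
  then show ?thesis using assms(3) by (auto simp: r_coset_def)
qed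

end

section \<open>Cones in function spaces\<close>

text \<open>Scalar multiplication as a named operation, so that the spans, subspaces and linear maps
  of the \<open>vector_space\<close> locale apply to function spaces such as
  \<open>'a rvec\<close>.\<close>

definition fscale :: "real \<Rightarrow> ('d \<Rightarrow> real) \<Rightarrow> 'd \<Rightarrow> real" where
  "fscale c v = (\<lambda>\<phi>. c * v \<phi>)"

lemma fscale_apply [simp]: "fscale c v \<phi> = c * v \<phi>"
  by (simp add: fscale_def)

global_interpretation fv: vector_space "fscale :: real \<Rightarrow> ('d \<Rightarrow> real) \<Rightarrow> 'd \<Rightarrow> real"
  by standard (auto simp: fun_eq_iff algebra_simps)

global_interpretation fvp: vector_space_pair
  "fscale :: real \<Rightarrow> ('d \<Rightarrow> real) \<Rightarrow> 'd \<Rightarrow> real" "fscale :: real \<Rightarrow> ('e \<Rightarrow> real) \<Rightarrow> 'e \<Rightarrow> real"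
  by standard

abbreviation flinear :: "(('d \<Rightarrow> real) \<Rightarrow> ('e \<Rightarrow> real)) \<Rightarrow> bool" where
  "flinear \<equiv> Vector_Spaces.linear fscale fscale"

lemma sum_fun_apply: "(\<Sum>x\<in>S. f x) \<phi> = (\<Sum>x\<in>S. f x \<phi>)"
  for f :: "'b \<Rightarrow> 'd \<Rightarrow> real"
  by (induction S rule: infinite_finite_induct) auto

lemma flinearI:
  assumes "\<And>v w. p (v + w) = p v + p w" "\<And>c v. p (fscale c v) = fscale c (p v)"
  shows "flinear p"
  using assms by unfold_locales auto

lemma vlin_eq: "vlin S r = (\<Sum>v\<in>S. fscale (r v) v)"
  by (auto simp: vlin_def sum_fun_apply fun_eq_iff)

lemma rspan_eq_span: "rspan V = fv.span V"
  by (auto simp: rspan_def fv.span_explicit vlin_eq)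

text \<open>Convex cones. \<open>gen_cone V\<close> is the least one containing \<open>V\<close>,
  and arguing by this minimality replaces manipulations of coefficient sums.\<close>

definition cone_closed :: "('d \<Rightarrow> real) set \<Rightarrow> bool" where
  "cone_closed C \<longleftrightarrow> 0 \<in> C \<and> (\<forall>u\<in>C. \<forall>v\<in>C. u + v \<in> C) \<and> (\<forall>u\<in>C. \<forall>c\<ge>0. fscale c u \<in> C)"

lemma cone_closed_gen_cone: "cone_closed (gen_cone V)"
  unfolding cone_closed_def
proof (intro conjI ballI allI impI)
  have "vlin {} (\<lambda>_. 0) = 0" by (simp add: vlin_eq)
  then show "0 \<in> gen_cone V" unfolding gen_cone_def by force
  fix u assume "u \<in> gen_cone V"
  then obtain S r where u: "u = vlin S r" "finite S" "S \<subseteq> V" "\<forall>v\<in>S. 0 \<le> r v"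
    by (auto simp: gen_cone_def)
  show "fscale c u \<in> gen_cone V" if "c \<ge> 0" for c
  proof -
    have "fscale c u = vlin S (\<lambda>v. c * r v)"
      by (simp add: u vlin_eq fv.scale_sum_right)
    then show ?thesis using u that unfolding gen_cone_def by force
  qed
  show "u + v \<in> gen_cone V" if vV: "v \<in> gen_cone V" for v
  proof -
    obtain T s where v: "v = vlin T s" "finite T" "T \<subseteq> V" "\<forall>v\<in>T. 0 \<le> s v"
      using vV by (auto simp: gen_cone_def)
    let ?t = "\<lambda>x. (if x \<in> S then r x else 0) + (if x \<in> T then s x else 0)"
    have "(\<Sum>x\<in>S \<union> T. fscale (if x \<in> S then r x else 0) x) = u"
      unfolding u vlin_eq using u v by (intro sum.mono_neutral_cong_right) auto
    moreover have "(\<Sum>x\<in>S \<union> T. fscale (if x \<in> T then s x else 0) x) = v"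
      unfolding v vlin_eq using u v by (intro sum.mono_neutral_cong_right) auto
    ultimately have "u + v = vlin (S \<union> T) ?t"
      by (simp add: vlin_eq fv.scale_left_distrib sum.distrib)
    moreover have "\<forall>x\<in>S \<union> T. 0 \<le> ?t x" using u v by auto
    ultimately show ?thesis using u v unfolding gen_cone_def
      by (intro CollectI exI[of _ "S \<union> T"] exI[of _ ?t]) auto
  qed
qed

lemma subset_gen_cone: "V \<subseteq> gen_cone V"
proof
  fix v assume "v \<in> V"
  moreover have "v = vlin {v} (\<lambda>_. 1)" by (simp add: vlin_eq)
  ultimately show "v \<in> gen_cone V" unfolding gen_cone_def
    by (intro CollectI exI[of _ "{v}"] exI[of _ "\<lambda>_. 1"]) auto
qed

lemma gen_cone_minimal:
  assumes "V \<subseteq> C" "cone_closed C" shows "gen_cone V \<subseteq> C"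
proof
  fix u assume "u \<in> gen_cone V"
  then obtain S r where u: "u = vlin S r" "finite S" "S \<subseteq> V" "\<forall>v\<in>S. 0 \<le> r v"
    by (auto simp: gen_cone_def)
  have "(\<Sum>v\<in>S. fscale (r v) v) \<in> C" using u(2,3,4)
    by (induction S rule: finite_induct) (use assms in \<open>auto simp: cone_closed_def subset_iff\<close>)
  then show "u \<in> C" by (simp add: u vlin_eq)
qed

lemma cone_closed_subspace: "fv.subspace W \<Longrightarrow> cone_closed W"
  by (auto simp: cone_closed_def fv.subspace_0 fv.subspace_add fv.subspace_scale)

lemma gen_cone_subset_span: "gen_cone V \<subseteq> fv.span V"
  by (rule gen_cone_minimal) (auto intro: fv.span_base cone_closed_subspace)

lemma span_gen_cone: "fv.span (gen_cone V) = fv.span V"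
  by (metis fv.span_mono fv.span_span gen_cone_subset_span subset_antisym subset_gen_cone)

text \<open>Minimality used twice: the preimage of a convex cone under \<open>p\<close> is a convex
  cone, and so is the image.\<close>

lemma gen_cone_image:
  assumes "flinear p" shows "p ` gen_cone V = gen_cone (p ` V)"
proof
  interpret p: Vector_Spaces.linear fscale fscale p by fact
  have "cone_closed (p -` gen_cone (p ` V))"
    using cone_closed_gen_cone[of "p ` V"] by (auto simp: cone_closed_def p.add p.scale p.zero)
  then have "gen_cone V \<subseteq> p -` gen_cone (p ` V)"
    using subset_gen_cone[of "p ` V"] by (intro gen_cone_minimal) auto
  then show "p ` gen_cone V \<subseteq> gen_cone (p ` V)" by auto
  have c: "cone_closed (gen_cone V)" by (rule cone_closed_gen_cone)
  have "cone_closed (p ` gen_cone V)"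
    unfolding cone_closed_def
  proof (intro conjI ballI allI impI)
    show "0 \<in> p ` gen_cone V" using c p.zero by (auto simp: cone_closed_def intro!: image_eqI[of _ p 0])
    show "u + v \<in> p ` gen_cone V" if "u \<in> p ` gen_cone V" "v \<in> p ` gen_cone V" for u v
      using that c by (auto simp: cone_closed_def p.add[symmetric])
    show "fscale a u \<in> p ` gen_cone V" if "u \<in> p ` gen_cone V" "a \<ge> 0" for u a
      using that c by (auto simp: cone_closed_def p.scale[symmetric])
  qed
  then show "gen_cone (p ` V) \<subseteq> p ` gen_cone V"
    using subset_gen_cone by (intro gen_cone_minimal) auto
qed

text \<open>In a linear combination of cone vectors, terms with nonnegative coefficient are
  collected in \<open>u\<close> and the negatives of the others in \<open>v\<close>.\<close>

lemma span_cone_closed_diff: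
  assumes C: "cone_closed C" and w: "w \<in> fv.span C"
  shows "\<exists>u\<in>C. \<exists>v\<in>C. w = u - v"
  using w
proof (induction rule: fv.span_induct_alt)
  case base
  then show ?case using C by (intro bexI[of _ 0]) (auto simp: cone_closed_def)
next
  case (step c x y)
  then obtain u v where uv: "u \<in> C" "v \<in> C" "y = u - v" by blast
  show ?case
  proof (cases "c \<ge> 0")
    case True
    then have "fscale c x + u \<in> C" using C step uv by (simp add: cone_closed_def)
    moreover have "fscale c x + y = (fscale c x + u) - v" using uv by simp
    ultimately show ?thesis using uv by blast
  next
    case False
    then have "0 \<le> - c" by simp
    then have "fscale (-c) x \<in> C" using C step(1) unfolding cone_closed_def by blast
    then have "fscale (-c) x + v \<in> C" using C uv unfolding cone_closed_def by blast
    moreover have "fscale c x + y = u - (fscale (-c) x + v)" using uv by (simp add: fun_eq_iff)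
    ultimately show ?thesis using uv by blast
  qed
qed

text \<open>Semi-tameness gives injectivity on a cone only. It spreads to the span because every
  vector there is a difference of two cone vectors.\<close>

lemma inj_on_span_cone:
  assumes C: "cone_closed C" and p: "flinear p" and i: "inj_on p C"
  shows "inj_on p (fv.span C)"
proof -
  interpret p: Vector_Spaces.linear fscale fscale p by fact
  have "w = 0" if w: "w \<in> fv.span C" "p w = 0" for w
  proof -
    obtain u v where uv: "u \<in> C" "v \<in> C" "w = u - v" using span_cone_closed_diff[OF C w(1)] by blast
    then have "p u = p v" using w by (simp add: p.diff)
    then show ?thesis using uv i by (simp add: inj_on_def)
  qed
  then show ?thesis
    by (metis (no_types, lifting) eq_iff_diff_eq_0 fv.span_diff inj_onI p.diff)
qed

lemma flinear_image_span_subset: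
  assumes "flinear p" "p ` A \<subseteq> fv.span B" shows "p ` fv.span A \<subseteq> fv.span B"
proof -
  interpret p: Vector_Spaces.linear fscale fscale p by fact
  show ?thesis using assms(2) by (metis p.span_image fv.span_minimal fv.subspace_span)
qed

text \<open>Pulls the supporting functional of a face back along a linear map; this is how faces are
  transported in either direction.\<close>

lemma rlinear_on_flinear:
  assumes l: "rlinear_on V l" and p: "flinear p" and pV: "p ` U \<subseteq> V"
  shows "rlinear_on U (\<lambda>v. l (p v))"
proof -
  interpret p: Vector_Spaces.linear fscale fscale p by fact
  have *: "(\<lambda>\<phi>. a * v \<phi> + b * w \<phi>) = fscale a v + fscale b w" for a b and v w :: "'x \<Rightarrow> real"
    by (simp add: fun_eq_iff)
  show ?thesis using l pV unfolding rlinear_on_def * by (auto simp: p.add p.scale)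
qed

section \<open>The real space of an abelian group\<close>

text \<open>What \<open>realify\<close> needs of \<open>f\<close>: pulling back integer functionals
  gives integer functionals. Being a homomorphism is sufficient, but \<open>betabar\<close> may fail
  to be one when the group has torsion and still has this property. The value \<open>0\<close> off
  the carrier is the normalisation in \<open>zdual\<close>.\<close>

definition dual_map :: "'a monoid \<Rightarrow> 'b monoid \<Rightarrow> ('a \<Rightarrow> 'b) \<Rightarrow> bool" where
  "dual_map N N' f \<longleftrightarrow> (\<forall>\<phi>\<in>zdual N'. (\<lambda>x. if x \<in> carrier N then \<phi> (f x) else 0) \<in> zdual N)"

lemma dual_map_hom:
  assumes "monoid N" "f \<in> hom N N'" shows "dual_map N N' f"
  using assms by (auto simp: dual_map_def zdual_def hom_def Pi_iff monoid.m_closed)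

lemma flinear_realify: "flinear (realify N N' f)"
  by (rule flinearI) (auto simp: realify_def fun_eq_iff)

lemma realify_ev:
  assumes "dual_map N N' f" "x \<in> carrier N"
  shows "realify N N' f (ev N x) = ev N' (f x)"
  using assms by (auto simp: realify_def ev_def dual_map_def fun_eq_iff)

lemma realify_realspace:
  assumes f: "dual_map N N' f" and v: "v \<in> realspace N"
  shows "realify N N' f v \<in> realspace N'"
proof -
  have "realify N N' f v (\<lambda>x. \<phi> x + \<psi> x) = realify N N' f v \<phi> + realify N N' f v \<psi>"
    if h: "\<phi> \<in> zdual N'" "\<psi> \<in> zdual N'" for \<phi> \<psi>
  proof -
    have "(\<lambda>x. \<phi> x + \<psi> x) \<in> zdual N'" using h by (auto simp: zdual_def)
    moreover have "(\<lambda>x. if x \<in> carrier N then \<phi> (f x) + \<psi> (f x) else 0) =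
      (\<lambda>x. (if x \<in> carrier N then \<phi> (f x) else 0) + (if x \<in> carrier N then \<psi> (f x) else 0))"
      by (simp add: fun_eq_iff)
    ultimately show ?thesis using h f v unfolding realify_def realspace_def dual_map_def by simp
  qed
  then show ?thesis by (auto simp: realspace_def realify_def)
qed

lemma realify_comp:
  assumes "f \<in> carrier N \<rightarrow> carrier N'" "dual_map N' N'' g"
  shows "realify N' N'' g (realify N N' f v) = realify N N'' (\<lambda>x. g (f x)) v"
  using assms
  by (auto simp: realify_def dual_map_def fun_eq_iff Pi_iff cong: if_cong intro!: arg_cong[of _ _ v])

lemma realify_cong:
  assumes "\<And>x. x \<in> carrier N \<Longrightarrow> f x = g x"
  shows "realify N N' f = realify N N' g"
  using assms by (auto simp: realify_def fun_eq_iff cong: if_cong)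

lemma realify_id:
  assumes "v \<in> realspace N" shows "realify N N (\<lambda>x. x) v = v"
proof -
  have "(\<lambda>x. if x \<in> carrier N then \<phi> x else 0) = \<phi>" if "\<phi> \<in> zdual N" for \<phi>
    using that by (auto simp: zdual_def)
  then show ?thesis using assms by (auto simp: realify_def realspace_def)
qed

lemma subspace_realspace: "fv.subspace (realspace N)"
  by (auto simp: fv.subspace_def realspace_def algebra_simps)

lemma ev_realspace: "ev N x \<in> realspace N"
proof -
  have "(\<lambda>x. \<phi> x + \<psi> x) \<in> zdual N" if "\<phi> \<in> zdual N" "\<psi> \<in> zdual N" for \<phi> \<psi>
    using that by (auto simp: zdual_def)
  then show ?thesis by (auto simp: realspace_def ev_def)
qed

lemma span_ev_realspace: "fv.span (ev N ` S) \<subseteq> realspace N"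
  by (rule fv.span_minimal) (auto simp: ev_realspace subspace_realspace)

lemma is_cone_realspace: "is_cone N \<sigma> \<Longrightarrow> \<sigma> \<subseteq> realspace N"
  using gen_cone_subset_span span_ev_realspace by (fastforce simp: is_cone_def)

lemma is_cone_closed: "is_cone N \<sigma> \<Longrightarrow> cone_closed \<sigma>"
  using cone_closed_gen_cone by (auto simp: is_cone_def)

lemma ev_mult:
  assumes "x \<in> carrier N" "y \<in> carrier N"
  shows "ev N (x \<otimes>\<^bsub>N\<^esub> y) = ev N x + ev N y"
  using assms by (auto simp: ev_def zdual_def fun_eq_iff)

lemma zdual_additive_on: "\<phi> \<in> zdual N \<Longrightarrow> additive_on N (carrier N) \<phi>"
  by (auto simp: zdual_def additive_on_def)

lemma zdual_int_pow:
  assumes "comm_group N" "\<phi> \<in> zdual N" "x \<in> carrier N"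
  shows "\<phi> (x [^]\<^bsub>N\<^esub> (k::int)) = k * \<phi> x"
proof -
  interpret comm_group N by fact
  show ?thesis by (rule additive_on_int_pow[OF subgroup_self zdual_additive_on[OF assms(2)] assms(3)])
qed

lemma zdual_tor:
  assumes "comm_group N" "\<phi> \<in> zdual N" "x \<in> tor N" shows "\<phi> x = 0"
proof -
  interpret comm_group N by fact
  obtain n :: nat where n: "n > 0" "x [^]\<^bsub>N\<^esub> n = \<one>\<^bsub>N\<^esub>" "x \<in> carrier N" using assms(3) by (auto simp: tor_def)
  have "int n * \<phi> x = \<phi> \<one>\<^bsub>N\<^esub>" using zdual_int_pow[OF assms(1,2) n(3), of "int n"] n by (simp add: int_pow_int)
  then show ?thesis using additive_on_one[OF subgroup_self zdual_additive_on[OF assms(2)]] n by simp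
qed

lemma ev_int_pow:
  assumes "comm_group N" "x \<in> carrier N"
  shows "ev N (x [^]\<^bsub>N\<^esub> (k::int)) = fscale (of_int k) (ev N x)"
  by (auto simp: ev_def fun_eq_iff zdual_int_pow[OF assms(1) _ assms(2)])

lemma ev_nat_pow:
  assumes "comm_group N" "x \<in> carrier N"
  shows "ev N (x [^]\<^bsub>N\<^esub> (k::nat)) = fscale (of_nat k) (ev N x)"
  using ev_int_pow[OF assms, of "int k"] by (simp add: int_pow_int)

lemma ev_one: "comm_group N \<Longrightarrow> ev N \<one>\<^bsub>N\<^esub> = 0"
  using ev_nat_pow[of N "\<one>\<^bsub>N\<^esub>" 0]
  by (simp add: comm_group_def comm_monoid_def monoid.one_closed fun_eq_iff)

lemma ev_inv:
  assumes "comm_group N" "x \<in> carrier N"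
  shows "ev N (inv\<^bsub>N\<^esub> x) = - ev N x"
proof -
  interpret comm_group N by fact
  have "ev N (inv\<^bsub>N\<^esub> x) + ev N x = 0"
    using ev_mult[of "inv\<^bsub>N\<^esub> x" N x] assms by (simp add: ev_one)
  then show ?thesis by (simp add: eq_neg_iff_add_eq_0)
qed

lemma subgroup_ev_mem_subspace:
  assumes "comm_group N" "fv.subspace W"
  shows "subgroup {x \<in> carrier N. ev N x \<in> W} N"
proof -
  interpret comm_group N by fact
  show ?thesis
    by (rule subgroupI) (use assms in \<open>auto simp: ev_mult ev_inv fv.subspace_add fv.subspace_neg
        intro!: exI[of _ "\<one>\<^bsub>N\<^esub>"] simp: ev_one fv.subspace_0\<close>)
qed

text \<open>The extension over a finite generating set already lives on all of \<open>N\<close>. A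
  factor \<open>m\<close> is unavoidable: half of the identity on the even integers does not extend
  integrally with any other denominator removed.\<close>

lemma zdual_extend:
  assumes N: "comm_group N" "fin_gen N" and A: "subgroup A N" "additive_on N A \<psi>"
  shows "\<exists>\<phi>\<in>zdual N. \<exists>m>0. \<forall>y\<in>A. \<phi> y = m * \<psi> y"
proof -
  interpret comm_group N by fact
  obtain S where S: "finite S" "S \<subseteq> carrier N" "generate N S = carrier N" using N(2) by (auto simp: fin_gen_def)
  obtain \<phi> m B where B: "m > 0" "subgroup B N" "A \<subseteq> B" "S \<subseteq> B" "additive_on N B \<phi>" "\<forall>y\<in>A. \<phi> y = m * \<psi> y"
    using additive_extend[OF A S(1,2)] by blast
  have "carrier N \<subseteq> B" using generate_subgroup_incl[OF B(4,2)] S by simp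
  then have BN: "B = carrier N" using subgroup.subset[OF B(2)] by blast
  let ?\<phi> = "\<lambda>x. if x \<in> carrier N then \<phi> x else 0"
  have "?\<phi> \<in> zdual N" using B(5)[unfolded BN additive_on_def] by (simp add: zdual_def)
  moreover have "\<forall>y\<in>A. ?\<phi> y = m * \<psi> y" using B(3,6) unfolding BN by auto
  ultimately show ?thesis using B(1) by (intro bexI[of _ ?\<phi>] exI[of _ m] conjI)
qed

text \<open>The hypothesis makes \<open>x\<close> free over \<open>A\<close>, so a functional may be
  declared to be \<open>1\<close> at \<open>x\<close> and \<open>0\<close> on \<open>A\<close>; a
  positive multiple of it extends to \<open>N\<close>.\<close>

lemma zdual_separate:
  assumes N: "comm_group N" "fin_gen N" and A: "subgroup A N" and x: "x \<in> carrier N"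
    and n: "\<And>n::nat. n > 0 \<Longrightarrow> x [^]\<^bsub>N\<^esub> n \<notin> A"
  shows "\<exists>\<phi>\<in>zdual N. (\<forall>y\<in>A. \<phi> y = 0) \<and> \<phi> x \<noteq> 0"
proof -
  interpret comm_group N by fact
  have A0: "additive_on N A (\<lambda>_. 0)" by (simp add: additive_on_def)
  \<comment> \<open>For the zero functional on \<open>A\<close> and \<open>c = m = 1\<close>, the
    compatibility condition of \<open>additive_adjoin\<close> says that \<open>x^k\<close> lies in
    \<open>A\<close> only for \<open>k = 0\<close>.\<close>
  have k0: "k * 1 = 1 * (\<lambda>_. 0) (x [^]\<^bsub>N\<^esub> k)" if k: "x [^]\<^bsub>N\<^esub> k \<in> A" for k :: int
  proof (rule ccontr)
    assume "\<not> ?thesis"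
    then have "k \<noteq> 0" by simp
    have "x [^]\<^bsub>N\<^esub> \<bar>k\<bar> \<in> A"
      using k x A by (auto simp: abs_if int_pow_neg subgroup.m_inv_closed)
    then have "x [^]\<^bsub>N\<^esub> (nat \<bar>k\<bar>) \<in> A" by (metis abs_ge_zero int_nat_eq int_pow_int)
    then show False using n[of "nat \<bar>k\<bar>"] \<open>k \<noteq> 0\<close> by simp
  qed
  obtain \<psi> where \<psi>: "additive_on N (adjoin N x A) \<psi>"
    "\<forall>k. \<forall>y\<in>A. \<psi> (x [^]\<^bsub>N\<^esub> (k::int) \<otimes>\<^bsub>N\<^esub> y) = k * 1 + 1 * 0"
    using additive_adjoin[OF A A0 x k0] by metis
  obtain \<phi> m where \<phi>: "\<phi> \<in> zdual N" "m > 0" "\<forall>y\<in>adjoin N x A. \<phi> y = m * \<psi> y"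
    using zdual_extend[OF N adjoin_subgroup[OF A x] \<psi>(1)] by blast
  have "\<psi> y = 0" if "y \<in> A" for y
    using \<psi>(2)[rule_format, OF that, of 0] subgroup.mem_carrier[OF A that] by simp
  moreover have "\<psi> x = 1"
    using \<psi>(2)[rule_format, OF subgroup.one_closed[OF A], of 1] x by simp
  ultimately have "\<forall>y\<in>A. \<phi> y = 0" "\<phi> x \<noteq> 0" using \<phi> subset_adjoin[OF A x] by auto
  then show ?thesis using \<phi>(1) by blast
qed

lemma ev_eq_0_imp_tor:
  assumes N: "comm_group N" "fin_gen N" and x: "x \<in> carrier N" "ev N x = 0"
  shows "x \<in> tor N"
proof (rule ccontr)
  interpret comm_group N by fact
  assume "x \<notin> tor N"
  then have "\<And>n::nat. n > 0 \<Longrightarrow> x [^]\<^bsub>N\<^esub> n \<notin> {\<one>\<^bsub>N\<^esub>}" using x unfolding tor_def by blast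
  then obtain \<phi> where "\<phi> \<in> zdual N" "\<phi> x \<noteq> 0"
    using zdual_separate[OF N triv_subgroup x(1)] by blast
  then show False using fun_cong[OF x(2), of \<phi>] by (simp add: ev_def)
qed

lemma torsion_free_ev_inj:
  assumes N: "comm_group N" "fin_gen N" and H: "subgroup H N" "torsion_free N H"
  shows "inj_on (ev N) H"
proof (rule inj_onI)
  interpret comm_group N by fact
  fix x y assume xy: "x \<in> H" "y \<in> H" "ev N x = ev N y"
  have c: "x \<in> carrier N" "y \<in> carrier N" using xy subgroup.mem_carrier[OF H(1)] by auto
  have d: "x \<otimes>\<^bsub>N\<^esub> inv\<^bsub>N\<^esub> y \<in> H" using xy H(1) by (simp add: subgroup.m_closed subgroup.m_inv_closed)
  have "ev N (x \<otimes>\<^bsub>N\<^esub> inv\<^bsub>N\<^esub> y) = 0" using xy c N(1) by (simp add: ev_mult ev_inv)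
  then have "x \<otimes>\<^bsub>N\<^esub> inv\<^bsub>N\<^esub> y \<in> tor N" using ev_eq_0_imp_tor[OF N] c by simp
  then have "x \<otimes>\<^bsub>N\<^esub> inv\<^bsub>N\<^esub> y = \<one>\<^bsub>N\<^esub>" using d H(2) by (auto simp: tor_def torsion_free_def)
  then show "x = y" using c by (metis inv_equality inv_inv inv_closed)
qed

text \<open>As a subgroup of a finitely generated abelian group, \<open>A\<close> has a finite
  generating set, and bounding the orders of these generators modulo \<open>H\<close> bounds the
  number of cosets.\<close>

lemma finite_cosets_of_pow_mem:
  assumes N: "comm_group N" "fin_gen N" and H: "subgroup H N" and A: "subgroup A N"
    and p: "\<And>x. x \<in> A \<Longrightarrow> \<exists>n::nat. n > 0 \<and> x [^]\<^bsub>N\<^esub> n \<in> H"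
  shows "finite {H #>\<^bsub>N\<^esub> x | x. x \<in> A}"
proof -
  interpret comm_group N by fact
  obtain S where S: "finite S" "S \<subseteq> carrier N" "generate N S = carrier N" using N(2) by (auto simp: fin_gen_def)
  obtain T where T: "finite T" "T \<subseteq> carrier N" "A = generate N T"
    using subgroup_of_fin_gen[OF S(1,2) A] subgroup.subset[OF A] S(3) by auto
  have "T \<subseteq> A" using T by (auto intro: generate.incl)
  then show ?thesis using finite_cosets_generate[OF H T(1,2)] p T(3) by auto
qed

section \<open>KM fans and their transport\<close>

locale kmf =
  fixes K :: "'a kmfan"
  assumes km: "km_fan K"
begin

sublocale N: comm_group "grp K"
  using km by (simp add: km_fan_def)

lemma fg: "fin_gen (grp K)"
  and finite_cones: "finite (cones K)"
  and cones_nonempty: "cones K \<noteq> {}"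
  using km by (simp_all add: km_fan_def is_fan_def)

lemma is_cone: "\<sigma> \<in> cones K \<Longrightarrow> is_cone (grp K) \<sigma>"
  and cone_sharp: "\<sigma> \<in> cones K \<Longrightarrow> sharp \<sigma>"
  and face_in_cones: "\<sigma> \<in> cones K \<Longrightarrow> is_face (grp K) \<tau> \<sigma> \<Longrightarrow> \<tau> \<in> cones K"
  and inter_face: "\<sigma> \<in> cones K \<Longrightarrow> \<sigma>' \<in> cones K \<Longrightarrow> is_face (grp K) (\<sigma> \<inter> \<sigma>') \<sigma>"
    "\<sigma> \<in> cones K \<Longrightarrow> \<sigma>' \<in> cones K \<Longrightarrow> is_face (grp K) (\<sigma> \<inter> \<sigma>') \<sigma>'"
  using km by (simp_all add: km_fan_def is_fan_def)

lemma lat_subgroup: "\<sigma> \<in> cones K \<Longrightarrow> subgroup (lat K \<sigma>) (grp K)"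
  and lat_subset_Nsig: "\<sigma> \<in> cones K \<Longrightarrow> lat K \<sigma> \<subseteq> Nsig (grp K) \<sigma>"
  and lat_torsion_free: "\<sigma> \<in> cones K \<Longrightarrow> torsion_free (grp K) (lat K \<sigma>)"
  and lat_finite_index: "\<sigma> \<in> cones K \<Longrightarrow> finite {lat K \<sigma> #>\<^bsub>grp K\<^esub> x | x. x \<in> Nsig (grp K) \<sigma>}"
  using km by (simp_all add: km_fan_def)

lemma lat_face:
  assumes "\<sigma> \<in> cones K" "is_face (grp K) \<tau> \<sigma>"
  shows "lat K \<tau> = {x \<in> lat K \<sigma>. ev (grp K) x \<in> fv.span \<tau>}"
  using km assms face_in_cones[OF assms] unfolding km_fan_def rspan_eq_span by blast

lemma lat_carrier: "\<sigma> \<in> cones K \<Longrightarrow> x \<in> lat K \<sigma> \<Longrightarrow> x \<in> carrier (grp K)"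
  using lat_subgroup subgroup.mem_carrier by metis

lemma lat_face_subset: "\<sigma> \<in> cones K \<Longrightarrow> is_face (grp K) \<tau> \<sigma> \<Longrightarrow> lat K \<tau> \<subseteq> lat K \<sigma>"
  using lat_face by blast

lemma face_subset: "is_face N \<tau> \<sigma> \<Longrightarrow> \<tau> \<subseteq> \<sigma>"
  by (auto simp: is_face_def)

lemma cone_realspace: "\<sigma> \<in> cones K \<Longrightarrow> \<sigma> \<subseteq> realspace (grp K)"
  using is_cone is_cone_realspace by blast

lemma lat_ev_span: "\<sigma> \<in> cones K \<Longrightarrow> x \<in> lat K \<sigma> \<Longrightarrow> ev (grp K) x \<in> fv.span \<sigma>"
  using lat_subset_Nsig by (auto simp: Nsig_def rspan_eq_span)

lemma Nsig_subgroup: "subgroup (Nsig (grp K) \<sigma>) (grp K)"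
  using subgroup_ev_mem_subspace[OF N.comm_group_axioms fv.subspace_span]
  by (simp add: Nsig_def rspan_eq_span)

lemma Nsig_pow_lat:
  assumes "\<sigma> \<in> cones K" "x \<in> Nsig (grp K) \<sigma>"
  shows "\<exists>n::nat. n > 0 \<and> x [^]\<^bsub>grp K\<^esub> n \<in> lat K \<sigma>"
  by (rule N.pow_mem_of_finite_cosets[OF lat_subgroup Nsig_subgroup _ lat_finite_index]) (use assms in auto)

text \<open>Generators of \<open>\<sigma>\<close> lie in \<open>Nsig\<close>, where
  \<open>lat K \<sigma>\<close> has finite index, so each has a positive power in the lattice. Under
  \<open>ev\<close> this power is a positive multiple, which leaves the cone unchanged.\<close>

lemma cone_generators:
  assumes s: "\<sigma> \<in> cones K"
  shows "\<exists>S. finite S \<and> S \<subseteq> lat K \<sigma> \<and> \<sigma> = gen_cone (ev (grp K) ` S)"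
proof -
  let ?ev = "ev (grp K)"
  obtain S where S: "finite S" "S \<subseteq> carrier (grp K)" "\<sigma> = gen_cone (?ev ` S)"
    using is_cone[OF s] by (auto simp: is_cone_def)
  have "S \<subseteq> Nsig (grp K) \<sigma>"
    using S subset_gen_cone[of "?ev ` S"] by (auto simp: Nsig_def rspan_eq_span intro: fv.span_base)
  then have "\<forall>x\<in>S. \<exists>n::nat. n > 0 \<and> x [^]\<^bsub>grp K\<^esub> n \<in> lat K \<sigma>" using Nsig_pow_lat[OF s] by blast
  then obtain n :: "'a \<Rightarrow> nat" where n: "\<And>x. x \<in> S \<Longrightarrow> n x > 0 \<and> x [^]\<^bsub>grp K\<^esub> n x \<in> lat K \<sigma>" by metis
  let ?T = "(\<lambda>x. x [^]\<^bsub>grp K\<^esub> n x) ` S"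
  have evT: "?ev (x [^]\<^bsub>grp K\<^esub> n x) = fscale (n x) (?ev x)" if "x \<in> S" for x
    using ev_nat_pow[OF N.comm_group_axioms] S that by blast
  have "\<sigma> = gen_cone (?ev ` ?T)"
  proof
    show "gen_cone (?ev ` ?T) \<subseteq> \<sigma>"
      using S(3) evT subset_gen_cone[of "?ev ` S"] cone_closed_gen_cone[of "?ev ` S"]
      by (intro gen_cone_minimal) (auto simp: cone_closed_def)
    have "?ev x \<in> gen_cone (?ev ` ?T)" if x: "x \<in> S" for x
    proof -
      have "?ev x = fscale (1 / n x) (?ev (x [^]\<^bsub>grp K\<^esub> n x))"
        using n[OF x] by (simp add: evT[OF x] fun_eq_iff)
      moreover have "?ev (x [^]\<^bsub>grp K\<^esub> n x) \<in> gen_cone (?ev ` ?T)"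
        using x by (intro subsetD[OF subset_gen_cone] imageI)
      ultimately show ?thesis using cone_closed_gen_cone[of "?ev ` ?T"] by (simp add: cone_closed_def)
    qed
    then show "\<sigma> \<subseteq> gen_cone (?ev ` ?T)"
      unfolding S(3) by (intro gen_cone_minimal cone_closed_gen_cone) auto
  qed
  moreover have "finite ?T" "?T \<subseteq> lat K \<sigma>" using S n by auto
  ultimately show ?thesis by blast
qed

lemma span_lat: 
  assumes s: "\<sigma> \<in> cones K" shows "fv.span (ev (grp K) ` lat K \<sigma>) = fv.span \<sigma>"
proof
  show "fv.span (ev (grp K) ` lat K \<sigma>) \<subseteq> fv.span \<sigma>"
    using lat_ev_span[OF s] by (intro fv.span_minimal) auto
  obtain S where S: "S \<subseteq> lat K \<sigma>" "\<sigma> = gen_cone (ev (grp K) ` S)" using cone_generators[OF s] by blast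
  show "fv.span \<sigma> \<subseteq> fv.span (ev (grp K) ` lat K \<sigma>)"
    using fv.span_mono[OF image_mono[OF S(1)], of "ev (grp K)"] span_gen_cone[of "ev (grp K) ` S"]
    by (simp flip: S(2))
qed

lemma lat_fin_gen:
  assumes "\<sigma> \<in> cones K"
  shows "\<exists>T. finite T \<and> T \<subseteq> carrier (grp K) \<and> lat K \<sigma> = generate (grp K) T"
proof -
  obtain S where S: "finite S" "S \<subseteq> carrier (grp K)" "generate (grp K) S = carrier (grp K)"
    using fg by (auto simp: fin_gen_def)
  show ?thesis
    using N.subgroup_of_fin_gen[OF S(1,2) lat_subgroup[OF assms]] lat_carrier[OF assms] S(3) by blast
qed

text \<open>A functional vanishing on \<open>H\<close> vanishes on all lattices, hence on the span
  of every cone. Atoroidality makes these spans add up to the whole real space, so the functional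
  cannot separate any element from \<open>H\<close>.\<close>

lemma atoroidal_finite_cosets:
  assumes a: "atoroidal K" and H: "subgroup H (grp K)" and lH: "\<And>\<sigma>. \<sigma> \<in> cones K \<Longrightarrow> lat K \<sigma> \<subseteq> H"
  shows "finite (rcosets\<^bsub>grp K\<^esub> H)"
proof -
  have "\<exists>n::nat. n > 0 \<and> x [^]\<^bsub>grp K\<^esub> n \<in> H" if x: "x \<in> carrier (grp K)" for x
  proof (rule ccontr)
    assume "\<not> ?thesis"
    then obtain \<phi> where \<phi>: "\<phi> \<in> zdual (grp K)" "\<forall>y\<in>H. \<phi> y = 0" "\<phi> x \<noteq> 0"
      using zdual_separate[OF N.comm_group_axioms fg H x] by blast
    obtain w where w: "\<forall>\<sigma>\<in>cones K. w \<sigma> \<in> rspan \<sigma>" "ev (grp K) x = (\<lambda>\<phi>. \<Sum>\<sigma>\<in>cones K. w \<sigma> \<phi>)"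
      using a[unfolded atoroidal_def, rule_format, OF ev_realspace] by metis
    have "w \<sigma> \<phi> = 0" if s: "\<sigma> \<in> cones K" for \<sigma>
    proof -
      have "w \<sigma> \<in> fv.span (ev (grp K) ` lat K \<sigma>)" using w(1) s span_lat[OF s] by (simp add: rspan_eq_span)
      then show ?thesis
      proof (rule fv.span_induct[where P = "\<lambda>v. v \<phi> = 0"])
        show "fv.subspace {v. v \<phi> = 0}" by (simp add: fv.subspace_def)
      qed (use \<phi> lH[OF s] in \<open>auto simp: ev_def\<close>)
    qed
    then have "ev (grp K) x \<phi> = 0" using w(2) by simp
    then show False using \<phi> by (simp add: ev_def)
  qed
  then have "finite {H #>\<^bsub>grp K\<^esub> x | x. x \<in> carrier (grp K)}"
    by (intro finite_cosets_of_pow_mem[OF N.comm_group_axioms fg H N.subgroup_self]) auto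
  moreover have "rcosets\<^bsub>grp K\<^esub> H = {H #>\<^bsub>grp K\<^esub> x | x. x \<in> carrier (grp K)}" by (auto simp: RCOSETS_def)
  ultimately show ?thesis by simp
qed

end

section \<open>The fan of images of cones under maps out of the lattices\<close>

text \<open>The common shape of \<open>unfold\<close> and \<open>urig\<close>, with the structure
  maps \<open>j\<close> as a parameter, so that one transport argument serves both.\<close>

definition img_fan :: "'a kmfan \<Rightarrow> 'b monoid \<Rightarrow> ('a rcone \<Rightarrow> 'a \<Rightarrow> 'b) \<Rightarrow> 'b kmfan" where
  "img_fan K M j = (let cn = (\<lambda>\<sigma>. lin_img (grp K) M (j \<sigma>) (lat K \<sigma>) \<sigma>)
     in (M, cn ` cones K, (\<lambda>\<sigma>'. \<Union>{j \<sigma> ` lat K \<sigma> | \<sigma>. \<sigma> \<in> cones K \<and> cn \<sigma> = \<sigma>'})))"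

text \<open>The map \<open>b\<close> need not be a homomorphism, only become one after composition with every
  functional on \<open>N\<close>: this is all that survives of \<open>\<beta>\<close> on the torsion-free quotient of
  \<open>\<Lambda>\<close> when \<open>N\<close> has torsion.\<close>

locale unfolding_data = kmf K for K :: "'a kmfan" +
  fixes M :: "'b monoid" and j :: "'a rcone \<Rightarrow> 'a \<Rightarrow> 'b" and b :: "'b \<Rightarrow> 'a"
  assumes M: "comm_group M"
    and j_closed: "\<And>\<sigma> x. \<sigma> \<in> cones K \<Longrightarrow> x \<in> lat K \<sigma> \<Longrightarrow> j \<sigma> x \<in> carrier M"
    and j_mult: "\<And>\<sigma> x y. \<sigma> \<in> cones K \<Longrightarrow> x \<in> lat K \<sigma> \<Longrightarrow> y \<in> lat K \<sigma> \<Longrightarrow>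
      j \<sigma> (x \<otimes>\<^bsub>grp K\<^esub> y) = j \<sigma> x \<otimes>\<^bsub>M\<^esub> j \<sigma> y"
    and j_face: "\<And>\<sigma> \<tau> x. \<sigma> \<in> cones K \<Longrightarrow> is_face (grp K) \<tau> \<sigma> \<Longrightarrow> x \<in> lat K \<tau> \<Longrightarrow> j \<tau> x = j \<sigma> x"
    and j_generate: "generate M (\<Union>\<sigma>\<in>cones K. j \<sigma> ` lat K \<sigma>) = carrier M"
    and b_dual: "dual_map M (grp K) b"
    and ev_b_j: "\<And>\<sigma> x. \<sigma> \<in> cones K \<Longrightarrow> x \<in> lat K \<sigma> \<Longrightarrow> ev (grp K) (b (j \<sigma> x)) = ev (grp K) x"
begin

sublocale M: comm_group M by (rule M)

abbreviation "p \<equiv> realify M (grp K) b"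
abbreviation "W \<sigma> \<equiv> fv.span (ev M ` j \<sigma> ` lat K \<sigma>)"
abbreviation "cn \<sigma> \<equiv> lin_img (grp K) M (j \<sigma>) (lat K \<sigma>) \<sigma>"
abbreviation "U \<equiv> img_fan K M j"

sublocale p: Vector_Spaces.linear fscale fscale p
  by (rule flinear_realify)

lemma grp_U [simp]: "grp U = M"
  and cones_U: "cones U = cn ` cones K"
  and lat_U: "lat U \<sigma>' = \<Union>{j \<sigma> ` lat K \<sigma> | \<sigma>. \<sigma> \<in> cones K \<and> cn \<sigma> = \<sigma>'}"
  by (simp_all add: img_fan_def grp_def cones_def lat_def)

lemma group_hom_j:
  assumes "\<sigma> \<in> cones K"
  shows "group_hom (grp K \<lparr>carrier := lat K \<sigma>\<rparr>) M (j \<sigma>)"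
  using assms N.subgroup_imp_group[OF lat_subgroup[OF assms]]
  by (auto simp: group_hom_def group_hom_axioms_def hom_def j_closed j_mult M.is_group)

lemma j_image_subgroup:
  assumes "\<sigma> \<in> cones K" shows "subgroup (j \<sigma> ` lat K \<sigma>) M"
  using group_hom.img_is_subgroup[OF group_hom_j[OF assms]] by simp

lemma p_j: "\<sigma> \<in> cones K \<Longrightarrow> x \<in> lat K \<sigma> \<Longrightarrow> p (ev M (j \<sigma> x)) = ev (grp K) x"
  using realify_ev[OF b_dual j_closed] ev_b_j by metis

text \<open>There are finitely many cones, and each lattice is finitely generated as a subgroup of a
  finitely generated abelian group.\<close>

lemma fin_gen_M: "fin_gen M"
proof -
  obtain T where T: "\<And>\<sigma>. \<sigma> \<in> cones K \<Longrightarrow> finite (T \<sigma>) \<and> T \<sigma> \<subseteq> carrier (grp K) \<and> lat K \<sigma> = generate (grp K) (T \<sigma>)"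
    using lat_fin_gen by metis
  let ?S = "\<Union>\<sigma>\<in>cones K. j \<sigma> ` T \<sigma>"
  have TL: "T \<sigma> \<subseteq> lat K \<sigma>" if "\<sigma> \<in> cones K" for \<sigma> using T[OF that] by (auto intro: generate.incl)
  have SM: "?S \<subseteq> carrier M" using TL j_closed by blast
  have sg: "subgroup (generate M ?S) M" by (rule M.generate_is_subgroup[OF SM])
  have "j \<sigma> ` lat K \<sigma> \<subseteq> generate M ?S" if s: "\<sigma> \<in> cones K" for \<sigma>
  proof -
    interpret h: group_hom "grp K \<lparr>carrier := lat K \<sigma>\<rparr>" M "j \<sigma>" by (rule group_hom_j[OF s])
    have "lat K \<sigma> = generate (grp K \<lparr>carrier := lat K \<sigma>\<rparr>) (T \<sigma>)"
      using N.generate_consistent[OF TL[OF s] lat_subgroup[OF s]] T[OF s] by simp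
    then have "j \<sigma> ` lat K \<sigma> = generate M (j \<sigma> ` T \<sigma>)"
      using h.generate_img[of "T \<sigma>"] TL[OF s] by simp
    also have "\<dots> \<subseteq> generate M ?S" using s by (intro M.mono_generate) auto
    finally show ?thesis .
  qed
  then have "generate M (\<Union>\<sigma>\<in>cones K. j \<sigma> ` lat K \<sigma>) \<subseteq> generate M ?S"
    by (intro M.generate_subgroup_incl[OF _ sg]) auto
  then have "generate M ?S = carrier M" using j_generate M.generate_incl[OF SM] by auto
  moreover have "finite ?S" using T finite_cones by auto
  ultimately show ?thesis using SM unfolding fin_gen_def by blast
qed

lemma W_realspace: "W \<sigma> \<subseteq> realspace M"
  by (rule span_ev_realspace)

text \<open>Functionals on \<open>F\<^sub>\<sigma>\<close> extend, up to a positive multiple, to functionals on \<open>N\<close>; hence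
  \<open>p\<close> loses nothing on the span of the image of \<open>F\<^sub>\<sigma>\<close>.\<close>

lemma p_inj_W:
  assumes s: "\<sigma> \<in> cones K" shows "inj_on p (W \<sigma>)"
proof -
  have z: "w = 0" if w: "w \<in> W \<sigma>" "p w = 0" for w
  proof
    fix \<psi>
    show "w \<psi> = 0 \<psi>"
    proof (cases "\<psi> \<in> zdual M")
      case False
      moreover have "w \<in> realspace M" using w(1) W_realspace by blast
      ultimately show ?thesis by (simp add: realspace_def)
    next
      case True
      have "additive_on (grp K) (lat K \<sigma>) (\<lambda>x. \<psi> (j \<sigma> x))"
        using True s by (simp add: additive_on_def zdual_def j_mult j_closed)
      then obtain \<phi> m where \<phi>: "\<phi> \<in> zdual (grp K)" "m > 0" "\<forall>x\<in>lat K \<sigma>. \<phi> x = m * \<psi> (j \<sigma> x)"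
        using zdual_extend[OF N.comm_group_axioms fg lat_subgroup[OF s]] by blast
      \<comment> \<open>By the choice of \<open>\<phi>\<close> this holds at each
        \<open>ev M (j \<sigma> x)\<close>, and both sides are linear in \<open>w\<close>. So
        \<open>p w = 0\<close> forces \<open>w\<close> to vanish at the arbitrary functional
        \<open>\<psi>\<close>.\<close>
      have "p w \<phi> = of_int m * w \<psi>" using w(1)
      proof (rule fv.span_induct[where P = "\<lambda>w. p w \<phi> = of_int m * w \<psi>"])
        show "fv.subspace {w. p w \<phi> = of_int m * w \<psi>}"
          by (simp add: fv.subspace_def p.add p.scale p.zero algebra_simps)
        fix v assume "v \<in> ev M ` j \<sigma> ` lat K \<sigma>"
        then obtain x where "x \<in> lat K \<sigma>" "v = ev M (j \<sigma> x)" by blast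
        then show "p v \<phi> = of_int m * v \<psi>" using p_j[OF s] \<phi> True by (simp add: ev_def)
      qed
      then show ?thesis using w(2) \<phi>(2) by simp
    qed
  qed
  show ?thesis
  proof (rule inj_onI)
    fix u v assume "u \<in> W \<sigma>" "v \<in> W \<sigma>" "p u = p v"
    then have "u - v = 0" by (intro z fv.span_diff) (simp_all add: p.diff)
    then show "u = v" by simp
  qed
qed

lemma p_W: "\<sigma> \<in> cones K \<Longrightarrow> p ` W \<sigma> = fv.span \<sigma>"
proof -
  assume s: "\<sigma> \<in> cones K"
  have "p ` ev M ` j \<sigma> ` lat K \<sigma> = ev (grp K) ` lat K \<sigma>" using p_j[OF s] by (force simp: image_image)
  then show ?thesis using p.span_image[of "ev M ` j \<sigma> ` lat K \<sigma>"] span_lat[OF s] by simp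
qed

text \<open>\<open>p\<close> sends a combination of the \<open>ev M (j \<sigma> x)\<close> to the
  same combination of the \<open>ev (grp K) x\<close>, so the side condition in
  \<open>lin_img\<close> depends on \<open>p w\<close> alone. The choice of \<open>S\<close> and
  \<open>r\<close> disappears, and the later arguments use this form.\<close>

lemma cn_eq:
  assumes s: "\<sigma> \<in> cones K" shows "cn \<sigma> = {w \<in> W \<sigma>. p w \<in> \<sigma>}"
proof (intro Set.set_eqI iffI)
  have sum_eq: "(\<lambda>\<phi>. \<Sum>x\<in>S. r x * f x \<phi>) = (\<Sum>x\<in>S. fscale (r x) (f x))"
    for S :: "'a set" and r and f :: "'a \<Rightarrow> ('x \<Rightarrow> int) \<Rightarrow> real"
    by (simp add: fun_eq_iff sum_fun_apply)
  have p_sum: "p (\<Sum>x\<in>S. fscale (r x) (ev M (j \<sigma> x))) = (\<Sum>x\<in>S. fscale (r x) (ev (grp K) x))"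
    if "S \<subseteq> lat K \<sigma>" for S r
    unfolding p.sum p.scale using that by (intro sum.cong) (auto simp: p_j[OF s] subset_iff)
  fix w
  {
    assume "w \<in> cn \<sigma>"
    then obtain S r where S: "finite S" "S \<subseteq> lat K \<sigma>" "(\<Sum>x\<in>S. fscale (r x) (ev (grp K) x)) \<in> \<sigma>"
      "w = (\<Sum>x\<in>S. fscale (r x) (ev M (j \<sigma> x)))"
      unfolding lin_img_def sum_eq by blast
    have "w \<in> W \<sigma>" unfolding S(4) using S(2)
      by (intro fv.span_sum fv.span_scale fv.span_base) auto
    then show "w \<in> {w \<in> W \<sigma>. p w \<in> \<sigma>}" using S p_sum[OF S(2)] by simp
  next
    assume w: "w \<in> {w \<in> W \<sigma>. p w \<in> \<sigma>}"
    then obtain T r where T: "finite T" "T \<subseteq> (\<lambda>x. ev M (j \<sigma> x)) ` lat K \<sigma>" "w = (\<Sum>a\<in>T. fscale (r a) a)"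
      unfolding fv.span_explicit image_image by blast
    \<comment> \<open>Coefficients in the span are indexed by vectors, those in
      \<open>lin_img\<close> by lattice elements. One preimage for each vector avoids counting a
      coefficient twice.\<close>
    obtain S where S: "S \<subseteq> lat K \<sigma>" "inj_on (\<lambda>x. ev M (j \<sigma> x)) S" "T = (\<lambda>x. ev M (j \<sigma> x)) ` S"
      using T(2) by (auto simp: subset_image_inj)
    have fS: "finite S" using T(1) S finite_image_iff by blast
    have wS: "w = (\<Sum>x\<in>S. fscale (r (ev M (j \<sigma> x))) (ev M (j \<sigma> x)))"
      unfolding T(3) S(3) by (simp add: sum.reindex[OF S(2)])
    then show "w \<in> cn \<sigma>" using w p_sum[OF S(1), of "\<lambda>x. r (ev M (j \<sigma> x))"] S(1) fS
      unfolding lin_img_def sum_eq by auto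
  }
qed

lemma p_cn:
  assumes s: "\<sigma> \<in> cones K" shows "p ` cn \<sigma> = \<sigma>"
proof -
  have "\<sigma> \<subseteq> p ` W \<sigma>" using p_W[OF s] fv.span_superset by auto
  then show ?thesis unfolding cn_eq[OF s] by auto
qed

text \<open>Makes the union that defines \<open>lat U\<close> at a cone consist of a single
  member.\<close>

lemma cn_inj: "inj_on cn (cones K)"
  by (rule inj_on_inverseI[where g = "\<lambda>\<sigma>. p ` \<sigma>"]) (rule p_cn)

lemma lat_U_cn: "\<sigma> \<in> cones K \<Longrightarrow> lat U (cn \<sigma>) = j \<sigma> ` lat K \<sigma>"
  unfolding lat_U using cn_inj by (auto simp: inj_on_def)

lemma cn_subset_W: "\<sigma> \<in> cones K \<Longrightarrow> cn \<sigma> \<subseteq> W \<sigma>"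
  by (simp add: cn_eq)

lemma p_inj_cn: "\<sigma> \<in> cones K \<Longrightarrow> inj_on p (cn \<sigma>)"
  by (rule inj_on_subset[OF p_inj_W cn_subset_W])

text \<open>Generators of \<open>\<sigma>\<close> taken from the lattice are moved by
  \<open>j \<sigma>\<close>. The cone they generate and \<open>cn \<sigma>\<close> lie in
  \<open>W \<sigma>\<close> and have the same image under \<open>p\<close>, so they agree by
  injectivity there.\<close>

lemma cn_is_cone:
  assumes s: "\<sigma> \<in> cones K" shows "is_cone M (cn \<sigma>)"
proof -
  obtain S where S: "finite S" "S \<subseteq> lat K \<sigma>" "\<sigma> = gen_cone (ev (grp K) ` S)"
    using cone_generators[OF s] by blast
  let ?G = "gen_cone (ev M ` j \<sigma> ` S)"
  have "p ` ev M ` j \<sigma> ` S = ev (grp K) ` S" using p_j[OF s] S(2) by (force simp: image_image)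
  then have pG: "p ` ?G = \<sigma>" using gen_cone_image[OF flinear_realify, of M "grp K" b "ev M ` j \<sigma> ` S"] by (simp flip: S(3))
  have GW: "?G \<subseteq> W \<sigma>"
  proof -
    have "fv.span (ev M ` j \<sigma> ` S) \<subseteq> W \<sigma>" using S(2) by (intro fv.span_mono) auto
    then show ?thesis using gen_cone_subset_span by blast
  qed
  have "p ` ?G = p ` cn \<sigma>" using pG p_cn[OF s] by simp
  then have "?G = cn \<sigma>"
    using inj_on_image_eq_iff[OF p_inj_W[OF s] GW cn_subset_W[OF s]] by simp
  moreover have "j \<sigma> ` S \<subseteq> carrier M" using S(2) j_closed[OF s] by auto
  ultimately show ?thesis using S(1) unfolding is_cone_def by blast
qed

lemma span_cn:
  assumes s: "\<sigma> \<in> cones K" shows "fv.span (cn \<sigma>) = W \<sigma>"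
proof -
  have 1: "fv.span (cn \<sigma>) \<subseteq> W \<sigma>" using cn_subset_W[OF s] by (intro fv.span_minimal) auto
  have "p ` fv.span (cn \<sigma>) = p ` W \<sigma>" using p.span_image[of "cn \<sigma>"] p_cn[OF s] p_W[OF s] by simp
  then show ?thesis using inj_on_image_eq_iff[OF p_inj_W[OF s] 1 subset_refl] by blast
qed

lemma cn_sharp:
  assumes s: "\<sigma> \<in> cones K" shows "sharp (cn \<sigma>)"
  unfolding sharp_def
proof (intro ballI impI)
  fix v assume v: "v \<in> cn \<sigma>" "(\<lambda>\<phi>. - v \<phi>) \<in> cn \<sigma>"
  have "(\<lambda>\<phi>. - v \<phi>) = - v" by (simp add: fun_eq_iff)
  then have "p v \<in> \<sigma>" "- p v \<in> \<sigma>" using v cn_eq[OF s] p.neg[of v] by auto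
  moreover have "(\<lambda>\<phi>. - p v \<phi>) = - p v" by (simp add: fun_eq_iff)
  ultimately have "p v = (\<lambda>_. 0)" using cone_sharp[OF s] unfolding sharp_def by metis
  then have "p v = p 0" by (simp add: p.zero fun_eq_iff)
  moreover have "v \<in> W \<sigma>" using v(1) cn_subset_W[OF s] by blast
  ultimately have "v = 0" using inj_onD[OF p_inj_W[OF s]] fv.span_zero by blast
  then show "v = (\<lambda>_. 0)" by (simp add: fun_eq_iff)
qed

lemma W_face:
  assumes "\<sigma> \<in> cones K" "is_face (grp K) \<tau> \<sigma>" shows "W \<tau> \<subseteq> W \<sigma>"
proof (rule fv.span_mono)
  show "ev M ` j \<tau> ` lat K \<tau> \<subseteq> ev M ` j \<sigma> ` lat K \<sigma>"
    using lat_face_subset[OF assms] j_face[OF assms] by fastforce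
qed

text \<open>A vector of \<open>W \<sigma>\<close> lying over \<open>\<tau>\<close> shares its image
  with some vector of \<open>W \<tau>\<close>. Compatibility of \<open>j\<close> with faces puts
  that vector in \<open>W \<sigma>\<close>, where \<open>p\<close> is injective.\<close>

lemma cn_face:
  assumes s: "\<sigma> \<in> cones K" and t: "is_face (grp K) \<tau> \<sigma>"
  shows "cn \<tau> = {w \<in> cn \<sigma>. p w \<in> \<tau>}"
proof -
  have tc: "\<tau> \<in> cones K" using face_in_cones[OF s t] .
  have ts: "\<tau> \<subseteq> \<sigma>" using face_subset[OF t] .
  have "w \<in> W \<tau>" if w: "w \<in> W \<sigma>" "p w \<in> \<tau>" for w
  proof -
    obtain w' where w': "w' \<in> W \<tau>" "p w' = p w" using p_W[OF tc] w(2) fv.span_base by (metis imageE)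
    then have "w' \<in> W \<sigma>" using W_face[OF s t] by blast
    then have "w' = w" using p_inj_W[OF s] w w' by (auto simp: inj_on_def)
    then show ?thesis using w' by simp
  qed
  then show ?thesis unfolding cn_eq[OF s] cn_eq[OF tc] using ts W_face[OF s t] by auto
qed

lemma face_cn:
  assumes s: "\<sigma> \<in> cones K" and t: "is_face (grp K) \<tau> \<sigma>"
  shows "is_face M (cn \<tau>) (cn \<sigma>)"
proof -
  obtain l where l: "rlinear_on (realspace (grp K)) l" "\<forall>v\<in>\<sigma>. 0 \<le> l v" "\<tau> = {v \<in> \<sigma>. l v = 0}"
    using t by (auto simp: is_face_def)
  have "rlinear_on (realspace M) (\<lambda>v. l (p v))"
    by (rule rlinear_on_flinear[OF l(1) flinear_realify]) (use realify_realspace[OF b_dual] in auto)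
  moreover have "\<forall>v\<in>cn \<sigma>. 0 \<le> l (p v)" using l(2) cn_eq[OF s] by auto
  moreover have "cn \<tau> = {v \<in> cn \<sigma>. l (p v) = 0}"
    unfolding cn_face[OF s t] using l(3) cn_eq[OF s] by auto
  ultimately show ?thesis unfolding is_face_def by blast
qed

text \<open>A functional on \<open>M\<^sub>\<real>\<close> supporting a face of \<open>cn \<sigma>\<close> is pulled back along a linear left inverse
  of \<open>p\<close> on \<open>W \<sigma>\<close>.\<close>

lemma face_of_cn:
  assumes s: "\<sigma> \<in> cones K" and t: "is_face M \<tau>' (cn \<sigma>)"
  shows "\<exists>\<tau>. is_face (grp K) \<tau> \<sigma> \<and> \<tau>' = cn \<tau>"
proof -
  obtain l where l: "rlinear_on (realspace M) l" "\<forall>v\<in>cn \<sigma>. 0 \<le> l v" "\<tau>' = {v \<in> cn \<sigma>. l v = 0}"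
    using t by (auto simp: is_face_def)
  obtain g where g: "range g \<subseteq> W \<sigma>" "flinear g" "\<forall>v\<in>W \<sigma>. g (p v) = v"
    using fvp.linear_exists_left_inverse_on[OF flinear_realify fv.subspace_span p_inj_W[OF s]] by blast
  let ?\<tau> = "{v \<in> \<sigma>. l (g v) = 0}"
  have gl: "rlinear_on (realspace (grp K)) (\<lambda>v. l (g v))"
    by (rule rlinear_on_flinear[OF l(1) g(2)]) (use g(1) W_realspace in blast)
  have gp: "g (p v) = v" if "v \<in> cn \<sigma>" for v using g(3) that cn_subset_W[OF s] by blast
  have "\<forall>v\<in>\<sigma>. 0 \<le> l (g v)"
  proof
    fix v assume "v \<in> \<sigma>"
    then obtain w where "w \<in> cn \<sigma>" "v = p w" using p_cn[OF s] by blast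
    then show "0 \<le> l (g v)" using gp l(2) by simp
  qed
  then have f: "is_face (grp K) ?\<tau> \<sigma>" using gl unfolding is_face_def by blast
  have "\<tau>' = cn ?\<tau>" unfolding cn_face[OF s f] l(3) using gp cn_eq[OF s] by auto
  then show ?thesis using f by blast
qed

lemma face_cn_iff:
  assumes "\<sigma> \<in> cones K" "\<tau> \<in> cones K"
  shows "is_face M (cn \<tau>) (cn \<sigma>) \<longleftrightarrow> is_face (grp K) \<tau> \<sigma>"
  using face_cn[OF assms(1)] face_of_cn[OF assms(1)] face_in_cones[OF assms(1)] inj_onD[OF cn_inj _ assms(2)]
  by metis

text \<open>\<open>p\<close> need not be injective on \<open>W \<sigma>\<close> and
  \<open>W \<tau>\<close> together, so equality cannot be tested after applying \<open>p\<close>.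
  Instead \<open>\<sigma> \<inter> \<tau>\<close> is a face of both cones, and
  \<open>cn_face\<close> describes its lift inside each of them.\<close>

lemma cn_inter:
  assumes "\<sigma> \<in> cones K" "\<tau> \<in> cones K"
  shows "cn \<sigma> \<inter> cn \<tau> = cn (\<sigma> \<inter> \<tau>)"
proof -
  note f = inter_face[OF assms]
  have "cn (\<sigma> \<inter> \<tau>) = {w \<in> cn \<sigma>. p w \<in> \<sigma> \<inter> \<tau>}" "cn (\<sigma> \<inter> \<tau>) = {w \<in> cn \<tau>. p w \<in> \<sigma> \<inter> \<tau>}"
    using cn_face[OF assms(1) f(1)] cn_face[OF assms(2) f(2)] by blast+
  then show ?thesis using cn_eq[OF assms(1)] cn_eq[OF assms(2)] by auto
qed

lemma is_fan_U: "is_fan M (cones U)"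
  unfolding is_fan_def cones_U
proof (intro conjI ballI allI impI)
  show "finite (cn ` cones K)" "cn ` cones K \<noteq> {}" using finite_cones cones_nonempty by auto
next
  fix \<sigma>' assume "\<sigma>' \<in> cn ` cones K"
  then obtain \<sigma> where s: "\<sigma> \<in> cones K" "\<sigma>' = cn \<sigma>" by blast
  show "is_cone M \<sigma>'" "sharp \<sigma>'" using cn_is_cone cn_sharp s by auto
  show "\<tau>' \<in> cn ` cones K" if "is_face M \<tau>' \<sigma>'" for \<tau>'
    using face_of_cn[OF s(1), of \<tau>'] that s face_in_cones by blast
  fix \<tau>' assume "\<tau>' \<in> cn ` cones K"
  then obtain \<tau> where t: "\<tau> \<in> cones K" "\<tau>' = cn \<tau>" by blast
  show "is_face M (\<sigma>' \<inter> \<tau>') \<sigma>'" "is_face M (\<sigma>' \<inter> \<tau>') \<tau>'"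
    unfolding s t cn_inter[OF s(1) t(1)] using face_cn inter_face s t by auto
qed

lemma ev_mem_W_iff:
  assumes s: "\<sigma> \<in> cones K" and t: "is_face (grp K) \<tau> \<sigma>" and x: "x \<in> lat K \<sigma>"
  shows "ev M (j \<sigma> x) \<in> W \<tau> \<longleftrightarrow> x \<in> lat K \<tau>"
proof
  have tc: "\<tau> \<in> cones K" using face_in_cones[OF s t] .
  assume "ev M (j \<sigma> x) \<in> W \<tau>"
  then have "ev (grp K) x \<in> fv.span \<tau>" using p_W[OF tc] p_j[OF s x] by (metis imageI)
  then show "x \<in> lat K \<tau>" using lat_face[OF s t] x by simp
next
  assume "x \<in> lat K \<tau>"
  then show "ev M (j \<sigma> x) \<in> W \<tau>" using j_face[OF s t] by (intro fv.span_base) auto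
qed

lemma km_fan_U: "km_fan U"
proof -
  have "subgroup (lat U \<sigma>') M \<and> lat U \<sigma>' \<subseteq> Nsig M \<sigma>' \<and> torsion_free M (lat U \<sigma>')
      \<and> finite {lat U \<sigma>' #>\<^bsub>M\<^esub> x | x. x \<in> Nsig M \<sigma>'}" if c: "\<sigma>' \<in> cones U" for \<sigma>'
  proof -
    obtain \<sigma> where s: "\<sigma> \<in> cones K" "\<sigma>' = cn \<sigma>" using c cones_U by blast
    have L: "lat U \<sigma>' = j \<sigma> ` lat K \<sigma>" using lat_U_cn s by simp
    have sg: "subgroup (lat U \<sigma>') M" unfolding L by (rule j_image_subgroup[OF s(1)])
    have Ns: "Nsig M \<sigma>' = {y \<in> carrier M. ev M y \<in> W \<sigma>}"
      by (simp add: Nsig_def rspan_eq_span span_cn s)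
    have "lat U \<sigma>' \<subseteq> Nsig M \<sigma>'"
      unfolding Ns L using j_closed[OF s(1)] by (auto intro: fv.span_base)
    moreover have "torsion_free M (lat U \<sigma>')"
      unfolding torsion_free_def L
    proof (intro ballI allI impI)
      fix y and n :: nat assume y: "y \<in> j \<sigma> ` lat K \<sigma>" and n: "0 < n \<and> y [^]\<^bsub>M\<^esub> n = \<one>\<^bsub>M\<^esub>"
      obtain x where x: "x \<in> lat K \<sigma>" "y = j \<sigma> x" using y by blast
      \<comment> \<open>A torsion element becomes zero in the real space of \<open>M\<close>.
        Applying \<open>p\<close> gives \<open>ev (grp K) x = 0\<close>, and the torsion-free group
        \<open>lat K \<sigma>\<close> embeds under \<open>ev\<close>.\<close>
      have "fscale n (ev M y) = 0"
        using ev_nat_pow[OF M, of y n] n ev_one[OF M] j_closed[OF s(1) x(1)] x by simp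
      then have "ev M y = 0" using n by (simp add: fun_eq_iff)
      then have "ev (grp K) x = ev (grp K) \<one>\<^bsub>grp K\<^esub>"
        using p_j[OF s(1) x(1)] x p.zero by (simp add: ev_one[OF N.comm_group_axioms])
      then have "x = \<one>\<^bsub>grp K\<^esub>"
        using torsion_free_ev_inj[OF N.comm_group_axioms fg lat_subgroup[OF s(1)] lat_torsion_free[OF s(1)]]
          x subgroup.one_closed[OF lat_subgroup[OF s(1)]] by (auto simp: inj_on_def)
      then show "y = \<one>\<^bsub>M\<^esub>" using x group_hom.hom_one[OF group_hom_j[OF s(1)]] by simp
    qed
    moreover have "finite {lat U \<sigma>' #>\<^bsub>M\<^esub> x | x. x \<in> Nsig M \<sigma>'}"
    proof (rule finite_cosets_of_pow_mem[OF M fin_gen_M sg])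
      show "subgroup (Nsig M \<sigma>') M" unfolding Ns by (rule subgroup_ev_mem_subspace[OF M fv.subspace_span])
      fix y assume y: "y \<in> Nsig M \<sigma>'"
      show "\<exists>n::nat. n > 0 \<and> y [^]\<^bsub>M\<^esub> n \<in> lat U \<sigma>'"
      \<comment> \<open>Finite index follows from spans: a functional separating \<open>y\<close>
        from the lattice vanishes on generators of \<open>W \<sigma>\<close>, hence on
        \<open>ev M y\<close>.\<close>
      proof (rule ccontr)
        assume "\<not> ?thesis"
        then obtain \<phi> where \<phi>: "\<phi> \<in> zdual M" "\<forall>z\<in>lat U \<sigma>'. \<phi> z = 0" "\<phi> y \<noteq> 0"
          using zdual_separate[OF M fin_gen_M sg] y Ns by blast
        have "ev M y \<in> W \<sigma>" using y Ns by simp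
        then have "ev M y \<phi> = 0"
        proof (rule fv.span_induct[where P = "\<lambda>v. v \<phi> = 0"])
          show "fv.subspace {v. v \<phi> = 0}" by (simp add: fv.subspace_def)
        qed (use \<phi> L in \<open>auto simp: ev_def\<close>)
        then show False using \<phi> by (simp add: ev_def)
      qed
    qed
    ultimately show ?thesis using sg by blast
  qed
  moreover have "lat U \<tau>' = {x \<in> lat U \<sigma>'. ev M x \<in> rspan \<tau>'}"
    if c: "\<sigma>' \<in> cones U" "\<tau>' \<in> cones U" "is_face M \<tau>' \<sigma>'" for \<sigma>' \<tau>'
  proof -
    obtain \<sigma> \<tau> where s: "\<sigma> \<in> cones K" "\<sigma>' = cn \<sigma>" "\<tau> \<in> cones K" "\<tau>' = cn \<tau>"
      using c(1,2) unfolding cones_U by (elim imageE)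
    then have f: "is_face (grp K) \<tau> \<sigma>" using c face_cn_iff by simp
    have "j \<tau> ` lat K \<tau> = {y \<in> j \<sigma> ` lat K \<sigma>. ev M y \<in> W \<tau>}"
      using ev_mem_W_iff[OF s(1) f] j_face[OF s(1) f] lat_face_subset[OF s(1) f] by force
    then show ?thesis using s by (simp add: lat_U_cn rspan_eq_span span_cn)
  qed
  ultimately show ?thesis unfolding km_fan_def using M fin_gen_M is_fan_U by simp
qed

text \<open>The generation condition under which \<open>semi_tame_mono\<close> gives uniqueness of
  morphisms out of \<open>U\<close>.\<close>

lemma generate_lat_U: "generate M (\<Union>\<sigma>\<in>cones U. lat U \<sigma>) = carrier M"
proof -
  have "(\<Union>\<sigma>\<in>cones U. lat U \<sigma>) = (\<Union>\<sigma>\<in>cones K. j \<sigma> ` lat K \<sigma>)"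
    unfolding cones_U using lat_U_cn by simp
  then show ?thesis using j_generate by simp
qed

lemma semi_tame_U:
  assumes b: "b \<in> hom M (grp K)" and bj: "\<And>\<sigma> x. \<sigma> \<in> cones K \<Longrightarrow> x \<in> lat K \<sigma> \<Longrightarrow> b (j \<sigma> x) = x"
  shows "semi_tame U K b"
proof -
  have L: "b ` lat U (cn \<sigma>) = lat K \<sigma>" if s: "\<sigma> \<in> cones K" for \<sigma>
    unfolding lat_U_cn[OF s] using bj[OF s] by force
  have "bij_betw b (lat U (cn \<sigma>)) (lat K \<sigma>)" if s: "\<sigma> \<in> cones K" for \<sigma>
    using L[OF s] unfolding bij_betw_def lat_U_cn[OF s] by (auto simp: inj_on_def bj[OF s])
  moreover have "bij_betw (\<lambda>\<sigma>. p ` \<sigma>) (cones U) (cones K)"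
    unfolding bij_betw_def cones_U by (auto simp: inj_on_def p_cn image_image)
  moreover have "km_morphism U K b"
    unfolding km_morphism_def cones_U grp_U using b
    by (intro conjI ballI) (auto simp: L p_cn)
  ultimately show ?thesis unfolding semi_tame_def by (auto simp: cones_U p_cn p_inj_cn)
qed

lemma tame_U:
  assumes b: "b \<in> hom M (grp K)" and bj: "\<And>\<sigma> x. \<sigma> \<in> cones K \<Longrightarrow> x \<in> lat K \<sigma> \<Longrightarrow> b (j \<sigma> x) = x"
    and a: "atoroidal K" and k: "torsion_free M (kernel M (grp K) b)"
  shows "tame U K b"
proof -
  interpret b: group_hom M "grp K" b using b by (simp add: group_hom_def group_hom_axioms_def M.is_group N.is_group)
  have "lat K \<sigma> \<subseteq> b ` carrier M" if "\<sigma> \<in> cones K" for \<sigma>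
    using bj[OF that] j_closed[OF that] by (metis image_eqI subsetI)
  then have "finite (rcosets\<^bsub>grp K\<^esub> (b ` carrier M))"
    by (rule atoroidal_finite_cosets[OF a b.img_is_subgroup])
  then show ?thesis using semi_tame_U[OF b bj] k by (simp add: tame_def)
qed

text \<open>For \<open>y\<close> in \<open>Nsig\<close> of a lifted cone, \<open>b y\<close> lies in
  \<open>Nsig\<close> of \<open>\<sigma>\<close>, which is the lattice since \<open>K\<close> is
  classical. Then \<open>j \<sigma> (b y)\<close> and \<open>y\<close> have equal images under
  \<open>p\<close> inside \<open>W \<sigma>\<close>, and torsion-freeness of \<open>M\<close> makes
  them equal.\<close>

lemma classical_U:
  assumes c: "classical K" and t: "torsion_free M (carrier M)" and b: "b \<in> hom M (grp K)"
  shows "classical U"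
proof -
  have "lat U \<sigma>' = Nsig M \<sigma>'" if c': "\<sigma>' \<in> cones U" for \<sigma>'
  proof
    obtain \<sigma> where s: "\<sigma> \<in> cones K" "\<sigma>' = cn \<sigma>" using c' cones_U by blast
    show "lat U \<sigma>' \<subseteq> Nsig M \<sigma>'" using km_fan_U c' by (simp add: km_fan_def)
    show "Nsig M \<sigma>' \<subseteq> lat U \<sigma>'"
    proof
      fix y assume "y \<in> Nsig M \<sigma>'"
      then have y: "y \<in> carrier M" "ev M y \<in> W \<sigma>" using s by (auto simp: Nsig_def rspan_eq_span span_cn)
      have pe: "p (ev M y) = ev (grp K) (b y)" using realify_ev[OF b_dual y(1)] .
      then have "ev (grp K) (b y) \<in> fv.span \<sigma>" using y p_W[OF s(1)] by (metis imageI)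
      then have "b y \<in> Nsig (grp K) \<sigma>" using b y(1) by (auto simp: Nsig_def rspan_eq_span hom_def)
      then have x: "b y \<in> lat K \<sigma>" using c s(1) by (simp add: classical_def)
      have "p (ev M (j \<sigma> (b y))) = p (ev M y)" using p_j[OF s(1) x] pe by simp
      moreover have "ev M (j \<sigma> (b y)) \<in> W \<sigma>" using x by (auto intro: fv.span_base)
      ultimately have "ev M (j \<sigma> (b y)) = ev M y" using y p_inj_W[OF s(1)] by (auto simp: inj_on_def)
      then have "j \<sigma> (b y) = y"
        using torsion_free_ev_inj[OF M fin_gen_M M.subgroup_self t] y(1) j_closed[OF s(1) x] by (auto simp: inj_on_def)
      then show "y \<in> lat U \<sigma>'" using x s lat_U_cn by force
    qed
  qed
  then show ?thesis using km_fan_U t by (simp add: classical_def lattice_km_def)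
qed

end

section \<open>Morphisms\<close>

lemma km_morphism_hom: "km_morphism K K' f \<Longrightarrow> f \<in> hom (grp K) (grp K')"
  by (simp add: km_morphism_def)

lemma km_morphism_dual_map:
  assumes "km_fan K" "km_morphism K K' f" shows "dual_map (grp K) (grp K') f"
proof -
  interpret kmf K by (rule kmf.intro) fact
  show ?thesis using dual_map_hom[OF N.monoid_axioms km_morphism_hom[OF assms(2)]] .
qed

lemma realify_comp_morphism:
  assumes "km_fan K2" "km_morphism K1 K2 f" "km_morphism K2 K3 g"
  shows "realify (grp K1) (grp K3) (\<lambda>x. g (f x)) v
    = realify (grp K2) (grp K3) g (realify (grp K1) (grp K2) f v)"
  using realify_comp[OF _ km_morphism_dual_map[OF assms(1,3)], of f "grp K1"] km_morphism_hom[OF assms(2)]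
  by (simp add: hom_def)

lemma km_morphism_id:
  assumes "km_fan K" shows "km_morphism K K (\<lambda>x. x)"
proof -
  interpret kmf K by (rule kmf.intro) fact
  have "realify (grp K) (grp K) (\<lambda>x. x) ` \<sigma> \<subseteq> \<sigma>" if "\<sigma> \<in> cones K" for \<sigma>
    using realify_id cone_realspace[OF that] by fastforce
  then show ?thesis by (auto simp: km_morphism_def hom_def)
qed

lemma km_morphism_comp:
  assumes "km_fan K2" and f: "km_morphism K1 K2 f" and g: "km_morphism K2 K3 g"
  shows "km_morphism K1 K3 (\<lambda>x. g (f x))"
proof -
  note r = realify_comp_morphism[OF assms]
  have "\<exists>\<rho>\<in>cones K3. realify (grp K1) (grp K3) (\<lambda>x. g (f x)) ` \<sigma> \<subseteq> \<rho> \<and> (\<lambda>x. g (f x)) ` lat K1 \<sigma> \<subseteq> lat K3 \<rho>"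
    if s: "\<sigma> \<in> cones K1" for \<sigma>
  proof -
    obtain \<tau> where t: "\<tau> \<in> cones K2" "realify (grp K1) (grp K2) f ` \<sigma> \<subseteq> \<tau>" "f ` lat K1 \<sigma> \<subseteq> lat K2 \<tau>"
      using f s unfolding km_morphism_def by metis
    obtain \<rho> where p: "\<rho> \<in> cones K3" "realify (grp K2) (grp K3) g ` \<tau> \<subseteq> \<rho>" "g ` lat K2 \<tau> \<subseteq> lat K3 \<rho>"
      using g t(1) unfolding km_morphism_def by metis
    show ?thesis using t p by (intro bexI[of _ \<rho>]) (auto simp: r image_subset_iff)
  qed
  then show ?thesis using hom_compose[OF km_morphism_hom[OF f] km_morphism_hom[OF g]]
    by (simp add: km_morphism_def comp_def)
qed

lemma semi_tame_morphism: "semi_tame K K' f \<Longrightarrow> km_morphism K K' f"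
  by (simp add: semi_tame_def)

text \<open>Applied to \<open>beta\<close> followed by a semi-tame \<open>h\<close>: the composite
  is what the initial property of the other unfolding is tested against.\<close>

lemma semi_tame_comp:
  assumes K2: "km_fan K2" and f: "semi_tame K1 K2 f" and g: "semi_tame K2 K3 g"
  shows "semi_tame K1 K3 (\<lambda>x. g (f x))"
proof -
  let ?f = "realify (grp K1) (grp K2) f" and ?g = "realify (grp K2) (grp K3) g"
  have r: "realify (grp K1) (grp K3) (\<lambda>x. g (f x)) = (\<lambda>v. ?g (?f v))"
    using realify_comp_morphism[OF K2 semi_tame_morphism[OF f] semi_tame_morphism[OF g]] by blast
  have ri: "realify (grp K1) (grp K3) (\<lambda>x. g (f x)) ` \<sigma> = ?g ` ?f ` \<sigma>" for \<sigma>
    unfolding r by (simp add: image_image)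
  have F: "?f ` \<sigma> \<in> cones K2" "inj_on ?f \<sigma>" "bij_betw f (lat K1 \<sigma>) (lat K2 (?f ` \<sigma>))" if "\<sigma> \<in> cones K1" for \<sigma>
    using f that by (simp_all add: semi_tame_def)
  have G: "?g ` \<sigma> \<in> cones K3" "inj_on ?g \<sigma>" "bij_betw g (lat K2 \<sigma>) (lat K3 (?g ` \<sigma>))" if "\<sigma> \<in> cones K2" for \<sigma>
    using g that by (simp_all add: semi_tame_def)
  have "inj_on (\<lambda>v. ?g (?f v)) \<sigma>" if "\<sigma> \<in> cones K1" for \<sigma>
    using comp_inj_on[OF F(2)[OF that] G(2)[OF F(1)[OF that]]] by (simp add: comp_def)
  moreover have "bij_betw (\<lambda>x. g (f x)) (lat K1 \<sigma>) (lat K3 (?g ` ?f ` \<sigma>))" if "\<sigma> \<in> cones K1" for \<sigma>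
    using bij_betw_trans[OF F(3)[OF that] G(3)[OF F(1)[OF that]]] by (simp add: comp_def)
  moreover have "bij_betw (\<lambda>\<sigma>. ?g ` ?f ` \<sigma>) (cones K1) (cones K3)"
    using bij_betw_trans[of "\<lambda>\<sigma>. ?f ` \<sigma>" "cones K1" "cones K2" "\<lambda>\<sigma>. ?g ` \<sigma>" "cones K3"] f g
    by (simp add: semi_tame_def comp_def)
  ultimately show ?thesis
    unfolding semi_tame_def ri
    using km_morphism_comp[OF K2 semi_tame_morphism[OF f] semi_tame_morphism[OF g]] F(1) G(1)
    by (simp add: r)
qed

section \<open>Lifting faces and lattice elements along a semi-tame morphism\<close>

locale semi_tame_data = K: kmf K + K': kmf K' for K :: "'a kmfan" and K' :: "'b kmfan" +
  fixes f :: "'b \<Rightarrow> 'a"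
  assumes f: "semi_tame K' K f"
begin

abbreviation "q \<equiv> realify (grp K') (grp K) f"

sublocale q: Vector_Spaces.linear fscale fscale q
  by (rule flinear_realify)

lemma f_hom: "f \<in> hom (grp K') (grp K)"
  by (rule km_morphism_hom[OF semi_tame_morphism[OF f]])

lemma f_dual: "dual_map (grp K') (grp K) f"
  by (rule km_morphism_dual_map[OF K'.km semi_tame_morphism[OF f]])

lemma q_cone: "\<sigma> \<in> cones K' \<Longrightarrow> q ` \<sigma> \<in> cones K"
  and q_inj: "\<sigma> \<in> cones K' \<Longrightarrow> inj_on q \<sigma>"
  and f_bij_lat: "\<sigma> \<in> cones K' \<Longrightarrow> bij_betw f (lat K' \<sigma>) (lat K (q ` \<sigma>))"
  and q_bij_cones: "bij_betw (\<lambda>\<sigma>. q ` \<sigma>) (cones K') (cones K)"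
  using f by (simp_all add: semi_tame_def)

lemma q_inj_span: "\<sigma> \<in> cones K' \<Longrightarrow> inj_on q (fv.span \<sigma>)"
  by (rule inj_on_span_cone[OF is_cone_closed[OF K'.is_cone] flinear_realify q_inj])

text \<open>The supporting functional of \<open>\<tau>\<close> composed with \<open>q\<close> cuts
  out the required face of \<open>\<sigma>\<close>.\<close>

lemma face_lift:
  assumes s: "\<sigma> \<in> cones K'" and t: "is_face (grp K) \<tau> (q ` \<sigma>)"
  shows "\<exists>\<tau>'. is_face (grp K') \<tau>' \<sigma> \<and> q ` \<tau>' = \<tau>"
proof -
  obtain l where l: "rlinear_on (realspace (grp K)) l" "\<forall>v\<in>q ` \<sigma>. 0 \<le> l v" "\<tau> = {v \<in> q ` \<sigma>. l v = 0}"
    using t by (auto simp: is_face_def)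
  have "rlinear_on (realspace (grp K')) (\<lambda>v. l (q v))"
    by (rule rlinear_on_flinear[OF l(1) flinear_realify]) (use realify_realspace[OF f_dual] in auto)
  then have "is_face (grp K') {v \<in> \<sigma>. l (q v) = 0} \<sigma>" using l(2) unfolding is_face_def by blast
  moreover have "q ` {v \<in> \<sigma>. l (q v) = 0} = \<tau>" using l(3) by auto
  ultimately show ?thesis by blast
qed

text \<open>The lifted face and \<open>\<tau>\<close> are cones with the same image, and
  \<open>q\<close> is injective on the set of cones.\<close>

lemma face_reflect:
  assumes s: "\<sigma> \<in> cones K'" "\<tau> \<in> cones K'" and t: "is_face (grp K) (q ` \<tau>) (q ` \<sigma>)"
  shows "is_face (grp K') \<tau> \<sigma>"
proof -
  obtain \<tau>' where t': "is_face (grp K') \<tau>' \<sigma>" "q ` \<tau>' = q ` \<tau>" using face_lift[OF s(1) t] by blast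
  then have "\<tau>' = \<tau>"
    using inj_onD[OF bij_betw_imp_inj_on[OF q_bij_cones] t'(2) K'.face_in_cones[OF s(1) t'(1)] s(2)] by simp
  then show ?thesis using t' by simp
qed

text \<open>\<open>g1\<close> and \<open>g2\<close> may send a cone into different cones
  \<open>\<tau>1\<close> and \<open>\<tau>2\<close>, where injectivity of \<open>f\<close> on one
  lattice says nothing. After composing with \<open>f\<close>, the image lies in the common face of
  \<open>q \<tau>1\<close> and \<open>q \<tau>2\<close>. This face lifts to both cones, and the two
  lifts are the same cone because \<open>q\<close> is injective on cones. Both values lie in the
  lattice of that cone, on which \<open>f\<close> is injective.\<close>

lemma semi_tame_mono:
  assumes V: "km_fan V" "generate (grp V) (\<Union>\<sigma>\<in>cones V. lat V \<sigma>) = carrier (grp V)"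
    and g: "km_morphism V K' g1" "km_morphism V K' g2"
    and eq: "\<And>x. x \<in> carrier (grp V) \<Longrightarrow> f (g1 x) = f (g2 x)"
    and x: "x \<in> carrier (grp V)"
  shows "g1 x = g2 x"
proof -
  interpret V: kmf V by (rule kmf.intro) fact
  have "g1 x = g2 x" if s: "\<sigma> \<in> cones V" and x: "x \<in> lat V \<sigma>" for \<sigma> x
  proof -
    have xc: "x \<in> carrier (grp V)" using V.lat_carrier[OF s x] .
    obtain \<tau>1 where t1: "\<tau>1 \<in> cones K'" "realify (grp V) (grp K') g1 ` \<sigma> \<subseteq> \<tau>1" "g1 ` lat V \<sigma> \<subseteq> lat K' \<tau>1"
      using g(1) s unfolding km_morphism_def by metis
    obtain \<tau>2 where t2: "\<tau>2 \<in> cones K'" "realify (grp V) (grp K') g2 ` \<sigma> \<subseteq> \<tau>2" "g2 ` lat V \<sigma> \<subseteq> lat K' \<tau>2"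
      using g(2) s unfolding km_morphism_def by metis
    let ?h = "realify (grp V) (grp K) (\<lambda>x. f (g1 x))"
    have h1: "?h v = q (realify (grp V) (grp K') g1 v)" for v
      by (rule realify_comp_morphism[OF K'.km g(1) semi_tame_morphism[OF f]])
    have h2: "?h v = q (realify (grp V) (grp K') g2 v)" for v
      using realify_comp_morphism[OF K'.km g(2) semi_tame_morphism[OF f], of v]
        realify_cong[of "grp V" "\<lambda>x. f (g1 x)" "\<lambda>x. f (g2 x)" "grp K"] eq by simp
    let ?\<tau> = "q ` \<tau>1 \<inter> q ` \<tau>2"
    have "?h ` \<sigma> \<subseteq> q ` \<tau>1" unfolding h1 using t1(2) by blast
    moreover have "?h ` \<sigma> \<subseteq> q ` \<tau>2" unfolding h2 using t2(2) by blast
    ultimately have hs: "?h ` \<sigma> \<subseteq> ?\<tau>" by blast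
    have "?h ` fv.span \<sigma> \<subseteq> fv.span ?\<tau>"
      by (rule flinear_image_span_subset[OF flinear_realify]) (use hs fv.span_superset in blast)
    moreover have "dual_map (grp V) (grp K) (\<lambda>x. f (g1 x))"
      by (rule km_morphism_dual_map[OF V(1) km_morphism_comp[OF K'.km g(1) semi_tame_morphism[OF f]]])
    ultimately have evx: "ev (grp K) (f (g1 x)) \<in> fv.span ?\<tau>"
      using realify_ev[OF _ xc] V.lat_ev_span[OF s x] by (metis image_subset_iff)
    \<comment> \<open>The element \<open>gi\<close> already lies in the lattice of the lifted face:
      that lattice contains some \<open>z\<close> with the same image, and \<open>f\<close> is
      injective on the larger lattice of \<open>\<tau>i\<close>.\<close>
    have key: "\<exists>\<tau>'\<in>cones K'. q ` \<tau>' = ?\<tau> \<and> gi \<in> lat K' \<tau>'"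
      if ti: "\<tau>i \<in> cones K'" "is_face (grp K) ?\<tau> (q ` \<tau>i)" and gi: "gi \<in> lat K' \<tau>i" "f gi = f (g1 x)" for \<tau>i gi
    proof -
      obtain \<tau>' where t': "is_face (grp K') \<tau>' \<tau>i" "q ` \<tau>' = ?\<tau>" using face_lift[OF ti] by blast
      have tc: "\<tau>' \<in> cones K'" using K'.face_in_cones[OF ti(1) t'(1)] .
      have "f gi \<in> lat K (q ` \<tau>i)" using gi(1) f_bij_lat[OF ti(1)] by (metis bij_betwE)
      then have "f gi \<in> lat K ?\<tau>" using K.lat_face[OF q_cone[OF ti(1)] ti(2)] evx gi(2) by simp
      then obtain z where z: "z \<in> lat K' \<tau>'" "f z = f gi"
        using f_bij_lat[OF tc] t'(2) by (metis bij_betw_imp_surj_on imageE)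
      then have "z \<in> lat K' \<tau>i" using K'.lat_face_subset[OF ti(1) t'(1)] by blast
      then have "z = gi" using z gi(1) f_bij_lat[OF ti(1)] by (metis bij_betw_imp_inj_on inj_onD)
      then show ?thesis using z(1) tc t'(2) by blast
    qed
    obtain \<rho>1 where r1: "\<rho>1 \<in> cones K'" "q ` \<rho>1 = ?\<tau>" "g1 x \<in> lat K' \<rho>1"
      using key[OF t1(1) K.inter_face(1)[OF q_cone[OF t1(1)] q_cone[OF t2(1)]], of "g1 x"] t1(3) x by blast
    obtain \<rho>2 where r2: "\<rho>2 \<in> cones K'" "q ` \<rho>2 = ?\<tau>" "g2 x \<in> lat K' \<rho>2"
      using key[OF t2(1) K.inter_face(2)[OF q_cone[OF t1(1)] q_cone[OF t2(1)]], of "g2 x"] t2(3) x eq[OF xc] by auto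
    have "\<rho>1 = \<rho>2"
      using inj_onD[OF bij_betw_imp_inj_on[OF q_bij_cones] _ r1(1) r2(1)] r1(2) r2(2) by simp
    then show ?thesis
      using inj_onD[OF bij_betw_imp_inj_on[OF f_bij_lat[OF r1(1)]] eq[OF xc] r1(3)] r2(3) by simp
  qed
  then have S: "g1 y = g2 y" if "y \<in> (\<Union>\<sigma>\<in>cones V. lat V \<sigma>)" for y using that by blast
  have "(\<Union>\<sigma>\<in>cones V. lat V \<sigma>) \<subseteq> carrier (grp V)" using V.lat_carrier by blast
  then show ?thesis
    using hom_eq_on_generate[OF V.N.is_group K'.N.is_group km_morphism_hom[OF g(1)] km_morphism_hom[OF g(2)] _ S]
      x V(2) by blast
qed

definition cone_lift :: "'a rcone \<Rightarrow> 'b rcone" where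
  "cone_lift = the_inv_into (cones K') (\<lambda>\<sigma>. q ` \<sigma>)"

definition lat_lift :: "'a rcone \<Rightarrow> 'a \<Rightarrow> 'b" where
  "lat_lift \<sigma> = the_inv_into (lat K' (cone_lift \<sigma>)) f"

lemma cone_lift: "\<sigma> \<in> cones K \<Longrightarrow> cone_lift \<sigma> \<in> cones K'" "\<sigma> \<in> cones K \<Longrightarrow> q ` cone_lift \<sigma> = \<sigma>"
  unfolding cone_lift_def
  using bij_betwE[OF bij_betw_the_inv_into[OF q_bij_cones]] f_the_inv_into_f_bij_betw[OF q_bij_cones]
  by blast+

lemma lat_lift:
  assumes "\<sigma> \<in> cones K" "x \<in> lat K \<sigma>"
  shows "lat_lift \<sigma> x \<in> lat K' (cone_lift \<sigma>)" "f (lat_lift \<sigma> x) = x"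
  using f_bij_lat[OF cone_lift(1)[OF assms(1)]] cone_lift(2)[OF assms(1)] assms(2)
  unfolding lat_lift_def
  by (metis bij_betwE bij_betw_the_inv_into, metis f_the_inv_into_f_bij_betw)

lemma lat_lift_unique:
  assumes "\<sigma> \<in> cones K" "x \<in> lat K \<sigma>" "y \<in> lat K' (cone_lift \<sigma>)" "f y = x"
  shows "lat_lift \<sigma> x = y"
  using inj_onD[OF bij_betw_imp_inj_on[OF f_bij_lat[OF cone_lift(1)[OF assms(1)]]]]
    lat_lift[OF assms(1,2)] assms(3,4) by simp

lemma lat_lift_carrier: "\<sigma> \<in> cones K \<Longrightarrow> x \<in> lat K \<sigma> \<Longrightarrow> lat_lift \<sigma> x \<in> carrier (grp K')"
  using K'.lat_carrier[OF cone_lift(1) lat_lift(1)] .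

lemma lat_lift_mult:
  assumes s: "\<sigma> \<in> cones K" and xy: "x \<in> lat K \<sigma>" "y \<in> lat K \<sigma>"
  shows "lat_lift \<sigma> (x \<otimes>\<^bsub>grp K\<^esub> y) = lat_lift \<sigma> x \<otimes>\<^bsub>grp K'\<^esub> lat_lift \<sigma> y"
proof (rule lat_lift_unique[OF s])
  show "x \<otimes>\<^bsub>grp K\<^esub> y \<in> lat K \<sigma>" using subgroup.m_closed[OF K.lat_subgroup[OF s] xy] .
  show "lat_lift \<sigma> x \<otimes>\<^bsub>grp K'\<^esub> lat_lift \<sigma> y \<in> lat K' (cone_lift \<sigma>)"
    using subgroup.m_closed[OF K'.lat_subgroup[OF cone_lift(1)[OF s]] lat_lift(1)[OF s xy(1)] lat_lift(1)[OF s xy(2)]] .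
  show "f (lat_lift \<sigma> x \<otimes>\<^bsub>grp K'\<^esub> lat_lift \<sigma> y) = x \<otimes>\<^bsub>grp K\<^esub> y"
    using hom_mult[OF f_hom] lat_lift_carrier[OF s] lat_lift(2)[OF s] xy by simp
qed

text \<open>The cone over \<open>\<tau>\<close> is a face of the cone over \<open>\<sigma>\<close>,
  so both lifts lie in one lattice, where lifts are unique.\<close>

lemma lat_lift_face:
  assumes s: "\<sigma> \<in> cones K" and t: "is_face (grp K) \<tau> \<sigma>" and x: "x \<in> lat K \<tau>"
  shows "lat_lift \<tau> x = lat_lift \<sigma> x"
proof -
  have tc: "\<tau> \<in> cones K" using K.face_in_cones[OF s t] .
  have xs: "x \<in> lat K \<sigma>" using K.lat_face_subset[OF s t] x by blast
  have "is_face (grp K') (cone_lift \<tau>) (cone_lift \<sigma>)"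
    using face_reflect[OF cone_lift(1)[OF s] cone_lift(1)[OF tc]] cone_lift(2)[OF s] cone_lift(2)[OF tc] t by simp
  then have "lat_lift \<tau> x \<in> lat K' (cone_lift \<sigma>)"
    using K'.lat_face_subset[OF cone_lift(1)[OF s]] lat_lift(1)[OF tc x] by blast
  then show ?thesis using lat_lift_unique[OF s xs _ lat_lift(2)[OF tc x]] by simp
qed

text \<open>Stated for any unfolding data so as to cover \<open>unfold\<close> and
  \<open>urig\<close> alike. The two cases differ only in how the homomorphism \<open>G\<close> that
  restricts to the lattice lifts is obtained, so \<open>G\<close> is a hypothesis.\<close>

lemma lift_initial:
  assumes U: "unfolding_data K M j b" and b: "b \<in> hom M (grp K)"
    and bj: "\<And>\<sigma> x. \<sigma> \<in> cones K \<Longrightarrow> x \<in> lat K \<sigma> \<Longrightarrow> b (j \<sigma> x) = x"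
    and G: "G \<in> hom M (grp K')"
    and Gj: "\<And>\<sigma> x. \<sigma> \<in> cones K \<Longrightarrow> x \<in> lat K \<sigma> \<Longrightarrow> G (j \<sigma> x) = lat_lift \<sigma> x"
  shows "km_morphism (img_fan K M j) K' G \<and> (\<forall>x\<in>carrier M. f (G x) = b x)
    \<and> (\<forall>g'. km_morphism (img_fan K M j) K' g' \<and> (\<forall>x\<in>carrier M. f (g' x) = b x)
         \<longrightarrow> (\<forall>x\<in>carrier M. g' x = G x))"
proof -
  interpret U: unfolding_data K M j b by fact
  have fG: "(\<lambda>x. f (G x)) \<in> hom M (grp K)" using hom_compose[OF G f_hom] by (simp add: comp_def)
  have comm: "f (G x) = b x" if "x \<in> carrier M" for x
    by (rule hom_eq_on_generate[OF U.M.is_group K.N.is_group fG b, of "\<Union>\<sigma>\<in>cones K. j \<sigma> ` lat K \<sigma>"])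
      (use that U.j_generate U.j_closed Gj lat_lift(2) bj in auto)
  have Gd: "dual_map M (grp K') G" by (rule dual_map_hom[OF U.M.monoid_axioms G])
  let ?G = "realify M (grp K') G"
  have qG: "q (?G w) = U.p w" for w
    using realify_comp[OF _ f_dual, of G M] G realify_cong[of M "\<lambda>x. f (G x)" b] comm by (simp add: hom_def)
  \<comment> \<open>A vector of the image lies in the span of \<open>cone_lift \<sigma>\<close>, and
    \<open>q\<close> sends it into \<open>\<sigma>\<close>. Since \<open>q\<close> is injective on
    that span and maps the cone onto \<open>\<sigma>\<close>, the vector lies in the cone.\<close>
  have Gc: "?G ` U.cn \<sigma> \<subseteq> cone_lift \<sigma>" if s: "\<sigma> \<in> cones K" for \<sigma>
  proof
    fix v assume "v \<in> ?G ` U.cn \<sigma>"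
    then obtain w where w: "w \<in> U.cn \<sigma>" "v = ?G w" by blast
    have "?G ` U.W \<sigma> \<subseteq> fv.span (cone_lift \<sigma>)"
    proof (rule flinear_image_span_subset[OF flinear_realify], clarify)
      fix x assume x: "x \<in> lat K \<sigma>"
      have "?G (ev M (j \<sigma> x)) = ev (grp K') (lat_lift \<sigma> x)"
        using realify_ev[OF Gd U.j_closed[OF s x]] Gj[OF s x] by simp
      then show "?G (ev M (j \<sigma> x)) \<in> fv.span (cone_lift \<sigma>)"
        using K'.lat_ev_span[OF cone_lift(1)[OF s] lat_lift(1)[OF s x]] by simp
    qed
    then have v: "v \<in> fv.span (cone_lift \<sigma>)" using w U.cn_subset_W[OF s] by blast
    have "q v \<in> \<sigma>" using w qG U.cn_eq[OF s] by simp
    then obtain u where u: "u \<in> cone_lift \<sigma>" "q u = q v" using cone_lift(2)[OF s] by (metis imageE)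
    then have "u = v"
      using inj_onD[OF q_inj_span[OF cone_lift(1)[OF s]] u(2) fv.span_base[OF u(1)] v] by simp
    then show "v \<in> cone_lift \<sigma>" using u by simp
  qed
  have mor: "km_morphism (img_fan K M j) K' G"
    unfolding km_morphism_def
  proof (intro conjI ballI)
    show "G \<in> hom (grp U.U) (grp K')" using G by simp
    fix \<sigma>' assume "\<sigma>' \<in> cones U.U"
    then obtain \<sigma> where s: "\<sigma> \<in> cones K" "\<sigma>' = U.cn \<sigma>" unfolding U.cones_U by blast
    have "G ` lat U.U \<sigma>' \<subseteq> lat K' (cone_lift \<sigma>)"
      using U.lat_U_cn[OF s(1)] s(2) Gj[OF s(1)] lat_lift(1)[OF s(1)] by auto
    then show "\<exists>\<tau>\<in>cones K'. realify (grp U.U) (grp K') G ` \<sigma>' \<subseteq> \<tau> \<and> G ` lat U.U \<sigma>' \<subseteq> lat K' \<tau>"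
      using Gc[OF s(1)] s cone_lift(1)[OF s(1)] by auto
  qed
  have "g' x = G x" if "km_morphism U.U K' g'" "\<forall>x\<in>carrier M. f (g' x) = b x" "x \<in> carrier M" for g' x
    using semi_tame_mono[OF U.km_fan_U _ that(1) mor, of x] U.generate_lat_U that(2,3) comm by simp
  then show ?thesis using mor comm by blast
qed

end

section \<open>The colimit of the lattices\<close>

lemma group_hom_finprod:
  assumes "comm_group G" "comm_group H" "h \<in> hom G H" "finite A" "f \<in> A \<rightarrow> carrier G"
  shows "h (finprod G f A) = finprod H (\<lambda>x. h (f x)) A"
proof -
  interpret G: comm_group G by fact
  interpret H: comm_group H by fact
  interpret group_hom G H h using assms by (simp add: group_hom_def group_hom_axioms_def G.is_group H.is_group)
  show ?thesis using assms(4,5)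
  proof (induction A rule: finite_induct)
    case (insert a A)
    have "f \<in> A \<rightarrow> carrier G" "f a \<in> carrier G" using insert.prems by auto
    then have "(\<lambda>x. h (f x)) \<in> A \<rightarrow> carrier H" "h (f a) \<in> carrier H" by (auto simp: Pi_iff)
    then show ?case using insert by simp
  qed simp
qed

text \<open>The homomorphism out of the colimit induced by a cocone \<open>g\<close>, computed on a
  picked representative; compatibility of \<open>g\<close> with faces makes the pick immaterial.
  \<open>beta\<close> is the case of the inclusions.\<close>

definition colim_map :: "'a kmfan \<Rightarrow> 'b monoid \<Rightarrow> ('a rcone \<Rightarrow> 'a \<Rightarrow> 'b) \<Rightarrow> ('a rcone \<Rightarrow> 'a) set \<Rightarrow> 'b" where
  "colim_map K M g \<xi> = finprod M (\<lambda>\<sigma>. g \<sigma> ((SOME c. c \<in> \<xi>) \<sigma>)) (cones K)"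

context kmf
begin

lemma sumgrp_simps:
  "carrier (sumgrp K) = {c. (\<forall>\<sigma>\<in>cones K. c \<sigma> \<in> lat K \<sigma>) \<and> (\<forall>\<sigma>. \<sigma> \<notin> cones K \<longrightarrow> c \<sigma> = \<one>\<^bsub>grp K\<^esub>)}"
  "c \<otimes>\<^bsub>sumgrp K\<^esub> d = (\<lambda>\<sigma>. c \<sigma> \<otimes>\<^bsub>grp K\<^esub> d \<sigma>)"
  "\<one>\<^bsub>sumgrp K\<^esub> = (\<lambda>\<sigma>. \<one>\<^bsub>grp K\<^esub>)"
  by (simp_all add: sumgrp_def)

lemma sumgrp_carrier: "c \<in> carrier (sumgrp K) \<Longrightarrow> c \<sigma> \<in> carrier (grp K)"
  by (cases "\<sigma> \<in> cones K") (auto simp: sumgrp_simps lat_carrier)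

lemma sumgrp_lat: "c \<in> carrier (sumgrp K) \<Longrightarrow> \<sigma> \<in> cones K \<Longrightarrow> c \<sigma> \<in> lat K \<sigma>"
  by (simp add: sumgrp_simps)

lemma comm_group_sumgrp: "comm_group (sumgrp K)"
proof (rule comm_groupI)
  fix x y z assume x: "x \<in> carrier (sumgrp K)" and y: "y \<in> carrier (sumgrp K)" and z: "z \<in> carrier (sumgrp K)"
  note c = sumgrp_carrier[OF x] sumgrp_carrier[OF y] sumgrp_carrier[OF z]
  show "x \<otimes>\<^bsub>sumgrp K\<^esub> y \<in> carrier (sumgrp K)"
    using x y by (simp add: sumgrp_simps subgroup.m_closed[OF lat_subgroup])
  show "x \<otimes>\<^bsub>sumgrp K\<^esub> y \<otimes>\<^bsub>sumgrp K\<^esub> z = x \<otimes>\<^bsub>sumgrp K\<^esub> (y \<otimes>\<^bsub>sumgrp K\<^esub> z)"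
    using c by (simp add: sumgrp_simps(2) N.m_assoc)
  show "x \<otimes>\<^bsub>sumgrp K\<^esub> y = y \<otimes>\<^bsub>sumgrp K\<^esub> x"
    using c by (simp add: sumgrp_simps(2) N.m_comm)
  show "\<one>\<^bsub>sumgrp K\<^esub> \<otimes>\<^bsub>sumgrp K\<^esub> x = x" using c by (simp add: sumgrp_simps(2,3))
  have "(\<lambda>\<sigma>. inv\<^bsub>grp K\<^esub> x \<sigma>) \<in> carrier (sumgrp K)"
    using x by (simp add: sumgrp_simps subgroup.m_inv_closed[OF lat_subgroup])
  moreover have "(\<lambda>\<sigma>. inv\<^bsub>grp K\<^esub> x \<sigma>) \<otimes>\<^bsub>sumgrp K\<^esub> x = \<one>\<^bsub>sumgrp K\<^esub>" using c by (simp add: sumgrp_simps(2,3))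
  ultimately show "\<exists>y\<in>carrier (sumgrp K). y \<otimes>\<^bsub>sumgrp K\<^esub> x = \<one>\<^bsub>sumgrp K\<^esub>" by blast
next
  show "\<one>\<^bsub>sumgrp K\<^esub> \<in> carrier (sumgrp K)" by (simp add: sumgrp_simps subgroup.one_closed[OF lat_subgroup])
qed

sublocale S: comm_group "sumgrp K"
  by (rule comm_group_sumgrp)

lemma delta_carrier: "\<sigma> \<in> cones K \<Longrightarrow> x \<in> lat K \<sigma> \<Longrightarrow> delta K \<sigma> x \<in> carrier (sumgrp K)"
  by (auto simp: delta_def sumgrp_simps subgroup.one_closed[OF lat_subgroup])

lemma delta_mult: "delta K \<sigma> (x \<otimes>\<^bsub>grp K\<^esub> y) = delta K \<sigma> x \<otimes>\<^bsub>sumgrp K\<^esub> delta K \<sigma> y"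
  by (auto simp: delta_def sumgrp_simps)

lemma rel_carrier:
  assumes "\<sigma> \<in> cones K" "is_face (grp K) \<tau> \<sigma>" "x \<in> lat K \<tau>"
  shows "delta K \<sigma> x \<in> carrier (sumgrp K)" "delta K \<tau> x \<in> carrier (sumgrp K)"
  using assms delta_carrier face_in_cones lat_face_subset by blast+

text \<open>Serves in two ways: with \<open>H\<close> the relation subgroup itself it yields the
  defining relations, and with \<open>H\<close> a kernel it shows that a map descends to the
  colimit.\<close>

lemma rels_subset_iff:
  assumes H: "subgroup H (sumgrp K)"
  shows "rels K \<subseteq> H \<longleftrightarrow> (\<forall>\<sigma>\<in>cones K. \<forall>\<tau>. is_face (grp K) \<tau> \<sigma> \<longrightarrow>
    (\<forall>x\<in>lat K \<tau>. delta K \<sigma> x \<otimes>\<^bsub>sumgrp K\<^esub> inv\<^bsub>sumgrp K\<^esub> (delta K \<tau> x) \<in> H))"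
    (is "_ \<longleftrightarrow> ?R")
proof
  let ?G = "{delta K \<sigma> x \<otimes>\<^bsub>sumgrp K\<^esub> inv\<^bsub>sumgrp K\<^esub> (delta K \<tau> x) | \<sigma> \<tau> x.
        \<sigma> \<in> cones K \<and> \<tau> \<in> cones K \<and> is_face (grp K) \<tau> \<sigma> \<and> x \<in> lat K \<tau>}"
  show ?R if "rels K \<subseteq> H"
  proof (intro ballI allI impI)
    fix \<sigma> \<tau> x assume "\<sigma> \<in> cones K" "is_face (grp K) \<tau> \<sigma>" "x \<in> lat K \<tau>"
    then have "delta K \<sigma> x \<otimes>\<^bsub>sumgrp K\<^esub> inv\<^bsub>sumgrp K\<^esub> (delta K \<tau> x) \<in> ?G" using face_in_cones by blast
    then have "delta K \<sigma> x \<otimes>\<^bsub>sumgrp K\<^esub> inv\<^bsub>sumgrp K\<^esub> (delta K \<tau> x) \<in> rels K"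
      unfolding rels_def by (rule generate.incl)
    then show "delta K \<sigma> x \<otimes>\<^bsub>sumgrp K\<^esub> inv\<^bsub>sumgrp K\<^esub> (delta K \<tau> x) \<in> H" using that by blast
  qed
  show "rels K \<subseteq> H" if ?R
    unfolding rels_def by (rule S.generate_subgroup_incl[OF _ H]) (use that in blast)
qed

lemma rels_subgroup: "subgroup (rels K) (sumgrp K)"
  unfolding rels_def by (rule S.generate_is_subgroup) (auto intro!: S.m_closed S.inv_closed dest: rel_carrier)

lemma rels_normal: "normal (rels K) (sumgrp K)"
  by (rule S.subgroup_imp_normal[OF rels_subgroup])

lemma comm_group_Lambda: "comm_group (Lambda K)"
  unfolding Lambda_def by (rule S.abelian_FactGroup[OF rels_subgroup])

sublocale L: comm_group "Lambda K"
  by (rule comm_group_Lambda)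

lemma proj_hom: "(\<lambda>c. rels K #>\<^bsub>sumgrp K\<^esub> c) \<in> hom (sumgrp K) (Lambda K)"
  unfolding Lambda_def by (rule normal.r_coset_hom_Mod[OF rels_normal])

lemma Lambda_cases:
  assumes "\<xi> \<in> carrier (Lambda K)"
  obtains c where "c \<in> carrier (sumgrp K)" "\<xi> = rels K #>\<^bsub>sumgrp K\<^esub> c"
  using assms by (auto simp: Lambda_def carrier_FactGroup)

lemma iota_closed: "\<sigma> \<in> cones K \<Longrightarrow> x \<in> lat K \<sigma> \<Longrightarrow> iota K \<sigma> x \<in> carrier (Lambda K)"
  unfolding iota_def using hom_in_carrier[OF proj_hom delta_carrier] .

lemma iota_mult:
  "\<sigma> \<in> cones K \<Longrightarrow> x \<in> lat K \<sigma> \<Longrightarrow> y \<in> lat K \<sigma> \<Longrightarrow>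
    iota K \<sigma> (x \<otimes>\<^bsub>grp K\<^esub> y) = iota K \<sigma> x \<otimes>\<^bsub>Lambda K\<^esub> iota K \<sigma> y"
  unfolding iota_def delta_mult using hom_mult[OF proj_hom delta_carrier delta_carrier] .

lemma iota_face:
  assumes "\<sigma> \<in> cones K" "is_face (grp K) \<tau> \<sigma>" "x \<in> lat K \<tau>"
  shows "iota K \<tau> x = iota K \<sigma> x"
proof -
  note c = rel_carrier[OF assms]
  have r: "delta K \<sigma> x \<otimes>\<^bsub>sumgrp K\<^esub> inv\<^bsub>sumgrp K\<^esub> (delta K \<tau> x) \<in> rels K"
    using rels_subset_iff[OF rels_subgroup] assms by blast
  have "delta K \<sigma> x = delta K \<sigma> x \<otimes>\<^bsub>sumgrp K\<^esub> inv\<^bsub>sumgrp K\<^esub> (delta K \<tau> x) \<otimes>\<^bsub>sumgrp K\<^esub> delta K \<tau> x"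
    using c by (simp add: S.m_assoc)
  then have "iota K \<sigma> x = rels K #>\<^bsub>sumgrp K\<^esub>
      (delta K \<sigma> x \<otimes>\<^bsub>sumgrp K\<^esub> inv\<^bsub>sumgrp K\<^esub> (delta K \<tau> x)) #>\<^bsub>sumgrp K\<^esub> delta K \<tau> x"
    unfolding iota_def using c S.coset_mult_assoc[OF subgroup.subset[OF rels_subgroup]] by simp
  also have "\<dots> = iota K \<tau> x"
    unfolding iota_def using S.coset_join2[OF _ rels_subgroup r] c by simp
  finally show ?thesis by simp
qed

lemma iota_generate: "generate (Lambda K) (\<Union>\<sigma>\<in>cones K. iota K \<sigma> ` lat K \<sigma>) = carrier (Lambda K)"
proof
  let ?I = "\<Union>\<sigma>\<in>cones K. iota K \<sigma> ` lat K \<sigma>"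
  have IL: "?I \<subseteq> carrier (Lambda K)" using iota_closed by blast
  show "generate (Lambda K) ?I \<subseteq> carrier (Lambda K)" by (rule L.generate_incl[OF IL])
  have sg: "subgroup (generate (Lambda K) ?I) (Lambda K)" by (rule L.generate_is_subgroup[OF IL])
  show "carrier (Lambda K) \<subseteq> generate (Lambda K) ?I"
  proof
    fix \<xi> assume "\<xi> \<in> carrier (Lambda K)"
    then obtain c where c: "c \<in> carrier (sumgrp K)" "\<xi> = rels K #>\<^bsub>sumgrp K\<^esub> c" by (rule Lambda_cases)
    \<comment> \<open>The family truncated to \<open>A\<close>. Enlarging \<open>A\<close> by one
      cone multiplies it by a single \<open>delta\<close>, which reduces the claim to the images of
      the lattices.\<close>
    define cut where "cut A = (\<lambda>\<sigma>. if \<sigma> \<in> A then c \<sigma> else \<one>\<^bsub>grp K\<^esub>)" for A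
    have cc: "cut A \<in> carrier (sumgrp K)" for A
      using c(1) by (auto simp: cut_def sumgrp_simps subgroup.one_closed[OF lat_subgroup])
    have "rels K #>\<^bsub>sumgrp K\<^esub> cut A \<in> generate (Lambda K) ?I" if "finite A" "A \<subseteq> cones K" for A
      using that
    proof (induction A rule: finite_induct)
      case empty
      have "cut {} = \<one>\<^bsub>sumgrp K\<^esub>" by (simp add: cut_def sumgrp_simps)
      then have "rels K #>\<^bsub>sumgrp K\<^esub> cut {} = \<one>\<^bsub>Lambda K\<^esub>"
        using S.coset_mult_one[OF subgroup.subset[OF rels_subgroup]] by (simp add: Lambda_def)
      then show ?case using generate.one by metis
    next
      case (insert \<sigma> A)
      then have s: "\<sigma> \<in> cones K" by simp
      have l: "c \<sigma> \<in> lat K \<sigma>" using sumgrp_lat[OF c(1) s] .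
      have "cut (insert \<sigma> A) = delta K \<sigma> (c \<sigma>) \<otimes>\<^bsub>sumgrp K\<^esub> cut A"
        using insert.hyps sumgrp_carrier[OF c(1)] by (auto simp: cut_def delta_def sumgrp_simps fun_eq_iff)
      then have "rels K #>\<^bsub>sumgrp K\<^esub> cut (insert \<sigma> A) = iota K \<sigma> (c \<sigma>) \<otimes>\<^bsub>Lambda K\<^esub> (rels K #>\<^bsub>sumgrp K\<^esub> cut A)"
        unfolding iota_def using hom_mult[OF proj_hom delta_carrier[OF s l] cc] by simp
      moreover have "iota K \<sigma> (c \<sigma>) \<in> generate (Lambda K) ?I" using s l by (intro generate.incl) auto
      ultimately show ?case using insert subgroup.m_closed[OF sg] by simp
    qed
    then have "rels K #>\<^bsub>sumgrp K\<^esub> cut (cones K) \<in> generate (Lambda K) ?I" using finite_cones by blast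
    moreover have "cut (cones K) = c" using c(1) by (auto simp: cut_def sumgrp_simps)
    ultimately show "\<xi> \<in> generate (Lambda K) ?I" using c by simp
  qed
qed

end

section \<open>The universal property of the colimit\<close>

locale cocone = kmf K for K :: "'a kmfan" +
  fixes M :: "'b monoid" and g :: "'a rcone \<Rightarrow> 'a \<Rightarrow> 'b"
  assumes M: "comm_group M"
    and g_closed: "\<And>\<sigma> x. \<sigma> \<in> cones K \<Longrightarrow> x \<in> lat K \<sigma> \<Longrightarrow> g \<sigma> x \<in> carrier M"
    and g_mult: "\<And>\<sigma> x y. \<sigma> \<in> cones K \<Longrightarrow> x \<in> lat K \<sigma> \<Longrightarrow> y \<in> lat K \<sigma> \<Longrightarrow>
      g \<sigma> (x \<otimes>\<^bsub>grp K\<^esub> y) = g \<sigma> x \<otimes>\<^bsub>M\<^esub> g \<sigma> y"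
    and g_face: "\<And>\<sigma> \<tau> x. \<sigma> \<in> cones K \<Longrightarrow> is_face (grp K) \<tau> \<sigma> \<Longrightarrow> x \<in> lat K \<tau> \<Longrightarrow> g \<tau> x = g \<sigma> x"
begin

sublocale M: comm_group M by (rule M)

definition sum_map :: "('a rcone \<Rightarrow> 'a) \<Rightarrow> 'b" where
  "sum_map c = finprod M (\<lambda>\<sigma>. g \<sigma> (c \<sigma>)) (cones K)"

lemma g_one: "\<sigma> \<in> cones K \<Longrightarrow> g \<sigma> \<one>\<^bsub>grp K\<^esub> = \<one>\<^bsub>M\<^esub>"
  using g_mult[of \<sigma> "\<one>\<^bsub>grp K\<^esub>" "\<one>\<^bsub>grp K\<^esub>"] subgroup.one_closed[OF lat_subgroup, of \<sigma>] g_closed[of \<sigma> "\<one>\<^bsub>grp K\<^esub>"]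
  by simp

lemma sum_map_hom: "sum_map \<in> hom (sumgrp K) M"
proof (rule homI)
  fix c d assume c: "c \<in> carrier (sumgrp K)" "d \<in> carrier (sumgrp K)"
  have *: "(\<lambda>\<sigma>. g \<sigma> (c \<sigma>)) \<in> cones K \<rightarrow> carrier M" "(\<lambda>\<sigma>. g \<sigma> (d \<sigma>)) \<in> cones K \<rightarrow> carrier M"
    using c sumgrp_lat g_closed by auto
  show "sum_map c \<in> carrier M" unfolding sum_map_def by (rule M.finprod_closed[OF *(1)])
  have "sum_map (c \<otimes>\<^bsub>sumgrp K\<^esub> d) = finprod M (\<lambda>\<sigma>. g \<sigma> (c \<sigma>) \<otimes>\<^bsub>M\<^esub> g \<sigma> (d \<sigma>)) (cones K)"
    unfolding sum_map_def sumgrp_simps using c sumgrp_lat g_mult * by (intro M.finprod_cong') auto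
  then show "sum_map (c \<otimes>\<^bsub>sumgrp K\<^esub> d) = sum_map c \<otimes>\<^bsub>M\<^esub> sum_map d"
    using M.finprod_multf[OF *] by (simp add: sum_map_def)
qed

sublocale sm: group_hom "sumgrp K" M sum_map
  using sum_map_hom by (simp add: group_hom_def group_hom_axioms_def S.is_group M.is_group)

lemma sum_map_delta:
  assumes s: "\<sigma> \<in> cones K" and x: "x \<in> lat K \<sigma>"
  shows "sum_map (delta K \<sigma> x) = g \<sigma> x"
proof -
  have "sum_map (delta K \<sigma> x) = finprod M (\<lambda>\<rho>. if \<sigma> = \<rho> then g \<sigma> x else \<one>\<^bsub>M\<^esub>) (cones K)"
    unfolding sum_map_def using g_one g_closed[OF s x] s
    by (intro M.finprod_cong') (auto simp: delta_def)
  also have "\<dots> = g \<sigma> x"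
    using M.finprod_singleton[OF s finite_cones, of "\<lambda>_. g \<sigma> x"] g_closed[OF s x] by simp
  finally show ?thesis .
qed

lemma rels_kernel: "rels K \<subseteq> kernel (sumgrp K) M sum_map"
  unfolding rels_subset_iff[OF sm.subgroup_kernel]
proof (intro ballI allI impI)
  fix \<sigma> \<tau> x assume a: "\<sigma> \<in> cones K" "is_face (grp K) \<tau> \<sigma>" "x \<in> lat K \<tau>"
  note c = rel_carrier[OF a]
  have "sum_map (delta K \<sigma> x) = g \<sigma> x" "sum_map (delta K \<tau> x) = g \<sigma> x" "g \<sigma> x \<in> carrier M"
    using sum_map_delta a face_in_cones lat_face_subset g_face g_closed by (metis subsetD)+
  then show "delta K \<sigma> x \<otimes>\<^bsub>sumgrp K\<^esub> inv\<^bsub>sumgrp K\<^esub> (delta K \<tau> x) \<in> kernel (sumgrp K) M sum_map"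
    using c by (simp add: kernel_def)
qed

lemma colim_map_coset:
  assumes c: "c \<in> carrier (sumgrp K)"
  shows "colim_map K M g (rels K #>\<^bsub>sumgrp K\<^esub> c) = sum_map c"
proof -
  have "sum_map (h \<otimes>\<^bsub>sumgrp K\<^esub> c) = sum_map c" if "h \<in> rels K" for h
    using rels_kernel that c by (auto simp: kernel_def)
  then have "sum_map (SOME y. y \<in> rels K #>\<^bsub>sumgrp K\<^esub> c) = sum_map c"
    by (rule S.some_in_coset[OF rels_subgroup c])
  then show ?thesis by (simp add: colim_map_def sum_map_def)
qed

lemma colim_map_hom: "colim_map K M g \<in> hom (Lambda K) M"
proof (rule homI)
  fix x y assume "x \<in> carrier (Lambda K)" "y \<in> carrier (Lambda K)"
  then obtain c d where c: "c \<in> carrier (sumgrp K)" "x = rels K #>\<^bsub>sumgrp K\<^esub> c"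
    "d \<in> carrier (sumgrp K)" "y = rels K #>\<^bsub>sumgrp K\<^esub> d" by (metis Lambda_cases)
  show "colim_map K M g x \<in> carrier M" using c colim_map_coset by simp
  have "x \<otimes>\<^bsub>Lambda K\<^esub> y = rels K #>\<^bsub>sumgrp K\<^esub> (c \<otimes>\<^bsub>sumgrp K\<^esub> d)"
    using hom_mult[OF proj_hom c(1,3)] c by simp
  then show "colim_map K M g (x \<otimes>\<^bsub>Lambda K\<^esub> y) = colim_map K M g x \<otimes>\<^bsub>M\<^esub> colim_map K M g y"
    using c colim_map_coset by simp
qed

lemma colim_map_iota: "\<sigma> \<in> cones K \<Longrightarrow> x \<in> lat K \<sigma> \<Longrightarrow> colim_map K M g (iota K \<sigma> x) = g \<sigma> x"
  unfolding iota_def using colim_map_coset[OF delta_carrier] sum_map_delta by simp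

end

section \<open>The colimit and its torsion-free quotient as unfolding data\<close>

context kmf
begin

lemma beta_eq: "beta K = colim_map K (grp K) (\<lambda>\<sigma> x. x)"
  by (simp add: fun_eq_iff beta_def colim_map_def)

lemma beta_cocone: "cocone K (grp K) (\<lambda>\<sigma> x. x)"
  by unfold_locales (auto simp: lat_carrier)

lemma beta_hom: "beta K \<in> hom (Lambda K) (grp K)"
  unfolding beta_eq by (rule cocone.colim_map_hom[OF beta_cocone])

lemma beta_iota: "\<sigma> \<in> cones K \<Longrightarrow> x \<in> lat K \<sigma> \<Longrightarrow> beta K (iota K \<sigma> x) = x"
  unfolding beta_eq by (rule cocone.colim_map_iota[OF beta_cocone])

lemma unfold_eq: "unfold K = img_fan K (Lambda K) (iota K)"
  by (simp add: unfold_def img_fan_def)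

sublocale u: unfolding_data K "Lambda K" "iota K" "beta K"
  by unfold_locales
    (simp_all add: iota_closed iota_mult iota_face iota_generate beta_iota dual_map_hom[OF L.monoid_axioms beta_hom])

lemma qL_hom: "qL K \<in> hom (Lambda K) (LambdaBar K)"
  using normal.r_coset_hom_Mod[OF L.subgroup_imp_normal[OF L.tor_subgroup]]
  unfolding LambdaBar_def qL_def by (simp add: hom_def)

lemma comm_group_LambdaBar: "comm_group (LambdaBar K)"
  unfolding LambdaBar_def by (rule L.abelian_FactGroup[OF L.tor_subgroup])

lemma carrier_LambdaBar: "carrier (LambdaBar K) = qL K ` carrier (Lambda K)"
  by (simp add: LambdaBar_def carrier_FactGroup qL_def)

lemma LambdaBar_torsion_free: "torsion_free (LambdaBar K) (carrier (LambdaBar K))"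
  unfolding LambdaBar_def by (rule L.torsion_free_FactGroup_tor)

lemma some_qL:
  assumes "\<xi> \<in> carrier (Lambda K)" "\<And>t. t \<in> tor (Lambda K) \<Longrightarrow> f (t \<otimes>\<^bsub>Lambda K\<^esub> \<xi>) = f \<xi>"
  shows "f (SOME \<eta>. \<eta> \<in> qL K \<xi>) = f \<xi>"
  unfolding qL_def by (rule L.some_in_coset[OF L.tor_subgroup assms])

text \<open>A homomorphism into a torsion-free group kills torsion, so it is constant on the cosets
  of \<open>tor (Lambda K)\<close>. Used both for \<open>betabar\<close> and for the map into
  another lattice fan.\<close>

lemma hom_LambdaBar:
  assumes H: "comm_group H" "torsion_free H (carrier H)" and h: "h \<in> hom (Lambda K) H"
  shows "(\<lambda>\<Xi>. h (SOME \<xi>. \<xi> \<in> \<Xi>)) \<in> hom (LambdaBar K) H"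
    "\<And>\<xi>. \<xi> \<in> carrier (Lambda K) \<Longrightarrow> h (SOME \<eta>. \<eta> \<in> qL K \<xi>) = h \<xi>"
proof -
  interpret H: comm_group H by fact
  interpret h: group_hom "Lambda K" H h using h by (simp add: group_hom_def group_hom_axioms_def L.is_group H.is_group)
  have t: "h t = \<one>\<^bsub>H\<^esub>" if "t \<in> tor (Lambda K)" for t
  proof -
    obtain n :: nat where n: "t \<in> carrier (Lambda K)" "n > 0" "t [^]\<^bsub>Lambda K\<^esub> n = \<one>\<^bsub>Lambda K\<^esub>"
      using \<open>t \<in> tor (Lambda K)\<close> unfolding tor_def by blast
    then have "h t [^]\<^bsub>H\<^esub> n = \<one>\<^bsub>H\<^esub>" using h.hom_nat_pow[OF n(1), of n] by simp
    then show ?thesis using H(2) h.hom_closed[OF n(1)] n(2) unfolding torsion_free_def by blast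
  qed
  show *: "h (SOME \<eta>. \<eta> \<in> qL K \<xi>) = h \<xi>" if x: "\<xi> \<in> carrier (Lambda K)" for \<xi>
  proof (rule some_qL[OF x])
    fix t assume tt: "t \<in> tor (Lambda K)"
    then have "t \<in> carrier (Lambda K)" by (simp add: tor_def)
    then show "h (t \<otimes>\<^bsub>Lambda K\<^esub> \<xi>) = h \<xi>" using t[OF tt] x by simp
  qed
  show "(\<lambda>\<Xi>. h (SOME \<xi>. \<xi> \<in> \<Xi>)) \<in> hom (LambdaBar K) H"
  proof (rule homI)
    fix x y assume "x \<in> carrier (LambdaBar K)" "y \<in> carrier (LambdaBar K)"
    then obtain \<xi> \<eta> where e: "\<xi> \<in> carrier (Lambda K)" "x = qL K \<xi>" "\<eta> \<in> carrier (Lambda K)" "y = qL K \<eta>"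
      unfolding carrier_LambdaBar by blast
    show "h (SOME \<xi>. \<xi> \<in> x) \<in> carrier H" using e * by simp
    have "x \<otimes>\<^bsub>LambdaBar K\<^esub> y = qL K (\<xi> \<otimes>\<^bsub>Lambda K\<^esub> \<eta>)" using e hom_mult[OF qL_hom] by simp
    then show "h (SOME \<xi>. \<xi> \<in> x \<otimes>\<^bsub>LambdaBar K\<^esub> y) = h (SOME \<xi>. \<xi> \<in> x) \<otimes>\<^bsub>H\<^esub> h (SOME \<xi>. \<xi> \<in> y)"
      using e * by simp
  qed
qed

text \<open>If \<open>grp K\<close> has torsion, \<open>betabar\<close> depends on the
  representative picked, but only by the image of a torsion element of \<open>Lambda K\<close>, and
  integer functionals vanish on torsion.\<close>

lemma functional_betabar:
  assumes \<phi>: "\<phi> \<in> zdual (grp K)" and x: "\<xi> \<in> carrier (Lambda K)"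
  shows "\<phi> (betabar K (qL K \<xi>)) = \<phi> (beta K \<xi>)"
  unfolding betabar_def
proof (rule some_qL[OF x, where f = "\<lambda>\<xi>. \<phi> (beta K \<xi>)"])
  fix t assume tt: "t \<in> tor (Lambda K)"
  then have tc: "t \<in> carrier (Lambda K)" by (simp add: tor_def)
  have "(\<lambda>x. if x \<in> carrier (Lambda K) then \<phi> (beta K x) else 0) \<in> zdual (Lambda K)"
    using u.b_dual \<phi> by (simp add: dual_map_def)
  from zdual_tor[OF comm_group_Lambda this tt] have "\<phi> (beta K t) = 0" using tc by simp
  moreover have "\<phi> (beta K t \<otimes>\<^bsub>grp K\<^esub> beta K \<xi>) = \<phi> (beta K t) + \<phi> (beta K \<xi>)"
    using \<phi> tc x hom_in_carrier[OF beta_hom] by (simp add: zdual_def)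
  ultimately show "\<phi> (beta K (t \<otimes>\<^bsub>Lambda K\<^esub> \<xi>)) = \<phi> (beta K \<xi>)"
    using hom_mult[OF beta_hom tc x] by simp
qed

lemma betabar_dual_map: "dual_map (LambdaBar K) (grp K) (betabar K)"
  unfolding dual_map_def
proof
  fix \<phi> assume \<phi>: "\<phi> \<in> zdual (grp K)"
  interpret Lb: comm_group "LambdaBar K" by (rule comm_group_LambdaBar)
  have "\<phi> (betabar K (x \<otimes>\<^bsub>LambdaBar K\<^esub> y)) = \<phi> (betabar K x) + \<phi> (betabar K y)"
    if xy: "x \<in> carrier (LambdaBar K)" "y \<in> carrier (LambdaBar K)" for x y
  proof -
    obtain \<xi> \<eta> where e: "\<xi> \<in> carrier (Lambda K)" "x = qL K \<xi>" "\<eta> \<in> carrier (Lambda K)" "y = qL K \<eta>"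
      using xy unfolding carrier_LambdaBar by blast
    have "x \<otimes>\<^bsub>LambdaBar K\<^esub> y = qL K (\<xi> \<otimes>\<^bsub>Lambda K\<^esub> \<eta>)" using e hom_mult[OF qL_hom] by simp
    moreover have "\<phi> (beta K \<xi> \<otimes>\<^bsub>grp K\<^esub> beta K \<eta>) = \<phi> (beta K \<xi>) + \<phi> (beta K \<eta>)"
      using \<phi> e hom_in_carrier[OF beta_hom] by (simp add: zdual_def)
    ultimately show ?thesis using e functional_betabar[OF \<phi>] hom_mult[OF beta_hom] by simp
  qed
  then show "(\<lambda>x. if x \<in> carrier (LambdaBar K) then \<phi> (betabar K x) else 0) \<in> zdual (LambdaBar K)"
    by (simp add: zdual_def)
qed

lemma urig_eq: "urig K = img_fan K (LambdaBar K) (\<lambda>\<sigma>. qL K \<circ> iota K \<sigma>)"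
  by (simp add: urig_def img_fan_def)

lemma qL_iota_generate:
  "generate (LambdaBar K) (\<Union>\<sigma>\<in>cones K. (qL K \<circ> iota K \<sigma>) ` lat K \<sigma>) = carrier (LambdaBar K)"
proof -
  interpret Lb: comm_group "LambdaBar K" by (rule comm_group_LambdaBar)
  interpret q: group_hom "Lambda K" "LambdaBar K" "qL K"
    using qL_hom by (simp add: group_hom_def group_hom_axioms_def L.is_group Lb.is_group)
  have "(\<Union>\<sigma>\<in>cones K. (qL K \<circ> iota K \<sigma>) ` lat K \<sigma>) = qL K ` (\<Union>\<sigma>\<in>cones K. iota K \<sigma> ` lat K \<sigma>)"
    by (simp add: image_UN image_comp)
  moreover have "(\<Union>\<sigma>\<in>cones K. iota K \<sigma> ` lat K \<sigma>) \<subseteq> carrier (Lambda K)" using iota_closed by blast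
  ultimately show ?thesis using q.generate_img iota_generate carrier_LambdaBar by simp
qed

text \<open>Holds without torsion-freeness of \<open>grp K\<close>, so the rigidified unfolding is a
  KM fan for every \<open>K\<close>.\<close>

sublocale ub: unfolding_data K "LambdaBar K" "\<lambda>\<sigma>. qL K \<circ> iota K \<sigma>" "betabar K"
proof (rule unfolding_data.intro[OF kmf_axioms], rule unfolding_data_axioms.intro)
  show "comm_group (LambdaBar K)" by (rule comm_group_LambdaBar)
  then interpret Lb: comm_group "LambdaBar K" .
  fix \<sigma> x assume s: "\<sigma> \<in> cones K" and x: "x \<in> lat K \<sigma>"
  note i = iota_closed[OF s x]
  show "(qL K \<circ> iota K \<sigma>) x \<in> carrier (LambdaBar K)" using i carrier_LambdaBar by simp
  show "ev (grp K) (betabar K ((qL K \<circ> iota K \<sigma>) x)) = ev (grp K) x"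
    using functional_betabar[OF _ i] beta_iota[OF s x] by (auto simp: ev_def)
  show "(qL K \<circ> iota K \<sigma>) (x \<otimes>\<^bsub>grp K\<^esub> y) = (qL K \<circ> iota K \<sigma>) x \<otimes>\<^bsub>LambdaBar K\<^esub> (qL K \<circ> iota K \<sigma>) y"
    if y: "y \<in> lat K \<sigma>" for y
    using iota_mult[OF s x y] hom_mult[OF qL_hom i iota_closed[OF s y]] by simp
next
  show "(qL K \<circ> iota K \<tau>) x = (qL K \<circ> iota K \<sigma>) x"
    if "\<sigma> \<in> cones K" "is_face (grp K) \<tau> \<sigma>" "x \<in> lat K \<tau>" for \<sigma> \<tau> x
    using iota_face[OF that] by simp
qed (rule qL_iota_generate betabar_dual_map)+

lemma betabar_hom:
  assumes "torsion_free (grp K) (carrier (grp K))"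
  shows "betabar K \<in> hom (LambdaBar K) (grp K)"
  using hom_LambdaBar(1)[OF N.comm_group_axioms assms beta_hom] by (simp add: betabar_def[abs_def])

lemma betabar_iota:
  assumes "torsion_free (grp K) (carrier (grp K))" "\<sigma> \<in> cones K" "x \<in> lat K \<sigma>"
  shows "betabar K ((qL K \<circ> iota K \<sigma>) x) = x"
  using hom_LambdaBar(2)[OF N.comm_group_axioms assms(1) beta_hom iota_closed[OF assms(2,3)]] beta_iota[OF assms(2,3)]
  by (simp add: betabar_def)

end

section \<open>Functoriality and rigidification\<close>

lemma lin_img_realify:
  assumes q: "dual_map M M' q" and h: "h ` G \<subseteq> carrier M"
  shows "realify M M' q ` lin_img N M h G \<sigma> = lin_img N M' (q \<circ> h) G \<sigma>"
proof -
  interpret q: Vector_Spaces.linear fscale fscale "realify M M' q" by (rule flinear_realify)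
  have s: "(\<lambda>\<phi>. \<Sum>x\<in>S. r x * f x \<phi>) = (\<Sum>x\<in>S. fscale (r x) (f x))"
    for S :: "'c set" and r and f :: "'c \<Rightarrow> ('x \<Rightarrow> int) \<Rightarrow> real"
    by (simp add: fun_eq_iff sum_fun_apply)
  have e: "realify M M' q (\<Sum>x\<in>S. fscale (r x) (ev M (h x))) = (\<Sum>x\<in>S. fscale (r x) (ev M' ((q \<circ> h) x)))"
    if "S \<subseteq> G" for S r
    unfolding q.sum q.scale using that h by (intro sum.cong) (auto simp: realify_ev[OF q] image_subset_iff subset_iff)
  show ?thesis
  proof
    show "realify M M' q ` lin_img N M h G \<sigma> \<subseteq> lin_img N M' (q \<circ> h) G \<sigma>"
      unfolding lin_img_def s using e by fastforce
    show "lin_img N M' (q \<circ> h) G \<sigma> \<subseteq> realify M M' q ` lin_img N M h G \<sigma>"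
    proof
      fix w assume "w \<in> lin_img N M' (q \<circ> h) G \<sigma>"
      then obtain S r where S: "finite S" "S \<subseteq> G" "(\<Sum>x\<in>S. fscale (r x) (ev N x)) \<in> \<sigma>"
        "w = (\<Sum>x\<in>S. fscale (r x) (ev M' ((q \<circ> h) x)))"
        unfolding lin_img_def s by blast
      then have "(\<Sum>x\<in>S. fscale (r x) (ev M (h x))) \<in> lin_img N M h G \<sigma>"
        unfolding lin_img_def s by (intro CollectI exI[of _ S] exI[of _ r] conjI refl)
      moreover have "w = realify M M' q (\<Sum>x\<in>S. fscale (r x) (ev M (h x)))" using e[OF S(2)] S(4) by simp
      ultimately show "w \<in> realify M M' q ` lin_img N M h G \<sigma>" by (simp only: imageI)
    qed
  qed
qed

section \<open>Functoriality of the unfolding\<close>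

locale km_mor = K: kmf K + K': kmf K' for K :: "'a kmfan" and K' :: "'b kmfan" +
  fixes h :: "'a \<Rightarrow> 'b"
  assumes h: "km_morphism K K' h"
begin

abbreviation "hR \<equiv> realify (grp K) (grp K') h"
abbreviation "tgt \<equiv> tgt_cone K K' h"

text \<open>The condition under the \<open>SOME\<close> of \<open>tgt_cone\<close>, isolated because
  other cones than the selected one may satisfy it.\<close>

definition valid_target :: "'a rcone \<Rightarrow> 'b rcone \<Rightarrow> bool" where
  "valid_target \<sigma> \<tau> \<longleftrightarrow> \<tau> \<in> cones K' \<and> hR ` \<sigma> \<subseteq> \<tau> \<and> h ` lat K \<sigma> \<subseteq> lat K' \<tau>"

lemma tgt_valid: "\<sigma> \<in> cones K \<Longrightarrow> valid_target \<sigma> (tgt \<sigma>)"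
  using h someI_ex[of "valid_target \<sigma>"]
  unfolding tgt_cone_def valid_target_def[abs_def] km_morphism_def Bex_def by simp

lemma h_hom: "h \<in> hom (grp K) (grp K')"
  by (rule km_morphism_hom[OF h])

lemma h_dual: "dual_map (grp K) (grp K') h"
  by (rule km_morphism_dual_map[OF K.km h])

text \<open>The image of \<open>\<sigma>\<close> lies in the common face of the two targets, so
  \<open>h x\<close> lies in the lattice of that face, where both structure maps agree with the one
  of the face.\<close>

lemma iota_target_unique:
  assumes s: "\<sigma> \<in> cones K" and x: "x \<in> lat K \<sigma>" and t: "valid_target \<sigma> \<tau>1" "valid_target \<sigma> \<tau>2"
  shows "iota K' \<tau>1 (h x) = iota K' \<tau>2 (h x)"
proof -
  have c: "\<tau>1 \<in> cones K'" "\<tau>2 \<in> cones K'" using t by (simp_all add: valid_target_def)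
  have "hR ` \<sigma> \<subseteq> \<tau>1 \<inter> \<tau>2" using t by (simp add: valid_target_def)
  then have "hR ` fv.span \<sigma> \<subseteq> fv.span (\<tau>1 \<inter> \<tau>2)"
    by (intro flinear_image_span_subset[OF flinear_realify]) (use fv.span_superset in blast)
  then have "ev (grp K') (h x) \<in> fv.span (\<tau>1 \<inter> \<tau>2)"
    using realify_ev[OF h_dual K.lat_carrier[OF s x]] K.lat_ev_span[OF s x] by (metis image_subset_iff)
  moreover have "h x \<in> lat K' \<tau>1" using t(1) x by (auto simp: valid_target_def)
  ultimately have "h x \<in> lat K' (\<tau>1 \<inter> \<tau>2)" using K'.lat_face[OF c(1) K'.inter_face(1)[OF c]] by simp
  then show ?thesis
    using K'.iota_face[OF c(1) K'.inter_face(1)[OF c]] K'.iota_face[OF c(2) K'.inter_face(2)[OF c]] by metis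
qed

lemma h_tgt_lat: "\<sigma> \<in> cones K \<Longrightarrow> x \<in> lat K \<sigma> \<Longrightarrow> h x \<in> lat K' (tgt \<sigma>)"
  and tgt_cones: "\<sigma> \<in> cones K \<Longrightarrow> tgt \<sigma> \<in> cones K'"
  using tgt_valid[of \<sigma>] by (auto simp: valid_target_def)

sublocale c: cocone K "Lambda K'" "\<lambda>\<sigma> x. iota K' (tgt \<sigma>) (h x)"
proof (rule cocone.intro[OF K.kmf_axioms], rule cocone_axioms.intro)
  show "comm_group (Lambda K')" by (rule K'.comm_group_Lambda)
  fix \<sigma> x assume s: "\<sigma> \<in> cones K" and x: "x \<in> lat K \<sigma>"
  show "iota K' (tgt \<sigma>) (h x) \<in> carrier (Lambda K')"
    by (rule K'.iota_closed[OF tgt_cones[OF s] h_tgt_lat[OF s x]])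
  show "iota K' (tgt \<sigma>) (h (x \<otimes>\<^bsub>grp K\<^esub> y)) = iota K' (tgt \<sigma>) (h x) \<otimes>\<^bsub>Lambda K'\<^esub> iota K' (tgt \<sigma>) (h y)"
    if y: "y \<in> lat K \<sigma>" for y
    using hom_mult[OF h_hom K.lat_carrier[OF s x] K.lat_carrier[OF s y]]
      K'.iota_mult[OF tgt_cones[OF s] h_tgt_lat[OF s x] h_tgt_lat[OF s y]] by simp
next
  fix \<sigma> \<tau> x assume a: "\<sigma> \<in> cones K" "is_face (grp K) \<tau> \<sigma>" "x \<in> lat K \<tau>"
  \<comment> \<open>The cone selected for a face need not be a face of the cone selected for
    \<open>\<sigma>\<close>, but the latter is also admissible for the face, and the value in the
    colimit does not depend on the target.\<close>
  have "valid_target \<tau> (tgt \<sigma>)"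
    using tgt_valid[OF a(1)] K.face_subset[OF a(2)] K.lat_face_subset[OF a(1,2)]
    unfolding valid_target_def by (meson image_mono order_trans)
  then show "iota K' (tgt \<tau>) (h x) = iota K' (tgt \<sigma>) (h x)"
    using iota_target_unique[OF K.face_in_cones[OF a(1,2)] a(3) tgt_valid[OF K.face_in_cones[OF a(1,2)]]] by simp
qed

text \<open>\<open>unfold_map\<close> multiplies in the sum group and then projects,
  \<open>colim_map\<close> the other way round; the projection is a homomorphism and commutes with
  the finite product.\<close>

lemma unfold_map_eq:
  assumes x: "\<xi> \<in> carrier (Lambda K)"
  shows "unfold_map K K' h \<xi> = colim_map K (Lambda K') (\<lambda>\<sigma> x. iota K' (tgt \<sigma>) (h x)) \<xi>"
proof -
  obtain c0 where c0: "c0 \<in> carrier (sumgrp K)" "\<xi> = rels K #>\<^bsub>sumgrp K\<^esub> c0" using x by (rule K.Lambda_cases)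
  define c where "c = (SOME c. c \<in> \<xi>)"
  have "c0 \<in> \<xi>" unfolding c0(2) by (rule K.S.rcos_self[OF c0(1) K.rels_subgroup])
  then have "c \<in> \<xi>" unfolding c_def by (rule someI[of "\<lambda>c. c \<in> \<xi>"])
  then have c: "c \<in> carrier (sumgrp K)"
    using K.S.r_coset_subset_G[OF subgroup.subset[OF K.rels_subgroup] c0(1)] c0(2) by blast
  have "(\<lambda>\<sigma>. delta K' (tgt \<sigma>) (h (c \<sigma>))) \<in> cones K \<rightarrow> carrier (sumgrp K')"
    using K'.delta_carrier[OF tgt_cones h_tgt_lat] K.sumgrp_lat[OF c] by auto
  then show ?thesis
    using group_hom_finprod[OF K'.comm_group_sumgrp K'.comm_group_Lambda K'.proj_hom K.finite_cones]
    by (simp add: unfold_map_def colim_map_def iota_def flip: c_def)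
qed

lemma unfold_map_hom: "unfold_map K K' h \<in> hom (Lambda K) (Lambda K')"
  using c.colim_map_hom by (auto simp: hom_def unfold_map_eq Pi_iff)

lemma unfold_map_iota:
  "\<sigma> \<in> cones K \<Longrightarrow> x \<in> lat K \<sigma> \<Longrightarrow> unfold_map K K' h (iota K \<sigma> x) = iota K' (tgt \<sigma>) (h x)"
  using unfold_map_eq[OF K.iota_closed] c.colim_map_iota by simp

lemma beta_unfold_map:
  assumes "\<xi> \<in> carrier (Lambda K)"
  shows "beta K' (unfold_map K K' h \<xi>) = h (beta K \<xi>)"
proof (rule hom_eq_on_generate[where S = "\<Union>\<sigma>\<in>cones K. iota K \<sigma> ` lat K \<sigma>"
      and f = "\<lambda>\<xi>. beta K' (unfold_map K K' h \<xi>)" and g = "\<lambda>\<xi>. h (beta K \<xi>)"])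
  show "group (Lambda K)" "group (grp K')" by (rule K.L.is_group K'.N.is_group)+
  show "(\<lambda>\<xi>. beta K' (unfold_map K K' h \<xi>)) \<in> hom (Lambda K) (grp K')"
    using hom_compose[OF unfold_map_hom K'.beta_hom] by (simp add: comp_def)
  show "(\<lambda>\<xi>. h (beta K \<xi>)) \<in> hom (Lambda K) (grp K')"
    using hom_compose[OF K.beta_hom h_hom] by (simp add: comp_def)
  show "(\<Union>\<sigma>\<in>cones K. iota K \<sigma> ` lat K \<sigma>) \<subseteq> carrier (Lambda K)" using K.iota_closed by blast
  show "\<xi> \<in> generate (Lambda K) (\<Union>\<sigma>\<in>cones K. iota K \<sigma> ` lat K \<sigma>)" using assms K.iota_generate by simp
  show "beta K' (unfold_map K K' h \<eta>) = h (beta K \<eta>)" if "\<eta> \<in> (\<Union>\<sigma>\<in>cones K. iota K \<sigma> ` lat K \<sigma>)" for \<eta>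
    using that unfold_map_iota K.beta_iota K'.beta_iota[OF tgt_cones h_tgt_lat] by auto
qed

text \<open>By \<open>cn_eq\<close>, a vector belongs to the lifted target cone once it lies in the
  span of the target lattice and its image under \<open>\<beta>_R\<close> lies in the target. The
  first holds on generators, the second by naturality of \<open>beta\<close>.\<close>

lemma unfold_map_morphism: "km_morphism (unfold K) (unfold K') (unfold_map K K' h)"
  unfolding km_morphism_def K.unfold_eq K'.unfold_eq K.u.grp_U K'.u.grp_U
proof (intro conjI ballI)
  let ?u = "unfold_map K K' h"
  let ?uR = "realify (Lambda K) (Lambda K') ?u"
  show "?u \<in> hom (Lambda K) (Lambda K')" by (rule unfold_map_hom)
  have ud: "dual_map (Lambda K) (Lambda K') ?u" by (rule dual_map_hom[OF K.L.monoid_axioms unfold_map_hom])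
  have comm: "K'.u.p (?uR w) = hR (K.u.p w)" for w
  proof -
    have "K'.u.p (?uR w) = realify (Lambda K) (grp K') (\<lambda>\<xi>. beta K' (?u \<xi>)) w"
      using realify_comp[OF _ K'.u.b_dual, of ?u "Lambda K"] unfold_map_hom by (simp add: hom_def)
    also have "\<dots> = realify (Lambda K) (grp K') (\<lambda>\<xi>. h (beta K \<xi>)) w"
      using realify_cong[of "Lambda K" "\<lambda>\<xi>. beta K' (?u \<xi>)" "\<lambda>\<xi>. h (beta K \<xi>)"] beta_unfold_map by metis
    also have "\<dots> = hR (K.u.p w)"
      using realify_comp[OF _ h_dual, of "beta K" "Lambda K"] K.beta_hom by (simp add: hom_def)
    finally show ?thesis .
  qed
  fix \<sigma>' assume "\<sigma>' \<in> cones K.u.U"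
  then obtain \<sigma> where s: "\<sigma> \<in> cones K" "\<sigma>' = K.u.cn \<sigma>" unfolding K.u.cones_U by blast
  note t = tgt_cones[OF s(1)]
  have "?uR ` K.u.W \<sigma> \<subseteq> K'.u.W (tgt \<sigma>)"
  proof (rule flinear_image_span_subset[OF flinear_realify], clarify)
    fix x assume x: "x \<in> lat K \<sigma>"
    have "?uR (ev (Lambda K) (iota K \<sigma> x)) = ev (Lambda K') (iota K' (tgt \<sigma>) (h x))"
      using realify_ev[OF ud K.iota_closed[OF s(1) x]] unfold_map_iota[OF s(1) x] by simp
    then show "?uR (ev (Lambda K) (iota K \<sigma> x)) \<in> K'.u.W (tgt \<sigma>)"
      using h_tgt_lat[OF s(1) x] by (auto intro: fv.span_base)
  qed
  then have "?uR ` \<sigma>' \<subseteq> K'.u.cn (tgt \<sigma>)"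
    unfolding s(2) K.u.cn_eq[OF s(1)] K'.u.cn_eq[OF t]
    using comm tgt_valid[OF s(1)] by (auto simp: valid_target_def)
  moreover have "?u ` lat K.u.U \<sigma>' \<subseteq> lat K'.u.U (K'.u.cn (tgt \<sigma>))"
    unfolding s(2) K.u.lat_U_cn[OF s(1)] K'.u.lat_U_cn[OF t]
    using unfold_map_iota[OF s(1)] h_tgt_lat[OF s(1)] by auto
  ultimately show "\<exists>\<tau>\<in>cones K'.u.U. ?uR ` \<sigma>' \<subseteq> \<tau> \<and> ?u ` lat K.u.U \<sigma>' \<subseteq> lat K'.u.U \<tau>"
    using t unfolding K'.u.cones_U by blast
qed

end

section \<open>Initiality and rigidification\<close>

context kmf
begin

lemma grp_unfold: "grp (unfold K) = Lambda K"
  by (simp add: unfold_eq)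

lemma km_fan_unfold: "km_fan (unfold K)"
  unfolding unfold_eq by (rule u.km_fan_U)

lemma generate_lat_unfold:
  "generate (grp (unfold K)) (\<Union>\<sigma>\<in>cones (unfold K). lat (unfold K) \<sigma>) = carrier (grp (unfold K))"
  using u.generate_lat_U by (simp add: unfold_eq)

lemma semi_tame_beta: "semi_tame (unfold K) K (beta K)"
  unfolding unfold_eq by (rule u.semi_tame_U[OF beta_hom beta_iota])

lemma semi_tame_data_unfold: "semi_tame_data K (unfold K) (beta K)"
  by (intro semi_tame_data.intro kmf_axioms kmf.intro km_fan_unfold semi_tame_data_axioms.intro semi_tame_beta)

lemma unfold_initial:
  fixes K' :: "'b kmfan"
  assumes "km_fan K'" "semi_tame K' K f"
  shows "\<exists>g. km_morphism (unfold K) K' g \<and> (\<forall>x\<in>carrier (Lambda K). f (g x) = beta K x)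
             \<and> (\<forall>g'. km_morphism (unfold K) K' g' \<and> (\<forall>x\<in>carrier (Lambda K). f (g' x) = beta K x)
                    \<longrightarrow> (\<forall>x\<in>carrier (Lambda K). g' x = g x))"
proof -
  interpret t: semi_tame_data K K' f
    by (intro semi_tame_data.intro kmf_axioms kmf.intro assms semi_tame_data_axioms.intro)
  interpret c: cocone K "grp K'" t.lat_lift
    by (intro cocone.intro kmf_axioms cocone_axioms.intro t.K'.N.comm_group_axioms
        t.lat_lift_carrier t.lat_lift_mult t.lat_lift_face)
  show ?thesis
    using t.lift_initial[OF u.unfolding_data_axioms beta_hom beta_iota c.colim_map_hom c.colim_map_iota]
    unfolding unfold_eq by blast
qed

lemma rig_unfold: "rig (unfold K) = urig K"
proof -
  have q: "(\<lambda>x. tor (Lambda K) #>\<^bsub>Lambda K\<^esub> x) = qL K" by (simp add: qL_def fun_eq_iff)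
  let ?qR = "realify (Lambda K) (LambdaBar K) (qL K)"
  have cn: "?qR ` u.cn \<sigma> = ub.cn \<sigma>" if "\<sigma> \<in> cones K" for \<sigma>
    by (rule lin_img_realify[OF dual_map_hom[OF L.monoid_axioms qL_hom]]) (use iota_closed[OF that] in auto)
  have "(\<lambda>\<sigma>. ?qR ` \<sigma>) ` cones u.U = cones ub.U"
    unfolding u.cones_U ub.cones_U image_image using cn by (intro image_cong) auto
  \<comment> \<open>Equality of triples requires the lattice components to agree at every set
    \<open>\<rho>\<close>, not only at cones, so the families under the two unions are compared
    directly.\<close>
  moreover have "\<Union>{qL K ` lat u.U \<sigma> | \<sigma>. \<sigma> \<in> cones u.U \<and> ?qR ` \<sigma> = \<rho>} = lat ub.U \<rho>" for \<rho>
  proof -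
    have "{qL K ` lat u.U \<sigma> | \<sigma>. \<sigma> \<in> cones u.U \<and> ?qR ` \<sigma> = \<rho>}
        = {(qL K \<circ> iota K \<sigma>) ` lat K \<sigma> | \<sigma>. \<sigma> \<in> cones K \<and> ub.cn \<sigma> = \<rho>}"
    proof (intro Set.set_eqI iffI)
      fix B assume "B \<in> {qL K ` lat u.U \<sigma> | \<sigma>. \<sigma> \<in> cones u.U \<and> ?qR ` \<sigma> = \<rho>}"
      then obtain \<sigma> where s: "\<sigma> \<in> cones K" "B = qL K ` lat u.U (u.cn \<sigma>)" "?qR ` u.cn \<sigma> = \<rho>"
        unfolding u.cones_U by blast
      then have "B = (qL K \<circ> iota K \<sigma>) ` lat K \<sigma>" "ub.cn \<sigma> = \<rho>"
        using u.lat_U_cn[OF s(1)] cn[OF s(1)] by (simp_all add: image_comp)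
      then show "B \<in> {(qL K \<circ> iota K \<sigma>) ` lat K \<sigma> | \<sigma>. \<sigma> \<in> cones K \<and> ub.cn \<sigma> = \<rho>}" using s(1) by blast
    next
      fix B assume "B \<in> {(qL K \<circ> iota K \<sigma>) ` lat K \<sigma> | \<sigma>. \<sigma> \<in> cones K \<and> ub.cn \<sigma> = \<rho>}"
      then obtain \<sigma> where s: "\<sigma> \<in> cones K" "B = (qL K \<circ> iota K \<sigma>) ` lat K \<sigma>" "ub.cn \<sigma> = \<rho>" by blast
      then have "B = qL K ` lat u.U (u.cn \<sigma>)" "?qR ` u.cn \<sigma> = \<rho>" "u.cn \<sigma> \<in> cones u.U"
        using u.lat_U_cn[OF s(1)] cn[OF s(1)] u.cones_U by (simp_all add: image_comp)
      then show "B \<in> {qL K ` lat u.U \<sigma> | \<sigma>. \<sigma> \<in> cones u.U \<and> ?qR ` \<sigma> = \<rho>}" by blast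
    qed
    then show ?thesis by (simp add: ub.lat_U)
  qed
  ultimately have "rig u.U = (LambdaBar K, cones ub.U, lat ub.U)"
    unfolding rig_def Let_def u.grp_U LambdaBar_def[symmetric] q by (simp add: fun_eq_iff)
  also have "\<dots> = ub.U" using ub.grp_U by (simp add: grp_def cones_def lat_def prod_eq_iff)
  finally show ?thesis by (simp add: unfold_eq urig_eq)
qed

text \<open>The colimit of the lattice lifts is a map from \<open>Lambda K\<close> into a
  torsion-free group, so it factors through \<open>LambdaBar K\<close>; this is where the other fan
  must be a lattice fan.\<close>

lemma urig_initial:
  fixes K' :: "'b kmfan"
  assumes tf: "torsion_free (grp K) (carrier (grp K))" and K': "lattice_km K'" "semi_tame K' K f"
  shows "\<exists>g. km_morphism (urig K) K' g \<and> (\<forall>x\<in>carrier (LambdaBar K). f (g x) = betabar K x)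
             \<and> (\<forall>g'. km_morphism (urig K) K' g' \<and> (\<forall>x\<in>carrier (LambdaBar K). f (g' x) = betabar K x)
                    \<longrightarrow> (\<forall>x\<in>carrier (LambdaBar K). g' x = g x))"
proof -
  have km': "km_fan K'" and tf': "torsion_free (grp K') (carrier (grp K'))" using K' by (simp_all add: lattice_km_def)
  interpret t: semi_tame_data K K' f
    by (intro semi_tame_data.intro kmf_axioms kmf.intro km' K'(2) semi_tame_data_axioms.intro)
  interpret c: cocone K "grp K'" t.lat_lift
    by (intro cocone.intro kmf_axioms cocone_axioms.intro t.K'.N.comm_group_axioms
        t.lat_lift_carrier t.lat_lift_mult t.lat_lift_face)
  note h = hom_LambdaBar[OF t.K'.N.comm_group_axioms tf' c.colim_map_hom]
  let ?G = "\<lambda>\<Xi>. colim_map K (grp K') t.lat_lift (SOME \<xi>. \<xi> \<in> \<Xi>)"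
  have "?G ((qL K \<circ> iota K \<sigma>) x) = t.lat_lift \<sigma> x" if "\<sigma> \<in> cones K" "x \<in> lat K \<sigma>" for \<sigma> x
    using h(2)[OF iota_closed[OF that]] c.colim_map_iota[OF that] by simp
  then show ?thesis
    using t.lift_initial[OF ub.unfolding_data_axioms betabar_hom[OF tf] betabar_iota[OF tf] h(1)]
    unfolding urig_eq by blast
qed

end

text \<open>The inverse comes from the initial property of \<open>unfold K'\<close> against the
  semi-tame composite of \<open>beta K\<close> and \<open>h\<close>. Both round trips agree with the
  identity after composition with a semi-tame morphism, namely that composite on one side and
  \<open>beta K'\<close> on the other, so they are identities by
  \<open>semi_tame_mono\<close>.\<close>

lemma unfold_map_semi_tame_iso:
  assumes K: "km_fan K" "km_fan K'" and st_h: "semi_tame K K' h"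
  shows "km_iso (unfold K) (unfold K') (unfold_map K K' h)"
proof -
  interpret km_mor K K' h
    by (intro km_mor.intro kmf.intro km_mor_axioms.intro K semi_tame_morphism[OF st_h])
  let ?u = "unfold_map K K' h"
  let ?hb = "\<lambda>x. h (beta K x)"
  have st: "semi_tame (unfold K) K' ?hb" by (rule semi_tame_comp[OF K(1) K.semi_tame_beta st_h])
  interpret b: semi_tame_data K' "unfold K" ?hb
    by (intro semi_tame_data.intro K'.kmf_axioms kmf.intro K.km_fan_unfold st semi_tame_data_axioms.intro)
  interpret b': semi_tame_data K' "unfold K'" "beta K'" by (rule K'.semi_tame_data_unfold)
  obtain g where g: "km_morphism (unfold K') (unfold K) g" "\<And>y. y \<in> carrier (Lambda K') \<Longrightarrow> h (beta K (g y)) = beta K' y"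
    using K'.unfold_initial[OF K.km_fan_unfold st] by blast
  note u = unfold_map_morphism
  have gc: "g y \<in> carrier (Lambda K)" if "y \<in> carrier (Lambda K')" for y
    using hom_in_carrier[OF km_morphism_hom[OF g(1)]] that by (simp add: K.grp_unfold K'.grp_unfold)
  have uc: "?u x \<in> carrier (Lambda K')" if "x \<in> carrier (Lambda K)" for x
    using hom_in_carrier[OF unfold_map_hom that] .
  have "g (?u x) = x" if x: "x \<in> carrier (grp (unfold K))" for x
    using b.semi_tame_mono[OF K.km_fan_unfold K.generate_lat_unfold
        km_morphism_comp[OF K'.km_fan_unfold u g(1)] km_morphism_id[OF K.km_fan_unfold] _ x]
      g(2)[OF uc] beta_unfold_map by (simp add: K.grp_unfold)
  moreover have "?u (g y) = y" if y: "y \<in> carrier (grp (unfold K'))" for y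
    using b'.semi_tame_mono[OF K'.km_fan_unfold K'.generate_lat_unfold
        km_morphism_comp[OF K.km_fan_unfold g(1) u] km_morphism_id[OF K'.km_fan_unfold] _ y]
      g(2) beta_unfold_map[OF gc] by (simp add: K'.grp_unfold)
  ultimately show ?thesis using u g(1) unfolding km_iso_def by blast
qed

text \<open>The target selected for \<open>\<sigma>\<close> under the identity may be a larger cone
  than \<open>\<sigma>\<close>, so the equality is not by definition. It follows because
  \<open>beta\<close> has the same composite with both sides.\<close>

lemma unfold_map_id:
  assumes K: "km_fan K" and x: "\<xi> \<in> carrier (Lambda K)"
  shows "unfold_map K K (\<lambda>x. x) \<xi> = \<xi>"
proof -
  interpret km_mor K K "\<lambda>x. x"
    by (intro km_mor.intro kmf.intro km_mor_axioms.intro K km_morphism_id)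
  interpret b: semi_tame_data K "unfold K" "beta K" by (rule K.semi_tame_data_unfold)
  show ?thesis
    using b.semi_tame_mono[OF K.km_fan_unfold K.generate_lat_unfold unfold_map_morphism
        km_morphism_id[OF K.km_fan_unfold]] beta_unfold_map x by (simp add: K.grp_unfold)
qed

text \<open>The targets selected for the composite need not be the composites of the selected
  targets; naturality of \<open>beta\<close> together with its cancellation property bypasses the
  choices.\<close>

lemma unfold_map_comp:
  assumes K: "km_fan K1" "km_fan K2" "km_fan K3" and h: "km_morphism K1 K2 h1" "km_morphism K2 K3 h2"
    and x: "\<xi> \<in> carrier (Lambda K1)"
  shows "unfold_map K1 K3 (\<lambda>x. h2 (h1 x)) \<xi> = unfold_map K2 K3 h2 (unfold_map K1 K2 h1 \<xi>)"
proof -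
  interpret m1: km_mor K1 K2 h1 by (intro km_mor.intro kmf.intro km_mor_axioms.intro K h)
  interpret m2: km_mor K2 K3 h2 by (intro km_mor.intro kmf.intro km_mor_axioms.intro K h)
  interpret m3: km_mor K1 K3 "\<lambda>x. h2 (h1 x)"
    by (intro km_mor.intro kmf.intro km_mor_axioms.intro K km_morphism_comp[OF K(2) h])
  interpret b: semi_tame_data K3 "unfold K3" "beta K3" by (rule m2.K'.semi_tame_data_unfold)
  have "beta K3 (unfold_map K1 K3 (\<lambda>x. h2 (h1 x)) \<eta>) = beta K3 (unfold_map K2 K3 h2 (unfold_map K1 K2 h1 \<eta>))"
    if "\<eta> \<in> carrier (Lambda K1)" for \<eta>
    using m3.beta_unfold_map[OF that] m1.beta_unfold_map[OF that]
      m2.beta_unfold_map[OF hom_in_carrier[OF m1.unfold_map_hom that]] by simp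
  then show ?thesis
    using b.semi_tame_mono[OF m1.K.km_fan_unfold m1.K.generate_lat_unfold m3.unfold_map_morphism
        km_morphism_comp[OF m1.K'.km_fan_unfold m1.unfold_map_morphism m2.unfold_map_morphism]] x
    by (simp add: m1.K.grp_unfold)
qed

theorem theorem4p3p6:
  fixes F :: "'a kmfan"
  assumes "km_fan F"
  shows
    "km_fan (unfold F)
     \<and> semi_tame (unfold F) F (beta F)
     \<and> (\<forall>(F' :: 'b kmfan) f. km_fan F' \<and> semi_tame F' F f \<longrightarrow>
          (\<exists>g. km_morphism (unfold F) F' g \<and> (\<forall>x\<in>carrier (Lambda F). f (g x) = beta F x)
             \<and> (\<forall>g'. km_morphism (unfold F) F' g' \<and> (\<forall>x\<in>carrier (Lambda F). f (g' x) = beta F x)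
                    \<longrightarrow> (\<forall>x\<in>carrier (Lambda F). g' x = g x))))
     \<and> (atoroidal F \<and> torsion_free (Lambda F) (kernel (Lambda F) (grp F) (beta F))
          \<longrightarrow> tame (unfold F) F (beta F))
     \<and> (\<forall>\<xi>\<in>carrier (Lambda F). unfold_map F F (\<lambda>x. x) \<xi> = \<xi>)
     \<and> (\<forall>(K2 :: 'b kmfan) h. km_fan K2 \<and> km_morphism F K2 h \<longrightarrow>
          km_morphism (unfold F) (unfold K2) (unfold_map F K2 h)
          \<and> (\<forall>\<xi>\<in>carrier (Lambda F). beta K2 (unfold_map F K2 h \<xi>) = h (beta F \<xi>))
          \<and> (semi_tame F K2 h \<longrightarrow> km_iso (unfold F) (unfold K2) (unfold_map F K2 h)))
     \<and> (\<forall>(K2 :: 'b kmfan) (K3 :: 'c kmfan) h1 h2.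
          km_fan K2 \<and> km_fan K3 \<and> km_morphism F K2 h1 \<and> km_morphism K2 K3 h2 \<longrightarrow>
          (\<forall>\<xi>\<in>carrier (Lambda F).
             unfold_map F K3 (h2 \<circ> h1) \<xi> = unfold_map K2 K3 h2 (unfold_map F K2 h1 \<xi>)))
     \<and> rig (unfold F) = urig F
     \<and> km_fan (urig F)
     \<and> (torsion_free (grp F) (carrier (grp F)) \<longrightarrow>
          semi_tame (urig F) F (betabar F)
          \<and> (\<forall>(F' :: 'b kmfan) f. lattice_km F' \<and> semi_tame F' F f \<longrightarrow>
               (\<exists>g. km_morphism (urig F) F' g \<and> (\<forall>x\<in>carrier (LambdaBar F). f (g x) = betabar F x)
                  \<and> (\<forall>g'. km_morphism (urig F) F' g'
                           \<and> (\<forall>x\<in>carrier (LambdaBar F). f (g' x) = betabar F x)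
                         \<longrightarrow> (\<forall>x\<in>carrier (LambdaBar F). g' x = g x))))
          \<and> (atoroidal F \<longrightarrow> tame (urig F) F (betabar F)))
     \<and> (classical F \<longrightarrow> classical (urig F))"
proof -
  interpret kmf F by (rule kmf.intro) fact
  have tame: "tame (unfold F) F (beta F)"
    if "atoroidal F" "torsion_free (Lambda F) (kernel (Lambda F) (grp F) (beta F))"
    unfolding unfold_eq by (rule u.tame_U[OF beta_hom beta_iota that])
  have natural: "km_morphism (unfold F) (unfold K2) (unfold_map F K2 h)"
    "\<And>\<xi>. \<xi> \<in> carrier (Lambda F) \<Longrightarrow> beta K2 (unfold_map F K2 h \<xi>) = h (beta F \<xi>)"
    if "km_fan K2" "km_morphism F K2 h" for K2 :: "'b kmfan" and h
  proof -
    interpret km_mor F K2 h by (intro km_mor.intro kmf.intro km_mor_axioms.intro assms that)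
    show "km_morphism (unfold F) (unfold K2) (unfold_map F K2 h)" by (rule unfold_map_morphism)
    show "beta K2 (unfold_map F K2 h \<xi>) = h (beta F \<xi>)" if "\<xi> \<in> carrier (Lambda F)" for \<xi>
      by (rule beta_unfold_map[OF that])
  qed
  have km_urig: "km_fan (urig F)" unfolding urig_eq by (rule ub.km_fan_U)
  have semi_tame_urig: "semi_tame (urig F) F (betabar F)" if "torsion_free (grp F) (carrier (grp F))"
    unfolding urig_eq by (rule ub.semi_tame_U[OF betabar_hom[OF that] betabar_iota[OF that]])
  have tame_urig: "tame (urig F) F (betabar F)"
    if tf: "torsion_free (grp F) (carrier (grp F))" and a: "atoroidal F"
  proof -
    \<comment> \<open>The kernel condition in tameness is automatic here, since the kernel sits
      inside a torsion-free group.\<close>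
    have "torsion_free (LambdaBar F) (kernel (LambdaBar F) (grp F) (betabar F))"
      using LambdaBar_torsion_free by (auto simp: torsion_free_def kernel_def)
    from ub.tame_U[OF betabar_hom[OF tf] betabar_iota[OF tf] a this]
    show ?thesis unfolding urig_eq .
  qed
  have classical_urig: "classical (urig F)" if "classical F"
    unfolding urig_eq
    by (rule ub.classical_U[OF that LambdaBar_torsion_free betabar_hom])
      (use that in \<open>simp add: classical_def lattice_km_def\<close>)
  note rules = km_fan_unfold semi_tame_beta unfold_initial tame unfold_map_id[OF assms] natural
    unfold_map_semi_tame_iso[OF assms] unfold_map_comp[OF assms] rig_unfold km_urig semi_tame_urig
    urig_initial tame_urig classical_urig
  show ?thesis
    unfolding comp_def by (intro conjI allI impI ballI; (elim conjE)?; rule rules; assumption)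
qed

end
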